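(* Suppose that $\mathcal{M}$ is a finitely generated von Neumann algebra with a tracial state $\tau$. Suppose that $\{\mathcal{N}_i\}_{i=1}^{\infty}$ is an ascending sequence of von Neumann subalgebras of $\mathcal{M}$ such that $\mathfrak{K}_2(\mathcal{N}_i)=0$ for all $i\ge1$ and $\mathcal{M}=\overline{\bigcup_i\mathcal{N}_i}^{SOT}$ (closure in the strong operator topology). Then $\mathfrak{K}_2(\mathcal{M})=0$.
   Context: Tracial states are faithful and normal; a subalgebra carries the restricted trace. Let $\mathcal{M}_k(\mathbb{C})$ be the $k\times k$ complex matrices, $\tau_k=\frac1k Tr$, $\mathcal{U}(k)$ the unitary group, and $\|(A_1,\ldots,A_n)\|_2^2=\sum_j\tau_k(A_j^*A_j)$ on $\mathcal{M}_k(\mathbb{C})^n$; $\|\cdot\|$ is the operator norm. For $R,\epsilon>0$ and $m,k\in\mathbb{N}$, $\Gamma_R(x_1,\ldots,x_n;m,k,\epsilon)$ is the set of $(A_1,\ldots,A_n)\in\mathcal{M}_k(\mathbb{C})^n$ with $\|A_j\|\le R$ for all $j$ and $|\tau_k(A_{i_1}^{\eta_1}\cdots A_{i_q}^{\eta_q})-\tau(x_{i_1}^{\eta_1}\cdots x_{i_q}^{\eta_q})|<\epsilon$ for all $1\le q\le m$, $1\le i_1,\ldots,i_q\le n$, $\eta_1,\ldots,\eta_q\in\{1,*\}$. For $\omega>0$, the $\omega$-orbit-ball $\mathcal{U}(B_1,\ldots,B_n;\omega)$ is the set of $(A_1,\ldots,A_n)\in\mathcal{M}_k(\mathbb{C})^n$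 for which there is $W\in\mathcal{U}(k)$ with $\|(A_1,\ldots,A_n)-(WB_1W^*,\ldots,WB_nW^* )\|_2<\omega$. The $\omega$-orbit covering number $\nu(\Gamma_R(x_1,\ldots,x_n;m,k,\epsilon),\omega)$ is the minimal number of $\omega$-orbit-balls with centers in $\Gamma_R(x_1,\ldots,x_n;m,k,\epsilon)$ that cover this set (by convention $\nu(\emptyset,\omega)=1$, so that the quantities below are $\ge0$ for $0<\omega<1$). Define $$\mathfrak{K}(x_1,\ldots,x_n;\omega,R)=\inf_{m\in\mathbb{N},\epsilon>0}\limsup_{k\to\infty}\frac{\log\nu(\Gamma_R(x_1,\ldots,x_n;m,k,\epsilon),\omega)}{-k^2\log\omega},$$ $\mathfrak{K}(x_1,\ldots,x_n;\omega)=\sup_{R>0}\mathfrak{K}(x_1,\ldots,x_n;\omega,R)$, and $\mathfrak{K}_2(x_1,\ldots,x_n)=\sup_{0<\omega<1}\mathfrak{K}(x_1,\ldots,x_n;\omega)$. For a finitely generated von Neumann algebra $\mathcal{M}$ with tracial state $\tau$, the upper free orbit-dimension $\mathfrak{K}_2(\mathcal{M})$ is the supremum of $\mathfrak{K}_2(x_1,\ldots,x_n)$ over all finite families $x_1,\ldots,x_n$ that generate $\mathcal{M}$ as a von Neumann algebra. Since $\mathfrak{K}_2$ is defined only for finitely generated algebras, any algebra to which it is applied is understood to be finitely generated. *)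

theory Defs
  imports "HOL-Analysis.Analysis" "Jordan_Normal_Form.Schur_Decomposition"
begin

section \<open>Complex Hilbert spaces and their bounded operators\<close>

text \<open>
  The real structure (real scalar multiplication, real inner product, norm) is the one underlying
  the complex structure, so that the library's type of bounded (real-)linear maps, its norm and its
  strong operator topology are available. The inner product is linear in the first argument.
\<close>

class complex_hilbert_space = real_inner + banach +
  fixes scaleC :: "complex \<Rightarrow> 'a \<Rightarrow> 'a" (infixr "*\<^sub>C" 75)
    and cinner :: "'a \<Rightarrow> 'a \<Rightarrow> complex"
  assumes scaleR_scaleC: "scaleR r x = complex_of_real r *\<^sub>C x"
    and scaleC_add_right: "c *\<^sub>C (x + y) = c *\<^sub>C x + c *\<^sub>C y"
    and scaleC_add_left: "(c + d) *\<^sub>C x = c *\<^sub>C x + d *\<^sub>C x"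
    and scaleC_scaleC: "c *\<^sub>C (d *\<^sub>C x) = (c * d) *\<^sub>C x"
    and inner_eq_Re_cinner: "inner x y = Re (cinner x y)"
    and cinner_commute: "cinner x y = cnj (cinner y x)"
    and cinner_add_left: "cinner (x + y) z = cinner x z + cinner y z"
    and cinner_scaleC_left: "cinner (c *\<^sub>C x) y = c * cinner x y"

lemma norm_scaleC:
  fixes x :: "'a::complex_hilbert_space"
  shows "norm (c *\<^sub>C x) = cmod c * norm x"
proof -
  have "cinner (c *\<^sub>C x) (c *\<^sub>C x) = c * cnj (c * cinner x x)"
    by (metis cinner_commute cinner_scaleC_left)
  also have "\<dots> = (c * cnj c) * cinner x x"
    using cinner_commute[of x x] by simp
  also have "\<dots> = of_real ((cmod c)\<^sup>2) * cinner x x"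
    by (simp only: complex_norm_square)
  finally have "inner (c *\<^sub>C x) (c *\<^sub>C x) = (cmod c)\<^sup>2 * inner x x"
    by (simp only: inner_eq_Re_cinner Re_complex_of_real Im_complex_of_real times_complex.sel)
  then show ?thesis
    by (simp add: norm_eq_sqrt_inner real_sqrt_mult)
qed

definition complex_linear :: "('h::complex_hilbert_space \<Rightarrow>\<^sub>L 'h) \<Rightarrow> bool" where
  "complex_linear T \<longleftrightarrow> (\<forall>c x. T (c *\<^sub>C x) = c *\<^sub>C T x)"

lift_definition blinfun_scaleC ::
  "complex \<Rightarrow> ('h::complex_hilbert_space \<Rightarrow>\<^sub>L 'h) \<Rightarrow> ('h \<Rightarrow>\<^sub>L 'h)"
  is "\<lambda>c T x. c *\<^sub>C T x"
proof -
  fix c :: complex and T :: "'h \<Rightarrow> 'h"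
  assume "bounded_linear T"
  moreover have "bounded_linear (\<lambda>x::'h. c *\<^sub>C x)"
    by (rule bounded_linear_intro[where K = "cmod c"])
      (simp_all add: scaleC_add_right scaleR_scaleC scaleC_scaleC norm_scaleC mult.commute)
  ultimately show "bounded_linear (\<lambda>x. c *\<^sub>C T x)"
    by (rule bounded_linear_compose[rotated])
qed

text \<open>Existence for complex-linear operators is the Riesz representation theorem.\<close>

definition cadjoint :: "('h::complex_hilbert_space \<Rightarrow>\<^sub>L 'h) \<Rightarrow> ('h \<Rightarrow>\<^sub>L 'h)" where
  "cadjoint T = (THE S. \<forall>x y. cinner (T x) y = cinner x (blinfun_apply S y))"


section \<open>Von Neumann algebras with a tracial state\<close>

definition von_neumann_algebra :: "('h::complex_hilbert_space \<Rightarrow>\<^sub>L 'h) set \<Rightarrow> bool" where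
  "von_neumann_algebra M \<longleftrightarrow>
     (\<forall>T\<in>M. complex_linear T) \<and>
     id_blinfun \<in> M \<and>
     (\<forall>S\<in>M. \<forall>T\<in>M. S + T \<in> M) \<and>
     (\<forall>c. \<forall>T\<in>M. blinfun_scaleC c T \<in> M) \<and>
     (\<forall>S\<in>M. \<forall>T\<in>M. S o\<^sub>L T \<in> M) \<and>
     (\<forall>T\<in>M. cadjoint T \<in> M) \<and>
     closedin strong_operator_topology M"

definition generates_vna ::
  "('h::complex_hilbert_space \<Rightarrow>\<^sub>L 'h) list \<Rightarrow> ('h \<Rightarrow>\<^sub>L 'h) set \<Rightarrow> bool" where
  "generates_vna xs M \<longleftrightarrow> xs \<noteq> [] \<and> von_neumann_algebra M \<and> von_neumann_algebra hull (set xs) = M"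

definition finitely_generated_vna :: "('h::complex_hilbert_space \<Rightarrow>\<^sub>L 'h) set \<Rightarrow> bool" where
  "finitely_generated_vna M \<longleftrightarrow> (\<exists>xs. generates_vna xs M)"

definition ultraweak_topology :: "('h::complex_hilbert_space \<Rightarrow>\<^sub>L 'h) topology" where
  "ultraweak_topology = topology_generated_by
     {{T. (\<Sum>n. cinner (blinfun_apply T (\<xi> n)) (\<eta> n)) \<in> U} | \<xi> \<eta> U.
        summable (\<lambda>n. (norm (\<xi> n))\<^sup>2) \<and> summable (\<lambda>n. (norm (\<eta> n))\<^sup>2) \<and> open U}"

text \<open>
  Tracial states are faithful and normal, where normal means ultraweakly continuous. Only the
  values of \<open>\<tau>\<close> on \<open>M\<close> matter, so the restriction of \<open>\<tau>\<close> to a subalgebra is \<open>\<tau>\<close> itself.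
\<close>

definition tracial_state ::
  "('h::complex_hilbert_space \<Rightarrow>\<^sub>L 'h) set \<Rightarrow> (('h \<Rightarrow>\<^sub>L 'h) \<Rightarrow> complex) \<Rightarrow> bool" where
  "tracial_state M \<tau> \<longleftrightarrow>
     (\<forall>S\<in>M. \<forall>T\<in>M. \<tau> (S + T) = \<tau> S + \<tau> T) \<and>
     (\<forall>c. \<forall>T\<in>M. \<tau> (blinfun_scaleC c T) = c * \<tau> T) \<and>
     (\<forall>T\<in>M. \<tau> (cadjoint T o\<^sub>L T) \<in> \<real>\<^sub>\<ge>\<^sub>0) \<and>
     \<tau> id_blinfun = 1 \<and>
     (\<forall>S\<in>M. \<forall>T\<in>M. \<tau> (S o\<^sub>L T) = \<tau> (T o\<^sub>L S)) \<and>
     (\<forall>T\<in>M. \<tau> (cadjoint T o\<^sub>L T) = 0 \<longrightarrow> T = 0) \<and>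
     continuous_map (subtopology ultraweak_topology M) euclidean \<tau>"


section \<open>Tuples of complex matrices\<close>

definition normalized_trace :: "complex mat \<Rightarrow> complex" where
  "normalized_trace A = (\<Sum>i<dim_row A. A $$ (i, i)) / of_nat (dim_row A)"

definition vec_l2norm :: "complex vec \<Rightarrow> real" where
  "vec_l2norm v = sqrt (Re (v \<bullet>c v))"

definition mat_opnorm :: "complex mat \<Rightarrow> real" where
  "mat_opnorm A = (SUP v\<in>{v \<in> carrier_vec (dim_col A). vec_l2norm v \<le> 1}. vec_l2norm (A *\<^sub>v v))"

definition unitary_group :: "nat \<Rightarrow> complex mat set" where
  "unitary_group k =
     {W \<in> carrier_mat k k. mat_adjoint W * W = 1\<^sub>m k \<and> W * mat_adjoint W = 1\<^sub>m k}"

definition tuple_norm2 :: "complex mat list \<Rightarrow> real" where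
  "tuple_norm2 As = sqrt (\<Sum>A\<leftarrow>As. Re (normalized_trace (mat_adjoint A * A)))"

definition mat_tuples :: "nat \<Rightarrow> nat \<Rightarrow> complex mat list set" where
  "mat_tuples n k = {As. length As = n \<and> set As \<subseteq> carrier_mat k k}"


section \<open>The upper free orbit-dimension\<close>

text \<open>
  A *-word is a list of letters \<open>(i, s)\<close>, standing for the \<open>i\<close>-th variable (counted from \<open>0\<close>) if
  \<open>s\<close> is false and for its adjoint if \<open>s\<close> is true.
\<close>

definition word_op ::
  "('h::complex_hilbert_space \<Rightarrow>\<^sub>L 'h) list \<Rightarrow> (nat \<times> bool) list \<Rightarrow> ('h \<Rightarrow>\<^sub>L 'h)" where
  "word_op xs w =
     foldr (\<lambda>(i, s) T. (if s then cadjoint (xs ! i) else xs ! i) o\<^sub>L T) w id_blinfun"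

definition word_mat :: "nat \<Rightarrow> complex mat list \<Rightarrow> (nat \<times> bool) list \<Rightarrow> complex mat" where
  "word_mat k As w =
     foldr (\<lambda>(i, s) B. (if s then mat_adjoint (As ! i) else As ! i) * B) w (1\<^sub>m k)"

definition microstates ::
  "(('h::complex_hilbert_space \<Rightarrow>\<^sub>L 'h) \<Rightarrow> complex) \<Rightarrow> ('h \<Rightarrow>\<^sub>L 'h) list \<Rightarrow>
   real \<Rightarrow> nat \<Rightarrow> nat \<Rightarrow> real \<Rightarrow> complex mat list set" where
  "microstates \<tau> xs R m k \<epsilon> =
     {As \<in> mat_tuples (length xs) k.
        (\<forall>A\<in>set As. mat_opnorm A \<le> R) \<and>
        (\<forall>w. 1 \<le> length w \<and> length w \<le> m \<and> (\<forall>(i, s)\<in>set w. i < length xs) \<longrightarrow>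
           cmod (normalized_trace (word_mat k As w) - \<tau> (word_op xs w)) < \<epsilon>)}"

definition orbit_ball :: "nat \<Rightarrow> complex mat list \<Rightarrow> real \<Rightarrow> complex mat list set" where
  "orbit_ball k Bs \<omega> =
     {As \<in> mat_tuples (length Bs) k.
        \<exists>W\<in>unitary_group k. tuple_norm2 (map2 (\<lambda>A B. A - W * B * mat_adjoint W) As Bs) < \<omega>}"

text \<open>
  Finite covers exist for the sets this is applied to, since they are bounded in a
  finite-dimensional space.
\<close>

definition orbit_covering_number :: "nat \<Rightarrow> complex mat list set \<Rightarrow> real \<Rightarrow> nat" where
  "orbit_covering_number k \<Gamma> \<omega> =
     (if \<Gamma> = {} then 1
      else LEAST p. \<exists>C. finite C \<and> card C = p \<and> C \<subseteq> \<Gamma> \<and> \<Gamma> \<subseteq> (\<Union>Bs\<in>C. orbit_ball k Bs \<omega>))"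

definition orbit_dim_at_cutoff ::
  "(('h::complex_hilbert_space \<Rightarrow>\<^sub>L 'h) \<Rightarrow> complex) \<Rightarrow> ('h \<Rightarrow>\<^sub>L 'h) list \<Rightarrow>
   real \<Rightarrow> real \<Rightarrow> ereal" where
  "orbit_dim_at_cutoff \<tau> xs \<omega> R =
     (INF m. INF \<epsilon>\<in>{0<..}. limsup (\<lambda>k. ereal
        (ln (real (orbit_covering_number k (microstates \<tau> xs R m k \<epsilon>) \<omega>)) /
         (- ((real k)\<^sup>2 * ln \<omega>)))))"

definition orbit_dim_at ::
  "(('h::complex_hilbert_space \<Rightarrow>\<^sub>L 'h) \<Rightarrow> complex) \<Rightarrow> ('h \<Rightarrow>\<^sub>L 'h) list \<Rightarrow> real \<Rightarrow> ereal" where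
  "orbit_dim_at \<tau> xs \<omega> = (SUP R\<in>{0<..}. orbit_dim_at_cutoff \<tau> xs \<omega> R)"

definition upper_orbit_dim ::
  "(('h::complex_hilbert_space \<Rightarrow>\<^sub>L 'h) \<Rightarrow> complex) \<Rightarrow> ('h \<Rightarrow>\<^sub>L 'h) list \<Rightarrow> ereal" where
  "upper_orbit_dim \<tau> xs = (SUP \<omega>\<in>{0<..<1}. orbit_dim_at \<tau> xs \<omega>)"

definition upper_orbit_dim_vna ::
  "(('h::complex_hilbert_space \<Rightarrow>\<^sub>L 'h) \<Rightarrow> complex) \<Rightarrow> ('h \<Rightarrow>\<^sub>L 'h) set \<Rightarrow> ereal" where
  "upper_orbit_dim_vna \<tau> M = (SUP xs\<in>{xs. generates_vna xs M}. upper_orbit_dim \<tau> xs)"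

end

theory Submission
  imports Defs
begin

text \<open>
  Let \<open>x\<close> generate \<open>M\<close>. Since \<open>\<Union>i. N i\<close> is strongly dense, some \<open>N i\<close> contains Hermitian elements
  whose combinations are close to the \<open>x\<^sub>j\<close> in the 2-norm; adjoin them to generators of \<open>N i\<close> to get
  a Hermitian generating family \<open>z\<close> of \<open>N i\<close>. Each \<open>z\<^sub>l\<close> is a strong limit of *-polynomials in \<open>x\<close>,
  and Kaplansky's truncation \<open>t \<mapsto> t / (1 + t\<^sup>2)\<close> can itself be replaced by a polynomial, so the
  approximating *-polynomials \<open>G\<^sub>l\<close> obey a bound of \<open>2\<close> at \<open>x\<close> and at every matrix tuple of norm at most
  \<open>R\<close>. Hence \<open>A \<mapsto> G(A)\<close> maps microstates of \<open>x\<close> to microstates of \<open>z\<close> with cutoff \<open>2\<close>, and \<open>A\<close> is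
  recovered linearly from \<open>G(A)\<close> up to a small error. An orbit cover for \<open>z\<close> therefore pulls back to
  an orbit cover for \<open>x\<close> of no larger size, and \<open>K(z) = 0\<close> forces \<open>K(x) = 0\<close>.
\<close>

section \<open>Complex Hilbert spaces\<close>

text \<open>The obstacle is boundedness: a polynomial strongly close to \<open>z\<^sub>l\<close> may
  be huge at matrices of norm at most \<open>R\<close>. Truncation helps because the residual of the
  Neumann iteration never grows: whatever the a priori bound \<open>C\<close> and the number of
  steps, the truncated value has norm at most 2. So \<open>C\<close> can be chosen after the
  approximating element, as large as all matrices require. The constant 2/5 comes from inverting the
  truncation: \<open>t / (1 + t^2)\<close> never exceeds 1/2, and the equation
  \<open>w = z + z w w\<close> is solved in the ball of radius 1/2, where 2/5 + (2/5)(1/4) = 1/2.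
  Families are Hermitian because the adjoint is not strongly continuous; with Hermitian letters,
  words and their traces converge along bounded strong nets. The map \<open>A \<mapsto> G(A)\<close>
  need not be Lipschitz: only its approximate linear inverse matters. The radius used for
  \<open>z\<close> is smaller than that for \<open>x\<close>, but this changes the quotient by a
  constant factor only, which is harmless when the dimension is 0.\<close>

lemma cinner_add_right: "cinner x (y + z) = cinner x y + cinner x z"
  for x :: "'h::complex_hilbert_space"
  by (metis cinner_commute cinner_add_left complex_cnj_add)

lemma cinner_scaleC_right: "cinner x (c *\<^sub>C y) = cnj c * cinner x y"
  for x :: "'h::complex_hilbert_space"
  by (metis cinner_commute cinner_scaleC_left complex_cnj_mult)

lemma cinner_zero [simp]: "cinner 0 y = 0" "cinner x 0 = 0"
  for x y :: "'h::complex_hilbert_space"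
  using cinner_add_left[of 0 0 y] cinner_add_right[of x 0 0] by simp_all

lemma Im_cinner: "Im (cinner x y) = - inner (\<i> *\<^sub>C x) y"
  for x :: "'h::complex_hilbert_space"
  by (simp add: inner_eq_Re_cinner cinner_scaleC_left)

lemma cmod_cinner_le: "cmod (cinner x y) \<le> norm x * norm y"
  for x :: "'h::complex_hilbert_space"
proof (cases "cinner x y = 0")
  case False
  \<comment> \<open>A phase that rotates \<open>cinner x y\<close> onto the positive axis, where it
    agrees with the real inner product; the real Cauchy-Schwarz inequality then applies.\<close>
  define c where "c = cnj (cinner x y) / cmod (cinner x y)"
  have c: "cmod c = 1"
    using False by (simp add: c_def norm_divide)
  have "cnj (cinner x y) * cinner x y = of_real ((cmod (cinner x y))\<^sup>2)"
    by (simp add: complex_norm_square[symmetric] mult.commute del: of_real_power)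
  then have "c * cinner x y = of_real (cmod (cinner x y))"
    using False by (simp add: c_def power2_eq_square)
  then have "cmod (cinner x y) = inner (c *\<^sub>C x) y"
    by (simp add: inner_eq_Re_cinner cinner_scaleC_left)
  also have "\<dots> \<le> norm (c *\<^sub>C x) * norm y"
    by (rule norm_cauchy_schwarz)
  finally show ?thesis
    by (simp add: norm_scaleC c)
qed simp

lemma bounded_bilinear_cinner:
  "bounded_bilinear (cinner :: 'h::complex_hilbert_space \<Rightarrow> 'h \<Rightarrow> complex)"
proof (unfold_locales, goal_cases)
  case (3 r a b) then show ?case
    by (simp add: scaleR_scaleC cinner_scaleC_left scaleR_conv_of_real)
next
  case (4 a r b) then show ?case
    by (simp add: scaleR_scaleC cinner_scaleC_right scaleR_conv_of_real)
next
  case 5 then show ?case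
    by (intro exI[of _ 1]) (simp add: cmod_cinner_le)
qed (simp_all add: cinner_add_left cinner_add_right)

lemma scaleC_of_real [simp]: "complex_of_real r *\<^sub>C x = r *\<^sub>R x"
  for x :: "'h::complex_hilbert_space"
  by (simp add: scaleR_scaleC)

lemma blinfun_scaleC_apply [simp]: "blinfun_apply (blinfun_scaleC c T) x = c *\<^sub>C T x"
  by transfer simp

lemma cinner_ext:
  fixes y z :: "'h::complex_hilbert_space"
  assumes "\<And>x. cinner x y = cinner x z"
  shows "y = z"
  using vector_eq_ldot[of y z] assms by (simp add: inner_eq_Re_cinner)

text \<open>Serves as the first-order condition at a minimiser: the quadratic vanishes at 0, so a
  nonzero slope would make it negative nearby.\<close>

lemma quadratic_nonneg_imp_linear_zero:
  fixes A B :: real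
  assumes "\<And>r. 0 \<le> 2 * r * A + r\<^sup>2 * B" and "B \<ge> 0"
  shows "A = 0"
proof (rule ccontr)
  assume "A \<noteq> 0"
  \<comment> \<open>Evaluation near the minimiser \<open>- A / B\<close>; the denominator
    \<open>B + 1\<close> also covers \<open>B = 0\<close>.\<close>
  have eq: "2 * (- (A / (B + 1))) * A + (- (A / (B + 1)))\<^sup>2 * B = - (A\<^sup>2 * (B + 2)) / (B + 1)\<^sup>2"
    using assms(2) by (simp add: divide_simps power2_eq_square) (simp add: algebra_simps)
  have "- (A\<^sup>2 * (B + 2)) / (B + 1)\<^sup>2 < 0"
    using \<open>A \<noteq> 0\<close> assms(2) by (simp add: divide_less_0_iff)
  then show False
    using assms(1)[of "- (A / (B + 1))"] eq by linarith
qed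

text \<open>Orthogonal projection of \<open>t\<close> onto the closure of a subspace \<open>S\<close> of a finite direct sum.\<close>

lemma projection_onto_closure:
  fixes S :: "('i \<Rightarrow> 'h::{real_inner,banach}) set"
  assumes "finite I" and "S \<noteq> {}"
    and add: "\<forall>f\<in>S. \<forall>g\<in>S. (\<lambda>i. f i + g i) \<in> S"
    and scale: "\<forall>f\<in>S. \<forall>r. (\<lambda>i. r *\<^sub>R f i) \<in> S"
  shows "\<exists>p s. (\<forall>n :: nat. s n \<in> S) \<and> (\<forall>i\<in>I. (\<lambda>n. s n i) \<longlonglongrightarrow> p i) \<and>
    (\<forall>f\<in>S. (\<Sum>i\<in>I. inner (f i) (t i - p i)) = 0)"
proof -
  define \<Phi> where "\<Phi> s = (\<Sum>i\<in>I. (norm (s i - t i))\<^sup>2)" for s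
  define d where "d = Inf (\<Phi> ` S)"
  have "bdd_below (\<Phi> ` S)"
    by (rule bdd_belowI[of _ 0]) (auto simp: \<Phi>_def intro!: sum_nonneg)
  then have d_le: "d \<le> \<Phi> s" if "s \<in> S" for s
    unfolding d_def using that by (intro cInf_lower) auto
  have "\<exists>s\<in>S. \<Phi> s < d + 1 / real (Suc n)" for n
  proof -
    have "Inf (\<Phi> ` S) < d + 1 / real (Suc n)"
      by (simp add: d_def)
    from cInf_lessD[OF _ this] \<open>S \<noteq> {}\<close> show ?thesis
      by auto
  qed
  then obtain s where s: "\<And>n. s n \<in> S" "\<And>n. \<Phi> (s n) < d + 1 / real (Suc n)"
    by metis
  \<comment> \<open>Parallelogram law in the direct sum: the midpoint of two near-minimisers lies in
    \<open>S\<close>, so its value is at least \<open>d\<close>, which forces the two to be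
    close.\<close>
  have gap: "(norm (s m i - s n i))\<^sup>2 \<le> 2 / real (Suc m) + 2 / real (Suc n)" if "i \<in> I" for m n i
  proof -
    let ?h = "\<lambda>i. (1/2) *\<^sub>R (s m i + s n i)"
    have "?h \<in> S"
      by (intro scale[rule_format] add[rule_format] s)
    have *: "4 * (norm (?h i - t i))\<^sup>2 + (norm (s m i - s n i))\<^sup>2
        = 2 * (norm (s m i - t i))\<^sup>2 + 2 * (norm (s n i - t i))\<^sup>2" for i
      by (simp add: power2_norm_eq_inner inner_diff_left inner_diff_right inner_add_left
          inner_add_right inner_commute field_simps)
    have "4 * \<Phi> ?h + (\<Sum>i\<in>I. (norm (s m i - s n i))\<^sup>2) = 2 * \<Phi> (s m) + 2 * \<Phi> (s n)"
      unfolding \<Phi>_def sum_distrib_left sum.distrib[symmetric] by (intro sum.cong refl *)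
    moreover have "(norm (s m i - s n i))\<^sup>2 \<le> (\<Sum>i\<in>I. (norm (s m i - s n i))\<^sup>2)"
      using that \<open>finite I\<close> by (intro member_le_sum) auto
    ultimately show ?thesis
      using d_le[OF \<open>?h \<in> S\<close>] s(2)[of m] s(2)[of n] by argo
  qed
  have "Cauchy (\<lambda>n. s n i)" if "i \<in> I" for i
  proof (rule metric_CauchyI)
    fix e :: real assume "e > 0"
    then obtain N where N: "inverse (real (Suc N)) < e\<^sup>2 / 4"
      using reals_Archimedean[of "e\<^sup>2/4"] by auto
    have "dist (s m i) (s n i) < e" if "m \<ge> N" "n \<ge> N" for m n
    proof -
      have "2 / real (Suc m) \<le> 2 / real (Suc N)" "2 / real (Suc n) \<le> 2 / real (Suc N)"
        using that by (auto intro!: divide_left_mono)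
      then have "(norm (s m i - s n i))\<^sup>2 \<le> 4 * inverse (real (Suc N))"
        using gap[OF \<open>i \<in> I\<close>, of m n] unfolding divide_inverse by linarith
      also have "\<dots> < e\<^sup>2"
        using N by simp
      finally show ?thesis
        using \<open>e > 0\<close> by (simp add: dist_norm power_less_imp_less_base)
    qed
    then show "\<exists>N. \<forall>m\<ge>N. \<forall>n\<ge>N. dist (s m i) (s n i) < e"
      by blast
  qed
  then have "\<exists>p. \<forall>i\<in>I. (\<lambda>n. s n i) \<longlonglongrightarrow> p i"
    by (intro bchoice ballI) (auto simp: Cauchy_convergent_iff convergent_def)
  then obtain p where p: "\<And>i. i \<in> I \<Longrightarrow> (\<lambda>n. s n i) \<longlonglongrightarrow> p i"
    by blast
  have "\<Phi> p \<le> d"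
  proof (rule LIMSEQ_le)
    show "(\<lambda>n. \<Phi> (s n)) \<longlonglongrightarrow> \<Phi> p"
      unfolding \<Phi>_def by (intro tendsto_intros p)
    show "(\<lambda>n. d + 1 / real (Suc n)) \<longlonglongrightarrow> d"
      using tendsto_add[OF tendsto_const LIMSEQ_inverse_real_of_nat, of d]
      by (simp add: inverse_eq_divide)
    show "\<exists>N. \<forall>n\<ge>N. \<Phi> (s n) \<le> d + 1 / real (Suc n)"
      using s(2) less_imp_le by blast
  qed
  have orth: "(\<Sum>i\<in>I. inner (f i) (t i - p i)) = 0" if "f \<in> S" for f
  proof -
    have "0 \<le> 2 * r * (\<Sum>i\<in>I. inner (f i) (p i - t i)) + r\<^sup>2 * (\<Sum>i\<in>I. (norm (f i))\<^sup>2)" for r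
    proof -
      \<comment> \<open>The limit \<open>p\<close> need not belong to \<open>S\<close>, so the bound
        by \<open>d\<close> is obtained for the perturbed members \<open>s n + r f\<close> of
        \<open>S\<close> and carried to the limit.\<close>
      have "(\<lambda>n. \<Phi> (\<lambda>i. s n i + r *\<^sub>R f i)) \<longlonglongrightarrow> \<Phi> (\<lambda>i. p i + r *\<^sub>R f i)"
        unfolding \<Phi>_def by (intro tendsto_intros p)
      then have "d \<le> \<Phi> (\<lambda>i. p i + r *\<^sub>R f i)"
        by (rule LIMSEQ_le_const) (auto intro!: d_le add[rule_format] s scale[rule_format] that)
      also have "\<dots> = \<Phi> p + (2 * r * (\<Sum>i\<in>I. inner (f i) (p i - t i)) + r\<^sup>2 * (\<Sum>i\<in>I. (norm (f i))\<^sup>2))"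
        unfolding \<Phi>_def sum_distrib_left sum.distrib[symmetric] power2_norm_eq_inner
        by (intro sum.cong refl)
          (simp add: inner_diff_left inner_diff_right inner_add_left
            inner_add_right inner_commute algebra_simps power2_eq_square)
      finally show ?thesis
        using \<open>\<Phi> p \<le> d\<close> by linarith
    qed
    then have "(\<Sum>i\<in>I. inner (f i) (p i - t i)) = 0"
      by (rule quadratic_nonneg_imp_linear_zero) (auto intro: sum_nonneg)
    then show ?thesis
      by (simp add: inner_diff_right sum_subtractf)
  qed
  with p s(1) show ?thesis
    by (intro exI[of _ p] exI[of _ s]) blast
qed

text \<open>Projecting a vector \<open>x\<^sub>0\<close> outside the kernel onto the kernel leaves a
  remainder \<open>u\<close> orthogonal to it, and every vector is a multiple of \<open>u\<close>
  modulo the kernel. A one-element index set turns the projection lemma for direct sums into one for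
  a single space.\<close>

lemma Riesz_representation:
  fixes f :: "'h::{real_inner,banach} \<Rightarrow> real"
  assumes "bounded_linear f"
  obtains y where "\<And>x. f x = inner x y"
proof (cases "\<forall>x. f x = 0")
  case True
  then show ?thesis
    by (intro that[of 0]) simp
next
  case False
  interpret f: bounded_linear f by fact
  from False obtain x\<^sub>0 where x0: "f x\<^sub>0 \<noteq> 0"
    by blast
  define S where "S = {g :: unit \<Rightarrow> 'h. f (g ()) = 0}"
  have "S \<noteq> {}"
    by (auto simp: S_def f.zero intro: exI[of _ "\<lambda>_. 0"])
  have add: "\<forall>f\<in>S. \<forall>g\<in>S. (\<lambda>i. f i + g i) \<in> S"
    by (simp add: S_def f.add)
  have scale: "\<forall>f\<in>S. \<forall>r. (\<lambda>i. r *\<^sub>R f i) \<in> S"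
    by (simp add: S_def f.scaleR)
  from projection_onto_closure[where I = "{()}" and t = "\<lambda>_. x\<^sub>0", OF finite.insertI[OF finite.emptyI] \<open>S \<noteq> {}\<close> add scale]
  obtain p s where ps: "(\<forall>n :: nat. s n \<in> S) \<and> (\<forall>i\<in>{()}. (\<lambda>n. s n i) \<longlonglongrightarrow> p i) \<and>
      (\<forall>g\<in>S. (\<Sum>i\<in>{()}. inner (g i) (x\<^sub>0 - p i)) = 0)"
    by (elim exE)
  then have s: "\<And>n. s n \<in> S" "(\<lambda>n. s n ()) \<longlonglongrightarrow> p ()"
    by blast+
  have p: "inner (g ()) (x\<^sub>0 - p ()) = 0" if "g \<in> S" for g
    using ps that by simp
  define u where "u = x\<^sub>0 - p ()"
  have "(\<lambda>n. f (s n ())) \<longlonglongrightarrow> f (p ())"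
    by (rule f.tendsto[OF s(2)])
  then have "f (p ()) = 0"
    using s(1) by (simp add: S_def LIMSEQ_const_iff)
  then have fu: "f u \<noteq> 0"
    using x0 by (simp add: u_def f.diff)
  have orth: "inner x u = 0" if "f x = 0" for x
    using p[of "\<lambda>_. x"] that by (simp add: S_def u_def)
  show ?thesis
  proof (rule that)
    fix x
    have "inner (x - (f x / f u) *\<^sub>R u) u = 0"
      using fu by (intro orth) (simp add: f.diff f.scaleR)
    then have "inner x u = (f x / f u) * inner u u"
      by (simp add: inner_diff_left)
    moreover have "inner u u \<noteq> 0"
      using fu f.zero by auto
    ultimately show "f x = inner x ((f u / inner u u) *\<^sub>R u)"
      using fu by simp
  qed
qed

section \<open>Adjoints of complex-linear operators\<close>

lemma cadjoint_eqI:
  fixes T S :: "'h::complex_hilbert_space \<Rightarrow>\<^sub>L 'h"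
  assumes "\<And>x y. cinner (T x) y = cinner x (S y)"
  shows "cadjoint T = S"
  unfolding cadjoint_def
proof (rule the_equality)
  show "\<forall>x y. cinner (T x) y = cinner x (S y)"
    using assms by blast
  fix S' assume "\<forall>x y. cinner (T x) y = cinner x (blinfun_apply S' y)"
  then show "S' = S"
    using assms by (intro blinfun_eqI cinner_ext) metis
qed

text \<open>Riesz gives an adjoint for the real inner product. Complex linearity of \<open>T\<close>
  upgrades it: the imaginary part of \<open>cinner\<close> is, up to sign, the real inner product
  after multiplication by i, which commutes with \<open>T\<close>.\<close>

lemma cinner_cadjoint:
  fixes T :: "'h::complex_hilbert_space \<Rightarrow>\<^sub>L 'h"
  assumes T: "complex_linear T"
  shows "cinner (T x) y = cinner x (cadjoint T y)"
proof -
  have "\<exists>s. \<forall>x. inner (T x) y = inner x s" for y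
    by (rule Riesz_representation[of "\<lambda>x. inner (T x) y"])
      (auto intro: bounded_linear_compose[OF bounded_linear_inner_left blinfun.bounded_linear_right])
  then obtain s where s: "\<And>x y. inner (T x) y = inner x (s y)"
    by metis
  have "bounded_linear s"
  proof (rule bounded_linear_intro[where K = "norm T"])
    show "s (x + y) = s x + s y" for x y
      by (subst vector_eq_ldot[symmetric]) (simp add: inner_add_right flip: s)
    show "s (r *\<^sub>R x) = r *\<^sub>R s x" for r x
      by (subst vector_eq_ldot[symmetric]) (simp flip: s)
    show "norm (s y) \<le> norm y * norm T" for y
    proof (cases "s y = 0")
      case False
      have "norm (s y) * norm (s y) = inner (T (s y)) y"
        by (simp add: s flip: power2_eq_square power2_norm_eq_inner)
      also have "\<dots> \<le> norm (T (s y)) * norm y"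
        by (rule norm_cauchy_schwarz)
      also have "\<dots> \<le> (norm T * norm (s y)) * norm y"
        by (intro mult_right_mono norm_blinfun) auto
      finally have "norm (s y) * norm (s y) \<le> norm (s y) * (norm y * norm T)"
        by (simp add: algebra_simps)
      then show ?thesis
        using False by simp
    qed simp
  qed
  then have app: "blinfun_apply (Blinfun s) = s"
    by (rule bounded_linear_Blinfun_apply)
  have eq: "cinner (T x) y = cinner x (Blinfun s y)" for x y
  proof (rule complex_eqI)
    show "Re (cinner (T x) y) = Re (cinner x (Blinfun s y))"
      by (simp add: app s flip: inner_eq_Re_cinner)
    have "inner (\<i> *\<^sub>C T x) y = inner (T (\<i> *\<^sub>C x)) y"
      using T by (simp add: complex_linear_def)
    then show "Im (cinner (T x) y) = Im (cinner x (Blinfun s y))"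
      by (simp add: Im_cinner app s)
  qed
  show ?thesis
    using eq cadjoint_eqI[of T "Blinfun s"] by simp
qed

lemma inner_cadjoint:
  "complex_linear T \<Longrightarrow> inner (T x) y = inner x (cadjoint T y)"
  by (simp add: inner_eq_Re_cinner cinner_cadjoint)

lemma inner_cadjoint':
  "complex_linear T \<Longrightarrow> inner (cadjoint T x) y = inner x (T y)"
  by (metis inner_cadjoint inner_commute)

lemma complex_linearD: "complex_linear T \<Longrightarrow> T (c *\<^sub>C x) = c *\<^sub>C T x"
  by (simp add: complex_linear_def)

lemma complex_linear_intros [simp, intro]:
  "complex_linear 0" "complex_linear id_blinfun"
  "complex_linear S \<Longrightarrow> complex_linear T \<Longrightarrow> complex_linear (S + T)"
  "complex_linear T \<Longrightarrow> complex_linear (blinfun_scaleC c T)"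
  "complex_linear S \<Longrightarrow> complex_linear T \<Longrightarrow> complex_linear (S o\<^sub>L T)"
  using scaleC_add_right[of _ "0::'a" 0]
  by (simp_all add: complex_linear_def blinfun.add_left scaleC_add_right scaleC_scaleC mult.commute)

lemma complex_linear_cadjoint [simp, intro]:
  assumes "complex_linear T"
  shows "complex_linear (cadjoint T)"
  unfolding complex_linear_def
  by (intro allI cinner_ext) (simp add: cinner_scaleC_right flip: cinner_cadjoint[OF assms])

lemma cadjoint_cadjoint [simp]: "complex_linear T \<Longrightarrow> cadjoint (cadjoint T) = T"
  by (rule cadjoint_eqI) (metis cinner_cadjoint cinner_commute)

lemma cadjoint_id [simp]: "cadjoint id_blinfun = id_blinfun"
  by (rule cadjoint_eqI) simp

lemma cadjoint_zero [simp]: "cadjoint 0 = 0"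
  by (rule cadjoint_eqI) simp

lemma cadjoint_add:
  "complex_linear S \<Longrightarrow> complex_linear T \<Longrightarrow> cadjoint (S + T) = cadjoint S + cadjoint T"
  by (rule cadjoint_eqI) (simp add: blinfun.add_left cinner_add_left cinner_add_right cinner_cadjoint)

lemma cadjoint_scaleC:
  "complex_linear T \<Longrightarrow> cadjoint (blinfun_scaleC c T) = blinfun_scaleC (cnj c) (cadjoint T)"
  by (rule cadjoint_eqI) (simp add: cinner_scaleC_left cinner_scaleC_right cinner_cadjoint)

lemma cadjoint_compose:
  "complex_linear S \<Longrightarrow> complex_linear T \<Longrightarrow> cadjoint (S o\<^sub>L T) = cadjoint T o\<^sub>L cadjoint S"
  by (rule cadjoint_eqI) (simp add: cinner_cadjoint)

section \<open>Strong operator closures of *-algebras\<close>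

text \<open>Index filter for nets: a finite set of vectors together with a precision. Sequences
  would not do, since the Hilbert space may be nonseparable. One fixed filter for all nets lets
  finitely many of them be evaluated at a common index.\<close>

definition strong_net :: "('h set \<times> nat) filter" where
  "strong_net = finite_subsets_at_top UNIV \<times>\<^sub>F sequentially"

lemma strong_net_neq_bot [simp]: "strong_net \<noteq> bot"
  by (simp add: strong_net_def prod_filter_eq_bot)

text \<open>The approximants are values \<open>f y\<close> of arbitrary data \<open>y\<close>, so
  that the same selection later yields nets of formal polynomials and not only of operators.\<close>

lemma strong_net_exists:
  fixes f :: "'y \<Rightarrow> ('h::real_normed_vector \<Rightarrow>\<^sub>L 'h)"
  assumes approx: "\<And>F e. finite F \<Longrightarrow> e > 0 \<Longrightarrow> \<exists>y. P y \<and> (\<forall>\<xi>\<in>F. norm (f y \<xi> - z \<xi>) < e)"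
  shows "\<exists>g :: 'h set \<times> nat \<Rightarrow> 'y. (\<forall>i. P (g i)) \<and> (\<forall>\<xi>. ((\<lambda>i. f (g i) \<xi>) \<longlongrightarrow> z \<xi>) strong_net)"
proof -
  have "\<exists>y. P y \<and> (finite (fst i) \<longrightarrow> (\<forall>\<xi>\<in>fst i. norm (f y \<xi> - z \<xi>) < 1 / real (Suc (snd i))))"
    for i :: "'h set \<times> nat"
  proof (cases "finite (fst i)")
    case True
    then show ?thesis
      using approx[of "fst i" "1 / real (Suc (snd i))"] by auto
  next
    \<comment> \<open>Indices with an infinite first component are invisible to the filter; any
      \<open>y\<close> with \<open>P\<close> will do there.\<close>
    case False
    then show ?thesis
      using approx[of "{}" 1] by auto
  qed
  then obtain g :: "'h set \<times> nat \<Rightarrow> 'y" where g: "\<And>i. P (g i)"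
    "\<And>i \<xi>. finite (fst i) \<Longrightarrow> \<xi> \<in> fst i \<Longrightarrow> norm (f (g i) \<xi> - z \<xi>) < 1 / real (Suc (snd i))"
    by metis
  have lim: "((\<lambda>i. f (g i) \<xi>) \<longlongrightarrow> z \<xi>) strong_net" for \<xi>
  proof (rule tendstoI)
    fix e :: real assume "e > 0"
    have "eventually (\<lambda>F. finite F \<and> \<xi> \<in> F) (finite_subsets_at_top UNIV)"
      unfolding eventually_finite_subsets_at_top by (intro exI[of _ "{\<xi>}"]) auto
    moreover have "eventually (\<lambda>n. 1 / real (Suc n) < e) sequentially"
      using order_tendstoD(2)[OF LIMSEQ_inverse_real_of_nat \<open>e > 0\<close>] by (simp add: inverse_eq_divide)
    ultimately have "eventually (\<lambda>i. (finite (fst i) \<and> \<xi> \<in> fst i) \<and> 1 / real (Suc (snd i)) < e) strong_net"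
      unfolding strong_net_def by (rule eventually_prodI)
    then show "eventually (\<lambda>i. dist (f (g i) \<xi>) (z \<xi>) < e) strong_net"
    proof (rule eventually_mono)
      fix i assume i: "(finite (fst i) \<and> \<xi> \<in> fst i) \<and> 1 / real (Suc (snd i)) < e"
      then have "norm (f (g i) \<xi> - z \<xi>) < 1 / real (Suc (snd i))"
        by (intro g(2)) auto
      also have "\<dots> < e"
        using i by blast
      finally show "dist (f (g i) \<xi>) (z \<xi>) < e"
        by (simp add: dist_norm)
    qed
  qed
  show ?thesis
    by (intro exI[of _ g] conjI allI g(1) lim)
qed

lemma tendsto_scaleC: "(f \<longlongrightarrow> l) F \<Longrightarrow> ((\<lambda>i. c *\<^sub>C f i) \<longlongrightarrow> c *\<^sub>C l) F"
  for l :: "'h::complex_hilbert_space"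
  using bounded_linear.tendsto[OF blinfun.bounded_linear_right[of "blinfun_scaleC c id_blinfun"], of f l F]
  by simp

abbreviation (input) sot_closure :: "('h::real_normed_vector \<Rightarrow>\<^sub>L 'h) set \<Rightarrow> ('h \<Rightarrow>\<^sub>L 'h) set" where
  "sot_closure A \<equiv> strong_operator_topology closure_of A"

lemma in_sot_closure_iff:
  "T \<in> sot_closure A \<longleftrightarrow>
    (\<forall>F e. finite F \<longrightarrow> e > 0 \<longrightarrow> (\<exists>a\<in>A. \<forall>\<xi>\<in>F. norm (blinfun_apply a \<xi> - T \<xi>) < e))"
  (is "?L \<longleftrightarrow> ?R")
proof
  assume L: ?L
  show ?R
  proof (intro allI impI)
    fix F :: "'a set" and e :: real
    assume "finite F" "e > 0"
    define U where "U = {f. \<forall>\<xi>\<in>F. blinfun_apply f \<xi> \<in> ball (T \<xi>) e}"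
    have "openin strong_operator_topology U"
      unfolding U_def using \<open>finite F\<close> by (intro strong_operator_topology_basis) auto
    moreover have "T \<in> U"
      using \<open>e > 0\<close> by (simp add: U_def)
    ultimately have "\<exists>a. a \<in> A \<and> a \<in> U"
      using L unfolding in_closure_of by (elim conjE allE[of _ U] impE) simp_all
    then obtain a where "a \<in> A" "a \<in> U"
      by blast
    then show "\<exists>a\<in>A. \<forall>\<xi>\<in>F. norm (blinfun_apply a \<xi> - T \<xi>) < e"
      by (intro bexI[of _ a]) (auto simp: U_def dist_norm norm_minus_commute)
  qed
next
  assume R: ?R
  show ?L
    unfolding in_closure_of
  proof (intro conjI allI impI)
    show "T \<in> topspace strong_operator_topology"
      by (simp add: strong_operator_topology_topspace)
    fix U assume U: "T \<in> U \<and> openin strong_operator_topology U"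
    then obtain V where V: "open V" "U = blinfun_apply -` V"
      unfolding strong_operator_topology_def openin_pullback_topology by auto
    then have "openin (product_topology (\<lambda>_. euclidean) UNIV) V" "blinfun_apply T \<in> V"
      using U by (auto simp: euclidean_product_topology)
    then obtain X where X: "blinfun_apply T \<in> (\<Pi>\<^sub>E i\<in>UNIV. X i)" "\<And>i. open (X i)"
      "finite {i. X i \<noteq> UNIV}" "(\<Pi>\<^sub>E i\<in>UNIV. X i) \<subseteq> V"
      using product_topology_open_contains_basis[of "\<lambda>_. euclidean" UNIV V "blinfun_apply T"]
      by auto
    let ?F = "{i. X i \<noteq> UNIV}"
    have "\<exists>e>0. ball (T i) e \<subseteq> X i" for i
    proof -
      have "T i \<in> X i"
        using X(1) by (simp add: PiE_iff)
      with X(2)[of i] show ?thesis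
        by (rule openE) (rule exI, rule conjI)
    qed
    then obtain r where r: "\<And>i. r i > 0" "\<And>i. ball (T i) (r i) \<subseteq> X i"
      by metis
    \<comment> \<open>Only finitely many coordinates are constrained, so a common radius exists;
      inserting 1 keeps the minimum defined when there are none.\<close>
    define e where "e = Min (insert 1 (r ` ?F))"
    have "e > 0"
      using X(3) r(1) by (simp add: e_def)
    have "\<exists>a\<in>A. \<forall>\<xi>\<in>?F. norm (blinfun_apply a \<xi> - T \<xi>) < e"
      using R X(3) \<open>e > 0\<close> by meson
    then obtain a where a: "a \<in> A" "\<And>\<xi>. \<xi> \<in> ?F \<Longrightarrow> norm (blinfun_apply a \<xi> - T \<xi>) < e"
      by (rule bexE) simp
    have "blinfun_apply a i \<in> X i" for i
    proof (cases "i \<in> ?F")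
      case True
      then have "e \<le> r i"
        using X(3) by (simp add: e_def)
      then have "blinfun_apply a i \<in> ball (T i) (r i)"
        using a(2)[OF True] by (simp add: dist_norm norm_minus_commute)
      then show ?thesis
        using r(2) by blast
    qed simp
    then have "blinfun_apply a \<in> V"
      using X(4) by blast
    then show "\<exists>y. y \<in> A \<and> y \<in> U"
      using a(1) V(2) by auto
  qed
qed

lemma sot_closure_approx:
  assumes "T \<in> sot_closure A" "finite F" "e > 0"
  shows "\<exists>a\<in>A. \<forall>\<xi>\<in>F. norm (blinfun_apply a \<xi> - T \<xi>) < e"
  using assms unfolding in_sot_closure_iff by meson

lemma sot_closure_net:
  fixes T :: "'h::real_normed_vector \<Rightarrow>\<^sub>L 'h"
  assumes "T \<in> sot_closure A"
  obtains g :: "'h set \<times> nat \<Rightarrow> ('h \<Rightarrow>\<^sub>L 'h)"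
  where "\<forall>i. g i \<in> A" "\<forall>\<xi>. ((\<lambda>i. g i \<xi>) \<longlongrightarrow> T \<xi>) strong_net"
proof -
  have "\<exists>g :: 'h set \<times> nat \<Rightarrow> _. (\<forall>i. g i \<in> A) \<and> (\<forall>\<xi>. ((\<lambda>i. g i \<xi>) \<longlongrightarrow> T \<xi>) strong_net)"
    by (rule strong_net_exists[where f = "\<lambda>a. a"]) (use sot_closure_approx[OF assms] in \<open>simp add: Bex_def\<close>)
  then show ?thesis
    using that by (elim exE conjE)
qed

lemma sot_closure_limit:
  fixes T :: "'h::real_normed_vector \<Rightarrow>\<^sub>L 'h"
  assumes "F \<noteq> bot" "\<And>i. g i \<in> A" "\<And>\<xi>. ((\<lambda>i. blinfun_apply (g i) \<xi>) \<longlongrightarrow> T \<xi>) F"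
  shows "T \<in> sot_closure A"
  unfolding in_sot_closure_iff
proof (intro allI impI)
  fix X :: "'h set" and e :: real assume "finite X" "e > 0"
  then have "eventually (\<lambda>i. \<forall>\<xi>\<in>X. dist (g i \<xi>) (T \<xi>) < e) F"
    using assms(3) by (intro eventually_ball_finite) (auto intro: tendstoD)
  from eventually_happens'[OF assms(1) this] show "\<exists>a\<in>A. \<forall>\<xi>\<in>X. norm (blinfun_apply a \<xi> - T \<xi>) < e"
    using assms(2) by (auto simp: dist_norm)
qed

text \<open>A Hahn--Banach type criterion: a real subspace of operators is strongly dense as soon as it
  is weakly dense.\<close>

lemma in_sot_closure_if_orthogonal:
  fixes T :: "'h::{real_inner,banach} \<Rightarrow>\<^sub>L 'h"
  assumes "A \<noteq> {}"
    and add: "\<And>a b. a \<in> A \<Longrightarrow> b \<in> A \<Longrightarrow> a + b \<in> A"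
    and scale: "\<And>r a. a \<in> A \<Longrightarrow> r *\<^sub>R a \<in> A"
    and orth: "\<And>F y. finite F \<Longrightarrow> (\<And>a. a \<in> A \<Longrightarrow> (\<Sum>\<xi>\<in>F. inner (blinfun_apply a \<xi>) (y \<xi>)) = 0) \<Longrightarrow>
      (\<Sum>\<xi>\<in>F. inner (T \<xi>) (y \<xi>)) = 0"
  shows "T \<in> sot_closure A"
  unfolding in_sot_closure_iff
proof (intro allI impI)
  fix F :: "'h set" and e :: real
  assume "finite F" "e > 0"
  define S where "S = blinfun_apply ` A"
  have "S \<noteq> {}"
    using \<open>A \<noteq> {}\<close> by (simp add: S_def)
  have S_add: "\<forall>f\<in>S. \<forall>g\<in>S. (\<lambda>i. f i + g i) \<in> S"
    using add by (force simp: S_def image_iff fun_eq_iff blinfun.add_left)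
  have S_scale: "\<forall>f\<in>S. \<forall>r. (\<lambda>i. r *\<^sub>R f i) \<in> S"
    using scale by (force simp: S_def image_iff fun_eq_iff blinfun.scaleR_left)
  from projection_onto_closure[where I = F and t = "blinfun_apply T",
      OF \<open>finite F\<close> \<open>S \<noteq> {}\<close> S_add S_scale]
  obtain p s where "(\<forall>n :: nat. s n \<in> S) \<and> (\<forall>i\<in>F. (\<lambda>n. s n i) \<longlonglongrightarrow> p i) \<and>
      (\<forall>f\<in>S. (\<Sum>i\<in>F. inner (f i) (T i - p i)) = 0)"
    by (elim exE)
  then have s: "\<And>n. s n \<in> S" "\<And>i. i \<in> F \<Longrightarrow> (\<lambda>n. s n i) \<longlonglongrightarrow> p i"
    and p: "\<And>f. f \<in> S \<Longrightarrow> (\<Sum>i\<in>F. inner (f i) (T i - p i)) = 0"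
    by simp_all
  \<comment> \<open>Orthogonality to \<open>S\<close> passes to the limit \<open>p\<close>. Together
    with \<open>orth\<close>, applied to the vectors \<open>T i - p i\<close>, it makes
    \<open>T - p\<close> orthogonal to itself on \<open>F\<close>.\<close>
  have "(\<lambda>n. \<Sum>i\<in>F. inner (s n i) (T i - p i)) \<longlonglongrightarrow> (\<Sum>i\<in>F. inner (p i) (T i - p i))"
    by (intro tendsto_intros s)
  then have "(\<Sum>i\<in>F. inner (p i) (T i - p i)) = 0"
    using p s(1) by (simp add: LIMSEQ_const_iff)
  moreover have "(\<Sum>i\<in>F. inner (T i) (T i - p i)) = 0"
    using p by (intro orth \<open>finite F\<close>) (auto simp: S_def)
  ultimately have "(\<Sum>i\<in>F. inner (T i - p i) (T i - p i)) = 0"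
    by (simp add: inner_diff_left sum_subtractf)
  then have "\<forall>i\<in>F. T i = p i"
    using \<open>finite F\<close> by (subst (asm) sum_nonneg_eq_0_iff) auto
  then have "eventually (\<lambda>n. \<forall>i\<in>F. dist (s n i) (T i) < e) sequentially"
    using s(2) \<open>finite F\<close> \<open>e > 0\<close> by (intro eventually_ball_finite) (auto intro: tendstoD)
  from eventually_happens'[OF sequentially_bot this]
  obtain n where n: "\<forall>i\<in>F. dist (s n i) (T i) < e"
    by blast
  obtain a where "a \<in> A" "s n = blinfun_apply a"
    using s(1)[of n] by (auto simp: S_def)
  then show "\<exists>a\<in>A. \<forall>\<xi>\<in>F. norm (blinfun_apply a \<xi> - T \<xi>) < e"
    using n by (auto simp: dist_norm)
qed

section \<open>Star algebras and their strong closures\<close>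

definition star_algebra :: "('h::complex_hilbert_space \<Rightarrow>\<^sub>L 'h) set \<Rightarrow> bool" where
  "star_algebra A \<longleftrightarrow>
     (\<forall>T\<in>A. complex_linear T) \<and>
     id_blinfun \<in> A \<and>
     (\<forall>S\<in>A. \<forall>T\<in>A. S + T \<in> A) \<and>
     (\<forall>c. \<forall>T\<in>A. blinfun_scaleC c T \<in> A) \<and>
     (\<forall>S\<in>A. \<forall>T\<in>A. S o\<^sub>L T \<in> A) \<and>
     (\<forall>T\<in>A. cadjoint T \<in> A)"

lemma star_algebraD:
  assumes "star_algebra A"
  shows "T \<in> A \<Longrightarrow> complex_linear T" "id_blinfun \<in> A" "S \<in> A \<Longrightarrow> T \<in> A \<Longrightarrow> S + T \<in> A"
    "T \<in> A \<Longrightarrow> blinfun_scaleC c T \<in> A" "S \<in> A \<Longrightarrow> T \<in> A \<Longrightarrow> S o\<^sub>L T \<in> A" "T \<in> A \<Longrightarrow> cadjoint T \<in> A"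
  using assms by (auto simp: star_algebra_def)

lemma scaleR_eq_blinfun_scaleC: "r *\<^sub>R T = blinfun_scaleC (complex_of_real r) T"
  by (rule blinfun_eqI) (simp add: blinfun.scaleR_left)

lemma star_algebra_more:
  assumes "star_algebra A"
  shows "T \<in> A \<Longrightarrow> r *\<^sub>R T \<in> A" "0 \<in> A" "T \<in> A \<Longrightarrow> - T \<in> A" "S \<in> A \<Longrightarrow> T \<in> A \<Longrightarrow> S - T \<in> A"
proof -
  show scale: "r *\<^sub>R T \<in> A" if "T \<in> A" for T r
    using that star_algebraD(4)[OF assms] by (simp add: scaleR_eq_blinfun_scaleC)
  show "0 \<in> A"
    using scale[OF star_algebraD(2)[OF assms], of 0] by simp
  show minus: "- T \<in> A" if "T \<in> A" for T
    using scale[OF that, of "-1"] by simp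
  show "S - T \<in> A" if "S \<in> A" "T \<in> A"
    using star_algebraD(3)[OF assms that(1) minus[OF that(2)]] by simp
qed

lemma von_neumann_algebra_iff:
  "von_neumann_algebra M \<longleftrightarrow> star_algebra M \<and> closedin strong_operator_topology M"
  by (auto simp: von_neumann_algebra_def star_algebra_def)

lemma star_algebra_of_vna: "von_neumann_algebra M \<Longrightarrow> star_algebra M"
  by (simp add: von_neumann_algebra_iff)

text \<open>Norm closedness provides the completeness for the contraction argument inside a von
  Neumann algebra.\<close>

lemma closed_of_vna:
  assumes "von_neumann_algebra M"
  shows "closed M"
  using closedin_continuous_map_preimage[OF strong_operator_topology_weaker_than_euclidean, of M] assms
  by (simp add: von_neumann_algebra_iff)

text \<open>The adjoint is not strongly continuous, so adjoints cannot be taken along the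
  approximating net. It is weakly continuous, and for subspaces the orthogonality criterion reduces
  strong density to weak density.\<close>

lemma cadjoint_in_sot_closure:
  assumes A: "star_algebra A" and T: "T \<in> sot_closure A"
    and "complex_linear T"
  shows "cadjoint T \<in> sot_closure A"
proof (rule in_sot_closure_if_orthogonal)
  show "A \<noteq> {}"
    using star_algebraD(2)[OF A] by blast
next
  fix F y assume "finite F"
    and zero: "\<And>a. a \<in> A \<Longrightarrow> (\<Sum>\<xi>\<in>F. inner (blinfun_apply a \<xi>) (y \<xi>)) = 0"
  obtain g :: "'a set \<times> nat \<Rightarrow> _" where "\<forall>i. g i \<in> A" "\<forall>\<xi>. ((\<lambda>i. g i \<xi>) \<longlongrightarrow> T \<xi>) strong_net"
    by (rule sot_closure_net[OF T])
  note g = this[rule_format]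
  have "(\<Sum>\<xi>\<in>F. inner (g i (y \<xi>)) \<xi>) = 0" for i
    using zero[OF star_algebraD(6)[OF A g(1)]] star_algebraD(1)[OF A g(1)]
    by (simp add: inner_cadjoint' inner_cadjoint[symmetric] inner_commute)
  moreover have "((\<lambda>i. \<Sum>\<xi>\<in>F. inner (g i (y \<xi>)) \<xi>) \<longlongrightarrow> (\<Sum>\<xi>\<in>F. inner (T (y \<xi>)) \<xi>)) strong_net"
    by (intro tendsto_intros g)
  ultimately have "(\<Sum>\<xi>\<in>F. inner (T (y \<xi>)) \<xi>) = 0"
    by (simp add: tendsto_const_iff)
  then show "(\<Sum>\<xi>\<in>F. inner (cadjoint T \<xi>) (y \<xi>)) = 0"
    by (simp add: inner_cadjoint'[OF \<open>complex_linear T\<close>] inner_cadjoint[OF \<open>complex_linear T\<close>, symmetric] inner_commute)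
qed (use star_algebraD[OF A] star_algebra_more[OF A] in auto)

text \<open>The Hermitian parts of a strongly convergent net converge only weakly in general, which
  again suffices. Hermitian elements form a real subspace only; this is why the criterion works with
  real scalars and the real inner product.\<close>

lemma selfadjoint_sot_closure:
  assumes A: "star_algebra A" and T: "T \<in> sot_closure A"
    and "complex_linear T" and sa: "cadjoint T = T"
  shows "T \<in> sot_closure {a \<in> A. cadjoint a = a}"
proof (rule in_sot_closure_if_orthogonal)
  show "{a \<in> A. cadjoint a = a} \<noteq> {}"
    using star_algebraD(2)[OF A] cadjoint_id by blast
next
  fix F y assume "finite F"
    and zero: "\<And>a. a \<in> {a \<in> A. cadjoint a = a} \<Longrightarrow> (\<Sum>\<xi>\<in>F. inner (blinfun_apply a \<xi>) (y \<xi>)) = 0"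
  obtain g :: "'a set \<times> nat \<Rightarrow> _" where "\<forall>i. g i \<in> A" "\<forall>\<xi>. ((\<lambda>i. g i \<xi>) \<longlongrightarrow> T \<xi>) strong_net"
    by (rule sot_closure_net[OF T])
  note g = this[rule_format]
  \<comment> \<open>In \<open>g i + cadjoint (g i)\<close> the adjoint is moved to the other side of
    the inner product, leaving only terms in which \<open>g i\<close> itself converges
    strongly.\<close>
  have "(\<Sum>\<xi>\<in>F. inner (g i \<xi>) (y \<xi>) + inner \<xi> (g i (y \<xi>))) = 0" for i
  proof -
    note lin = star_algebraD(1)[OF A g(1)[of i]]
    have "g i + cadjoint (g i) \<in> {a \<in> A. cadjoint a = a}"
      using star_algebraD[OF A] g(1) lin by (simp add: cadjoint_add add.commute)
    from zero[OF this] show ?thesis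
      by (simp add: blinfun.add_left inner_add_left inner_cadjoint'[OF lin])
  qed
  moreover have "((\<lambda>i. \<Sum>\<xi>\<in>F. inner (g i \<xi>) (y \<xi>) + inner \<xi> (g i (y \<xi>)))
      \<longlongrightarrow> (\<Sum>\<xi>\<in>F. inner (T \<xi>) (y \<xi>) + inner \<xi> (T (y \<xi>)))) strong_net"
    by (intro tendsto_intros g)
  ultimately have "(\<Sum>\<xi>\<in>F. inner (T \<xi>) (y \<xi>) + inner \<xi> (T (y \<xi>))) = 0"
    by (simp add: tendsto_const_iff)
  moreover have "inner \<xi> (T (y \<xi>)) = inner (T \<xi>) (y \<xi>)" for \<xi>
    using inner_cadjoint[OF \<open>complex_linear T\<close>, of \<xi> "y \<xi>"] sa by simp
  ultimately show "(\<Sum>\<xi>\<in>F. inner (T \<xi>) (y \<xi>)) = 0"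
    by (simp flip: sum_distrib_left)
next
  fix r a assume "a \<in> {a \<in> A. cadjoint a = a}"
  then show "r *\<^sub>R a \<in> {a \<in> A. cadjoint a = a}"
    using star_algebraD(1)[OF A, of a] star_algebraD(4)[OF A, of a]
    by (simp add: scaleR_eq_blinfun_scaleC cadjoint_scaleC)
qed (use star_algebraD[OF A] in \<open>auto simp: cadjoint_add\<close>)

lemma von_neumann_algebra_sot_closure:
  assumes A: "star_algebra A"
  shows "von_neumann_algebra (sot_closure A)" (is "von_neumann_algebra ?C")
proof -
  have sub: "A \<subseteq> ?C"
    by (rule closure_of_subset) (simp add: strong_operator_topology_topspace)
  have lin: "complex_linear T" if T: "T \<in> ?C" for T
    unfolding complex_linear_def
  proof (intro allI)
    fix c x
    obtain g :: "'a set \<times> nat \<Rightarrow> _" where "\<forall>i. g i \<in> A" "\<forall>\<xi>. ((\<lambda>i. g i \<xi>) \<longlongrightarrow> T \<xi>) strong_net"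
      by (rule sot_closure_net[OF T])
    note g = this[rule_format]
    have "((\<lambda>i. g i (c *\<^sub>C x)) \<longlongrightarrow> c *\<^sub>C T x) strong_net"
      using tendsto_scaleC[OF g(2)] by (simp add: complex_linearD[OF star_algebraD(1)[OF A g(1)]])
    then show "T (c *\<^sub>C x) = c *\<^sub>C T x"
      using tendsto_unique[OF strong_net_neq_bot g(2)] by blast
  qed
  have add: "S + T \<in> ?C" if ST: "S \<in> ?C" "T \<in> ?C" for S T
  proof -
    obtain g :: "'a set \<times> nat \<Rightarrow> _" where "\<forall>i. g i \<in> A" "\<forall>\<xi>. ((\<lambda>i. g i \<xi>) \<longlongrightarrow> S \<xi>) strong_net"
      by (rule sot_closure_net[OF ST(1)])
    note g = this[rule_format]
    obtain h :: "'a set \<times> nat \<Rightarrow> _" where "\<forall>i. h i \<in> A" "\<forall>\<xi>. ((\<lambda>i. h i \<xi>) \<longlongrightarrow> T \<xi>) strong_net"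
      by (rule sot_closure_net[OF ST(2)])
    note h = this[rule_format]
    show ?thesis
      using tendsto_add[OF g(2) h(2)]
      by (intro sot_closure_limit[OF strong_net_neq_bot, of "\<lambda>i. g i + h i"] star_algebraD(3)[OF A] g h)
        (simp add: blinfun.add_left)
  qed
  have scale: "blinfun_scaleC c T \<in> ?C" if T: "T \<in> ?C" for c T
  proof -
    obtain g :: "'a set \<times> nat \<Rightarrow> _" where "\<forall>i. g i \<in> A" "\<forall>\<xi>. ((\<lambda>i. g i \<xi>) \<longlongrightarrow> T \<xi>) strong_net"
      by (rule sot_closure_net[OF T])
    note g = this[rule_format]
    show ?thesis
      using tendsto_scaleC[OF g(2)]
      by (intro sot_closure_limit[OF strong_net_neq_bot, of "\<lambda>i. blinfun_scaleC c (g i)"] star_algebraD(4)[OF A] g)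
        simp
  qed
  have comp: "S o\<^sub>L T \<in> ?C" if ST: "S \<in> ?C" "T \<in> ?C" for S T
  proof -
    obtain g :: "'a set \<times> nat \<Rightarrow> _" where "\<forall>i. g i \<in> A" "\<forall>\<xi>. ((\<lambda>i. g i \<xi>) \<longlongrightarrow> S \<xi>) strong_net"
      by (rule sot_closure_net[OF ST(1)])
    note g = this[rule_format]
    obtain h :: "'a set \<times> nat \<Rightarrow> _" where "\<forall>i. h i \<in> A" "\<forall>\<xi>. ((\<lambda>i. h i \<xi>) \<longlongrightarrow> T \<xi>) strong_net"
      by (rule sot_closure_net[OF ST(2)])
    note h = this[rule_format]
    \<comment> \<open>Without a norm bound composition is not jointly strongly continuous, so the
      limits are taken one factor at a time; the second one ends in the closure of the
      closure.\<close>
    have Sh: "S o\<^sub>L h i \<in> ?C" for i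
      using g(2) by (intro sot_closure_limit[OF strong_net_neq_bot, of "\<lambda>j. g j o\<^sub>L h i"] star_algebraD(5)[OF A] g h) simp
    have "S o\<^sub>L T \<in> sot_closure ?C"
      by (rule sot_closure_limit[where g = "\<lambda>i. S o\<^sub>L h i", OF strong_net_neq_bot Sh])
        (simp add: blinfun.tendsto[OF tendsto_const h(2)])
    then show ?thesis
      by simp
  qed
  show ?thesis
    unfolding von_neumann_algebra_iff star_algebra_def
    using lin add scale comp cadjoint_in_sot_closure[OF A] star_algebraD(2)[OF A] sub by auto
qed

section \<open>Polynomial truncation and Kaplansky density\<close>

lemma inner_selfadjoint:
  "complex_linear a \<Longrightarrow> cadjoint a = a \<Longrightarrow> inner (a x) y = inner x (a y)"
  by (metis inner_cadjoint)

text \<open>Partial sums of the Neumann series for \<open>(1 + a\<^sup>2)\<^sup>-\<^sup>1\<close> around \<open>1 + C\<^sup>2\<close>. The point is that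
  they are polynomials in \<open>a\<close>, yet \<open>a (1 + a\<^sup>2)\<^sup>-\<^sup>1\<close> truncates \<open>a\<close>.\<close>

primrec resolvent_op :: "real \<Rightarrow> nat \<Rightarrow> ('h::real_normed_vector \<Rightarrow>\<^sub>L 'h) \<Rightarrow> ('h \<Rightarrow>\<^sub>L 'h)" where
  "resolvent_op C 0 a = 0"
| "resolvent_op C (Suc n) a =
    (1 / (1 + C\<^sup>2)) *\<^sub>R (id_blinfun + (C\<^sup>2 *\<^sub>R resolvent_op C n a - (a o\<^sub>L (a o\<^sub>L resolvent_op C n a))))"

lemma resolvent_op_commute: "resolvent_op C n a (a x) = a (resolvent_op C n a x)"
  by (induction n)
    (simp_all add: blinfun.zero_left blinfun.zero_right blinfun.scaleR_left blinfun.scaleR_right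
      blinfun.add_left blinfun.add_right blinfun.diff_left blinfun.diff_right)

text \<open>The residual of \<open>s = resolvent_op C n a x\<close> in the equation
  \<open>s + a (a s) = x\<close>.\<close>

definition resolvent_err :: "real \<Rightarrow> nat \<Rightarrow> ('h::real_normed_vector \<Rightarrow>\<^sub>L 'h) \<Rightarrow> 'h \<Rightarrow> 'h" where
  "resolvent_err C n a x = x - resolvent_op C n a x - a (a (resolvent_op C n a x))"

lemma one_plus_square_pos: "0 < 1 + C\<^sup>2" for C :: real
  by (simp add: add_pos_nonneg)

text \<open>One iteration replaces \<open>s\<close> by
  \<open>(x + (C^2 - a^2) s) / (1 + C^2)\<close>, whose fixed point solves
  \<open>(1 + a^2) s = x\<close>; hence the residual is multiplied by
  \<open>(C^2 - a^2) / (1 + C^2)\<close>.\<close>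

lemma resolvent_err_Suc:
  "resolvent_err C (Suc n) a x =
    (1 / (1 + C\<^sup>2)) *\<^sub>R (C\<^sup>2 *\<^sub>R resolvent_err C n a x - a (a (resolvent_err C n a x)))"
proof -
  let ?s = "resolvent_op C n a x"
  have "(1 + C\<^sup>2) *\<^sub>R resolvent_err C (Suc n) a x =
      (1 + C\<^sup>2) *\<^sub>R x - (x + (C\<^sup>2 *\<^sub>R ?s - a (a ?s))) - a (a (x + (C\<^sup>2 *\<^sub>R ?s - a (a ?s))))"
    using one_plus_square_pos[of C]
    by (simp add: resolvent_err_def blinfun.scaleR_left blinfun.scaleR_right blinfun.add_left
        blinfun.diff_left scaleR_diff_right)
  also have "\<dots> = C\<^sup>2 *\<^sub>R resolvent_err C n a x - a (a (resolvent_err C n a x))"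
    by (simp add: resolvent_err_def blinfun.scaleR_right blinfun.add_right blinfun.diff_right
        scaleR_diff_right scaleR_add_left)
  finally have "(1 / (1 + C\<^sup>2)) *\<^sub>R (1 + C\<^sup>2) *\<^sub>R resolvent_err C (Suc n) a x =
      (1 / (1 + C\<^sup>2)) *\<^sub>R (C\<^sup>2 *\<^sub>R resolvent_err C n a x - a (a (resolvent_err C n a x)))"
    by simp
  then show ?thesis
    using one_plus_square_pos[of C] by simp
qed

text \<open>Morally \<open>0 \<le> a^2 \<le> C^2\<close>. In place of operator order the square is
  expanded: the cross term \<open>- 2 C^2 |a x|^2\<close> absorbs \<open>|a (a x)|^2\<close>, which
  is at most \<open>C^2 |a x|^2\<close>.\<close>

lemma norm_square_defect_le:
  fixes a :: "'h::complex_hilbert_space \<Rightarrow>\<^sub>L 'h"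
  assumes "complex_linear a" "cadjoint a = a" "norm a \<le> C"
  shows "norm (C\<^sup>2 *\<^sub>R x - a (a x)) \<le> C\<^sup>2 * norm x"
proof -
  have C: "0 \<le> C"
    using assms(3) norm_ge_zero order_trans by blast
  have le: "norm (a y) \<le> C * norm y" for y
    using norm_blinfun[of a y] assms(3) by (meson mult_right_mono norm_ge_zero order_trans)
  have "(norm (a (a x)))\<^sup>2 \<le> (C * norm (a x))\<^sup>2"
    by (intro power_mono le) simp
  then have "(norm (a (a x)))\<^sup>2 \<le> C\<^sup>2 * (norm (a x))\<^sup>2"
    by (simp add: power_mult_distrib)
  moreover have "(norm (C\<^sup>2 *\<^sub>R x - a (a x)))\<^sup>2 =
      (C\<^sup>2)\<^sup>2 * (norm x)\<^sup>2 - 2 * C\<^sup>2 * (norm (a x))\<^sup>2 + (norm (a (a x)))\<^sup>2"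
    using inner_selfadjoint[OF assms(1,2), of "a x" x] inner_commute[of x "a (a x)"]
    unfolding power2_norm_eq_inner
    by (simp add: inner_diff_left inner_diff_right power2_eq_square algebra_simps)
  moreover have "0 \<le> C\<^sup>2 * (norm (a x))\<^sup>2"
    by simp
  ultimately have "(norm (C\<^sup>2 *\<^sub>R x - a (a x)))\<^sup>2 \<le> (C\<^sup>2 * norm x)\<^sup>2"
    unfolding power_mult_distrib by linarith
  then show ?thesis
    by (rule power2_le_imp_le) simp
qed

lemma norm_resolvent_err_le:
  fixes a :: "'h::complex_hilbert_space \<Rightarrow>\<^sub>L 'h"
  assumes "complex_linear a" "cadjoint a = a" "norm a \<le> C"
  shows "norm (resolvent_err C n a x) \<le> (C\<^sup>2 / (1 + C\<^sup>2)) ^ n * norm x"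
proof (induction n)
  case 0
  then show ?case
    by (simp add: resolvent_err_def blinfun.zero_left blinfun.zero_right)
next
  case (Suc n)
  have "norm (resolvent_err C (Suc n) a x) \<le> (1 / (1 + C\<^sup>2)) * (C\<^sup>2 * norm (resolvent_err C n a x))"
    unfolding resolvent_err_Suc norm_scaleR
    using norm_square_defect_le[OF assms, of "resolvent_err C n a x"] one_plus_square_pos[of C]
    by (intro mult_mono) auto
  also have "\<dots> = (C\<^sup>2 / (1 + C\<^sup>2)) * norm (resolvent_err C n a x)"
    by simp
  also have "\<dots> \<le> (C\<^sup>2 / (1 + C\<^sup>2)) * ((C\<^sup>2 / (1 + C\<^sup>2)) ^ n * norm x)"
    by (intro mult_left_mono Suc) simp
  finally show ?case
    by simp
qed

text \<open>The residual is no longer than \<open>x\<close>, so \<open>s + a (a s)\<close> has norm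
  at most \<open>2 |x|\<close>. Since \<open>a\<close> is Hermitian, the square of that norm is
  \<open>|s|^2 + 2 |a s|^2 + |a (a s)|^2\<close>, with no negative term. The bound depends neither
  on \<open>C\<close> nor on \<open>n\<close>.\<close>

lemma norm_resolvent_op_le:
  fixes a :: "'h::complex_hilbert_space \<Rightarrow>\<^sub>L 'h"
  assumes "complex_linear a" "cadjoint a = a" "norm a \<le> C"
  shows "norm (resolvent_op C n a x) \<le> 2 * norm x"
    and "norm (a (resolvent_op C n a x)) \<le> 2 * norm x"
proof -
  let ?s = "resolvent_op C n a x"
  have "(C\<^sup>2 / (1 + C\<^sup>2)) ^ n \<le> 1"
    by (intro power_le_one) (auto simp: one_plus_square_pos)
  then have "norm (resolvent_err C n a x) \<le> norm x"
    using norm_resolvent_err_le[OF assms, of n x] mult_right_mono[of _ 1 "norm x"] by fastforce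
  moreover have "?s + a (a ?s) = x - resolvent_err C n a x"
    by (simp add: resolvent_err_def)
  ultimately have "norm (?s + a (a ?s)) \<le> 2 * norm x"
    using norm_triangle_ineq4[of x "resolvent_err C n a x"] by simp
  then have "(norm (?s + a (a ?s)))\<^sup>2 \<le> (2 * norm x)\<^sup>2"
    by (intro power_mono) auto
  moreover have "(norm (?s + a (a ?s)))\<^sup>2 = (norm ?s)\<^sup>2 + 2 * (norm (a ?s))\<^sup>2 + (norm (a (a ?s)))\<^sup>2"
    using inner_selfadjoint[OF assms(1,2), of "a ?s" ?s] inner_commute[of ?s "a (a ?s)"]
    by (simp add: power2_norm_eq_inner inner_add_left inner_add_right)
  ultimately have "(norm ?s)\<^sup>2 \<le> (2 * norm x)\<^sup>2" "(norm (a ?s))\<^sup>2 \<le> (2 * norm x)\<^sup>2"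
    using zero_le_power2[of "norm ?s"] zero_le_power2[of "norm (a ?s)"]
      zero_le_power2[of "norm (a (a ?s))"] by linarith+
  then show "norm ?s \<le> 2 * norm x" "norm (a ?s) \<le> 2 * norm x"
    by (auto intro: power2_le_imp_le)
qed

text \<open>Solves \<open>z = w (1 + w\<^sup>2)\<^sup>-\<^sup>1\<close> for \<open>w\<close>.\<close>

lemma resolvent_equation_solution:
  fixes M :: "('h::complex_hilbert_space \<Rightarrow>\<^sub>L 'h) set"
  assumes M: "star_algebra M" and "closed M"
    and z: "z \<in> M" "cadjoint z = z" "norm z \<le> 2/5"
  obtains w where "w \<in> M" "cadjoint w = w" "w = z + (z o\<^sub>L (w o\<^sub>L w))" "w o\<^sub>L z = z o\<^sub>L w"
proof -
  \<comment> \<open>A complete set on which \<open>f\<close> contracts: 2/5 + (2/5)(1/4) = 1/2 keeps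
    the radius, and (2/5)(1/2 + 1/2) = 2/5 is the ratio. Commutation with \<open>z\<close> is
    carried along because the symmetry of \<open>z w w\<close> depends on it.\<close>
  define S where "S = {w \<in> M. norm w \<le> 1/2 \<and> (\<forall>x y. inner (w x) y = inner x (w y)) \<and>
    (\<forall>x. w (z x) = z (w x))}"
  define f where "f w = z + (z o\<^sub>L (w o\<^sub>L w))" for w
  have zsa: "inner (z x) y = inner x (z y)" for x y
    using inner_selfadjoint star_algebraD(1)[OF M] z by blast
  have "closed S"
    unfolding S_def
    by (intro closed_Collect_conj closed_Collect_all closed_Collect_le closed_Collect_eq
        continuous_intros blinfun.continuous_on) (simp_all add: \<open>closed M\<close>)
  then have "complete S"
    by (simp add: complete_eq_closed)
  moreover have "0 \<in> S"
    using star_algebra_more(2)[OF M] by (simp add: S_def blinfun.zero_left blinfun.zero_right)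
  then have "S \<noteq> {}"
    by blast
  moreover have "f w \<in> S" if w: "w \<in> S" for w
  proof -
    have "f w \<in> M"
      unfolding f_def using w z(1) by (intro star_algebraD[OF M]) (auto simp: S_def)
    moreover have "norm (f w) \<le> 1/2"
    proof -
      have "norm (z o\<^sub>L (w o\<^sub>L w)) \<le> 2/5 * (1/2 * (1/2))"
        using w z(3) unfolding S_def
        by (intro order_trans[OF norm_blinfun_compose] mult_mono) auto
      then show ?thesis
        unfolding f_def using norm_triangle_ineq[of z "z o\<^sub>L (w o\<^sub>L w)"] z(3) by simp
    qed
    ultimately show ?thesis
      using w zsa
      by (auto simp: S_def f_def blinfun.add_left blinfun.add_right inner_add_left inner_add_right)
  qed
  moreover have "dist (f v) (f w) \<le> (2/5) * dist v w" if "v \<in> S" "w \<in> S" for v w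
  proof -
    have "f v - f w = z o\<^sub>L ((v o\<^sub>L (v - w)) + ((v - w) o\<^sub>L w))"
      by (rule blinfun_eqI)
        (simp add: f_def blinfun.add_left blinfun.add_right blinfun.diff_left blinfun.diff_right)
    also have "norm \<dots> \<le> (2/5) * (norm (v o\<^sub>L (v - w)) + norm ((v - w) o\<^sub>L w))"
      using z(3) by (intro order_trans[OF norm_blinfun_compose] mult_mono norm_triangle_ineq) auto
    also have "\<dots> \<le> (2/5) * (1/2 * norm (v - w) + norm (v - w) * (1/2))"
      using that unfolding S_def
      by (intro mult_left_mono add_mono order_trans[OF norm_blinfun_compose] mult_mono) auto
    finally show ?thesis
      by (simp add: dist_norm)
  qed
  ultimately have "\<exists>!w. w \<in> S \<and> f w = w"
    by (intro Banach_fix[of S "2/5" f]) auto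
  then obtain w where w: "w \<in> S" "f w = w"
    by blast
  have "cinner (w x) y = cinner x (w y)" for x y
  proof (rule complex_eqI)
    have lin: "complex_linear w"
      using w(1) star_algebraD(1)[OF M] by (simp add: S_def)
    have sa: "inner (w x) y = inner x (w y)" for x y
      using w(1) by (simp add: S_def)
    show "Re (cinner (w x) y) = Re (cinner x (w y))"
      using sa by (simp flip: inner_eq_Re_cinner)
    show "Im (cinner (w x) y) = Im (cinner x (w y))"
      using sa[of "\<i> *\<^sub>C x" y] by (simp add: Im_cinner complex_linearD[OF lin])
  qed
  then have "cadjoint w = w"
    by (rule cadjoint_eqI)
  moreover have "w o\<^sub>L z = z o\<^sub>L w"
    using w(1) by (intro blinfun_eqI) (simp add: S_def)
  ultimately show ?thesis
    using that[of w] w by (simp add: S_def f_def)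
qed

text \<open>With \<open>z = w (1 + w^2)^-1\<close> and \<open>w\<close> in \<open>M\<close>, a
  Hermitian \<open>a\<close> in \<open>A\<close> that is close to \<open>w\<close> on finitely many
  vectors makes \<open>a (1 + a^2)^-1\<close> close to \<open>z\<close>, with no bound on
  \<open>a\<close> itself. The element \<open>a\<close> is fixed before \<open>C\<close>, so that
  \<open>C\<close> can later also dominate the matrix values of a polynomial representing
  \<open>a\<close>; only \<open>n\<close> depends on \<open>C\<close>.\<close>

lemma kaplansky_truncation:
  fixes A M :: "('h::complex_hilbert_space \<Rightarrow>\<^sub>L 'h) set"
  assumes A: "star_algebra A" and M: "von_neumann_algebra M"
    and sub: "M \<subseteq> sot_closure A"
    and z: "z \<in> M" "cadjoint z = z" "norm z \<le> 2/5"
    and F: "finite F" and e: "e > 0"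
  shows "\<exists>a\<in>A. cadjoint a = a \<and> (\<forall>C\<ge>norm a. \<exists>n. \<forall>\<xi>\<in>F. norm (a (resolvent_op C n a \<xi>) - z \<xi>) < e)"
proof -
  obtain w where w: "w \<in> M" "cadjoint w = w" "w = z + (z o\<^sub>L (w o\<^sub>L w))" "w o\<^sub>L z = z o\<^sub>L w"
    using resolvent_equation_solution[OF star_algebra_of_vna[OF M] closed_of_vna[OF M] z] .
  have eq: "w x = z x + z (w (w x))" for x
    by (subst w(3)) (simp add: blinfun.add_left)
  have comm: "w (z x) = z (w x)" for x
    using w(4) by (metis blinfun_apply_blinfun_compose)
  \<comment> \<open>This is \<open>(1 + w^2)^-1 \<xi>\<close> written without an inverse: since
    \<open>w = z + z w w\<close> and \<open>w\<close> commutes with \<open>z\<close>, the operator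
    \<open>1 - z w\<close> inverts \<open>1 + w^2\<close>.\<close>
  define u where "u \<xi> = \<xi> - z (w \<xi>)" for \<xi>
  have wu: "w (u \<xi>) = z \<xi>" for \<xi>
    using eq[of \<xi>] by (simp add: u_def blinfun.diff_right comm algebra_simps)
  have u: "u \<xi> + w (w (u \<xi>)) = \<xi>" for \<xi>
    by (simp add: wu comm) (simp add: u_def)
  have "w \<in> sot_closure {a \<in> A. cadjoint a = a}"
    using w(1,2) sub star_algebraD(1)[OF star_algebra_of_vna[OF M]]
    by (intro selfadjoint_sot_closure[OF A]) auto
  \<comment> \<open>Only the vectors \<open>u \<xi>\<close> and \<open>z \<xi>\<close> occur in the
    resolvent identity below. Both errors enter with factor 2, so \<open>e / 8\<close> leaves half
    of \<open>e\<close> for the residual.\<close>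
  from sot_closure_approx[OF this, of "u ` F \<union> z ` F" "e / 8"] F e
  obtain a where a: "a \<in> A" "cadjoint a = a"
    and au: "\<And>\<xi>. \<xi> \<in> F \<Longrightarrow> norm (a (u \<xi>) - w (u \<xi>)) < e / 8"
    and az: "\<And>\<xi>. \<xi> \<in> F \<Longrightarrow> norm (a (z \<xi>) - w (z \<xi>)) < e / 8"
    by auto
  have lin: "complex_linear a"
    using star_algebraD(1)[OF A a(1)] .
  have "\<exists>n. \<forall>\<xi>\<in>F. norm (a (resolvent_op C n a \<xi>) - z \<xi>) < e" if C: "C \<ge> norm a" for C
  proof -
    define K where "K = Max (insert 0 ((\<lambda>\<xi>. norm (z \<xi>)) ` F))"
    have K: "0 \<le> K" "\<And>\<xi>. \<xi> \<in> F \<Longrightarrow> norm (z \<xi>) \<le> K"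
      using F by (auto simp: K_def)
    have "e / 2 / (K + 1) > 0" "C\<^sup>2 / (1 + C\<^sup>2) < 1"
      using e K(1) one_plus_square_pos[of C] by auto
    then obtain n where n: "(C\<^sup>2 / (1 + C\<^sup>2)) ^ n < e / 2 / (K + 1)"
      using real_arch_pow_inv by blast
    let ?S = "resolvent_op C n a"
    have "norm (a (?S \<xi>) - z \<xi>) < e" if "\<xi> \<in> F" for \<xi>
    proof -
      let ?v = "z \<xi>"
      have "?S \<xi> = ?S (u \<xi>) + ?S (w ?v)"
        using u[of \<xi>] by (metis blinfun.add_right wu)
      then have "a (?S \<xi>) = ?S (a (u \<xi>)) + a (?S (w ?v))"
        by (simp add: blinfun.add_right resolvent_op_commute)
      moreover have "?v = ?S ?v + a (?S (a ?v)) + resolvent_err C n a ?v"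
        by (simp add: resolvent_err_def resolvent_op_commute)
      \<comment> \<open>Approximate resolvent identity for
        \<open>a (1 + a^2)^-1 - w (1 + w^2)^-1\<close>; the last term corrects for \<open>?S\<close>
        being only a partial sum.\<close>
      ultimately have "a (?S \<xi>) - ?v =
          ?S (a (u \<xi>) - w (u \<xi>)) - a (?S (a ?v - w ?v)) - resolvent_err C n a ?v"
        by (simp add: blinfun.diff_right wu algebra_simps)
      also have "norm \<dots> \<le> norm (?S (a (u \<xi>) - w (u \<xi>))) + norm (a (?S (a ?v - w ?v)))
          + norm (resolvent_err C n a ?v)"
        by (rule order_trans[OF norm_triangle_ineq4 add_right_mono[OF norm_triangle_ineq4]])
      also have "\<dots> \<le> 2 * norm (a (u \<xi>) - w (u \<xi>)) + 2 * norm (a ?v - w ?v) + e / 2"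
      proof (intro add_mono norm_resolvent_op_le[OF lin a(2) C])
        have "norm (resolvent_err C n a ?v) \<le> (C\<^sup>2 / (1 + C\<^sup>2)) ^ n * norm ?v"
          by (rule norm_resolvent_err_le[OF lin a(2) C])
        also have "\<dots> \<le> e / 2 / (K + 1) * (K + 1)"
          using n K(2)[OF that] K(1) e by (intro mult_mono) auto
        also have "\<dots> = e / 2"
          using K(1) by (simp add: field_simps)
        finally show "norm (resolvent_err C n a ?v) \<le> e / 2"
          by simp
      qed
      also have "\<dots> < e"
        using au[OF that] az[OF that] by simp
      finally show ?thesis .
    qed
    then show ?thesis
      by blast
  qed
  with a show ?thesis
    by blast
qed

lemma norm_truncation_le:
  fixes a :: "'h::complex_hilbert_space \<Rightarrow>\<^sub>L 'h"
  assumes "complex_linear a" "cadjoint a = a" "norm a \<le> C"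
  shows "norm (a o\<^sub>L resolvent_op C n a) \<le> 2"
  by (rule norm_blinfun_bound) (use norm_resolvent_op_le(2)[OF assms] in auto)

section \<open>Strong continuity of a normal trace on bounded sets\<close>

text \<open>On norm-bounded nets strong convergence implies ultraweak convergence: the defining
  series is dominated by \<open>B |\<xi> n| |\<eta> n|\<close>, so limit and sum interchange
  (Tannery). The rest is induction over the sets generated from the subbasis.\<close>

lemma eventually_in_ultraweak_nhd:
  fixes T :: "'i \<Rightarrow> ('h::complex_hilbert_space \<Rightarrow>\<^sub>L 'h)"
  assumes "openin ultraweak_topology U" "0 \<in> U"
    and lim: "\<And>\<xi>. ((\<lambda>i. T i \<xi>) \<longlongrightarrow> 0) F" and bound: "\<And>i. norm (T i) \<le> B" and "F \<noteq> bot"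
  shows "eventually (\<lambda>i. T i \<in> U) F"
proof -
  define \<S> :: "('h \<Rightarrow>\<^sub>L 'h) set set" where
    "\<S> = {{T. (\<Sum>n. cinner (blinfun_apply T (\<xi> n)) (\<eta> n)) \<in> U} | \<xi> \<eta> U.
        summable (\<lambda>n. (norm (\<xi> n))\<^sup>2) \<and> summable (\<lambda>n. (norm (\<eta> n))\<^sup>2) \<and> open U}"
  have "generate_topology_on \<S> U"
    using assms(1) by (simp add: ultraweak_topology_def openin_topology_generated_by_iff \<S>_def)
  then have "0 \<in> U \<longrightarrow> eventually (\<lambda>i. T i \<in> U) F"
  proof induction
    case (Int a b)
    then show ?case
      by (auto intro: eventually_conj)
  next
    case (UN K)
    show ?case
    proof
      assume "0 \<in> \<Union>K"
      then obtain k where "k \<in> K" "0 \<in> k"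
        by blast
      then have "eventually (\<lambda>i. T i \<in> k) F"
        using UN by blast
      then show "eventually (\<lambda>i. T i \<in> \<Union>K) F"
        by (rule eventually_mono) (use \<open>k \<in> K\<close> in blast)
    qed
  next
    case (Basis s)
    then obtain \<xi> \<eta> V where s: "s = {T. (\<Sum>n. cinner (blinfun_apply T (\<xi> n)) (\<eta> n)) \<in> V}"
      and sum: "summable (\<lambda>n. (norm (\<xi> n))\<^sup>2)" "summable (\<lambda>n. (norm (\<eta> n))\<^sup>2)" and V: "open V"
      unfolding \<S>_def by blast
    have "B \<ge> 0"
      using bound[of undefined] norm_ge_zero order_trans by blast
    have "summable (\<lambda>n. norm (\<xi> n) * norm (\<eta> n))"
    proof (rule summable_comparison_test')
      show "summable (\<lambda>n. (norm (\<xi> n))\<^sup>2 + (norm (\<eta> n))\<^sup>2)"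
        using sum by (rule summable_add)
      show "norm (norm (\<xi> n) * norm (\<eta> n)) \<le> (norm (\<xi> n))\<^sup>2 + (norm (\<eta> n))\<^sup>2" if "n \<ge> 0" for n
      proof -
        have p: "0 \<le> norm (\<xi> n) * norm (\<eta> n)"
          by simp
        have "2 * (norm (\<xi> n) * norm (\<eta> n)) \<le> (norm (\<xi> n))\<^sup>2 + (norm (\<eta> n))\<^sup>2"
          using sum_squares_bound[of "norm (\<xi> n)" "norm (\<eta> n)"] by (simp only: mult.assoc)
        then show ?thesis
          using p unfolding real_norm_def abs_of_nonneg[OF p] by linarith
      qed
    qed
    then have summ: "summable (\<lambda>n. B * (norm (\<xi> n) * norm (\<eta> n)))"
      by (rule summable_mult)
    have term_lim: "((\<lambda>i. cinner (T i (\<xi> n)) (\<eta> n)) \<longlongrightarrow> 0) F" for n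
      using bounded_bilinear.tendsto[OF bounded_bilinear_cinner lim[of "\<xi> n"] tendsto_const[of "\<eta> n"]]
      by simp
    have term_le: "norm (cinner (T i (\<xi> n)) (\<eta> n)) \<le> B * (norm (\<xi> n) * norm (\<eta> n))" for n i
    proof -
      have "norm (cinner (T i (\<xi> n)) (\<eta> n)) \<le> norm (T i (\<xi> n)) * norm (\<eta> n)"
        by (rule cmod_cinner_le)
      also have "\<dots> \<le> (B * norm (\<xi> n)) * norm (\<eta> n)"
        using bound[of i] \<open>B \<ge> 0\<close>
        by (intro mult_right_mono order_trans[OF norm_blinfun] mult_mono) auto
      finally show ?thesis
        by (simp add: mult.assoc)
    qed
    have "((\<lambda>i. \<Sum>n. cinner (T i (\<xi> n)) (\<eta> n)) \<longlongrightarrow> (\<Sum>n. 0)) F"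
      using tannerys_theorem[of "\<lambda>n i. cinner (T i (\<xi> n)) (\<eta> n)" "\<lambda>_. 0" F
          "\<lambda>n. B * (norm (\<xi> n) * norm (\<eta> n))"]
      using term_lim term_le summ \<open>F \<noteq> bot\<close> by (simp add: case_prod_unfold)
    then have lim0: "((\<lambda>i. \<Sum>n. cinner (T i (\<xi> n)) (\<eta> n)) \<longlongrightarrow> 0) F"
      by simp
    show ?case
    proof
      assume "0 \<in> s"
      then have "0 \<in> V"
        by (simp add: s blinfun.zero_left)
      then show "eventually (\<lambda>i. T i \<in> s) F"
        using topological_tendstoD[OF lim0 V] by (simp add: s)
    qed
  qed simp
  with \<open>0 \<in> U\<close> show ?thesis
    by blast
qed

lemma tracial_state_add: "tracial_state M \<tau> \<Longrightarrow> S \<in> M \<Longrightarrow> T \<in> M \<Longrightarrow> \<tau> (S + T) = \<tau> S + \<tau> T"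
  and tracial_state_scale: "tracial_state M \<tau> \<Longrightarrow> T \<in> M \<Longrightarrow> \<tau> (blinfun_scaleC c T) = c * \<tau> T"
  and tracial_state_id: "tracial_state M \<tau> \<Longrightarrow> \<tau> id_blinfun = 1"
  by (simp_all add: tracial_state_def)

lemma tracial_state_zero:
  assumes "tracial_state M \<tau>" "star_algebra M"
  shows "\<tau> 0 = 0"
  using tracial_state_add[OF assms(1), of 0 0] star_algebra_more(2)[OF assms(2)] by simp

text \<open>Normality gives ultraweak continuity on \<open>M\<close>, and boundedness turns strong
  into ultraweak convergence. Additivity moves the limit point to 0, where the neighbourhood lemma
  applies.\<close>

lemma tracial_state_tendsto:
  fixes T :: "'i \<Rightarrow> ('h::complex_hilbert_space \<Rightarrow>\<^sub>L 'h)"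
  assumes \<tau>: "tracial_state M \<tau>" and M: "star_algebra M"
    and T: "\<And>i. T i \<in> M" "T\<^sub>0 \<in> M"
    and lim: "\<And>\<xi>. ((\<lambda>i. T i \<xi>) \<longlongrightarrow> T\<^sub>0 \<xi>) F" and bound: "\<And>i. norm (T i) \<le> B" and "F \<noteq> bot"
  shows "((\<lambda>i. \<tau> (T i)) \<longlongrightarrow> \<tau> T\<^sub>0) F"
proof (rule topological_tendstoI)
  fix V assume V: "open V" "\<tau> T\<^sub>0 \<in> V"
  define W where "W = (\<lambda>z. \<tau> T\<^sub>0 + z) -` V"
  have "open W"
    unfolding W_def by (intro open_vimage V continuous_intros)
  have top: "topspace (subtopology ultraweak_topology M) \<subseteq> M"
    by (simp add: topspace_subtopology)
  have "continuous_map (subtopology ultraweak_topology M) euclidean \<tau>"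
    using \<tau> by (simp add: tracial_state_def)
  then have "openin (subtopology ultraweak_topology M)
      {x \<in> topspace (subtopology ultraweak_topology M). \<tau> x \<in> W}"
    by (rule openin_continuous_map_preimage) (simp add: \<open>open W\<close>)
  then obtain U where U: "openin ultraweak_topology U"
    "{x \<in> topspace (subtopology ultraweak_topology M). \<tau> x \<in> W} = U \<inter> M"
    unfolding openin_subtopology by blast
  \<comment> \<open>The whole space is a subbasic set, obtained from zero vectors; hence 0 belongs
    to the underlying space of the generated topology.\<close>
  have "UNIV \<in> {{T. (\<Sum>n. cinner (blinfun_apply T (\<xi> n)) (\<eta> n)) \<in> U} | \<xi> \<eta> U.
      summable (\<lambda>n. (norm (\<xi> n :: 'h))\<^sup>2) \<and> summable (\<lambda>n. (norm (\<eta> n :: 'h))\<^sup>2) \<and> open U}"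
    by (rule CollectI, rule exI[of _ "\<lambda>_. 0"], rule exI[of _ "\<lambda>_. 0"], rule exI[of _ UNIV]) simp
  then have "0 \<in> topspace (ultraweak_topology :: ('h \<Rightarrow>\<^sub>L 'h) topology)"
    unfolding ultraweak_topology_def topology_generated_by_topspace by blast
  then have "0 \<in> {x \<in> topspace (subtopology ultraweak_topology M). \<tau> x \<in> W}"
    using star_algebra_more(2)[OF M] V(2) tracial_state_zero[OF \<tau> M] by (simp add: W_def)
  then have "0 \<in> U"
    unfolding U(2) by blast
  have "eventually (\<lambda>i. T i - T\<^sub>0 \<in> U) F"
  proof (rule eventually_in_ultraweak_nhd[OF U(1) \<open>0 \<in> U\<close>])
    show "((\<lambda>i. (T i - T\<^sub>0) \<xi>) \<longlongrightarrow> 0) F" for \<xi>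
      using tendsto_diff[OF lim[of \<xi>] tendsto_const[of "T\<^sub>0 \<xi>"]] by (simp add: blinfun.diff_left)
    show "norm (T i - T\<^sub>0) \<le> B + norm T\<^sub>0" for i
      using norm_triangle_ineq4[of "T i" "T\<^sub>0"] bound[of i] by linarith
  qed fact
  then show "eventually (\<lambda>i. \<tau> (T i) \<in> V) F"
  proof (rule eventually_mono)
    fix i assume "T i - T\<^sub>0 \<in> U"
    moreover have mem: "T i - T\<^sub>0 \<in> M"
      by (intro star_algebra_more[OF M] T)
    ultimately have "\<tau> (T i - T\<^sub>0) \<in> W"
      using U(2) by blast
    moreover have "\<tau> T\<^sub>0 + \<tau> (T i - T\<^sub>0) = \<tau> (T i)"
      using tracial_state_add[OF \<tau> T(2) mem] by simp
    ultimately show "\<tau> (T i) \<in> V"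
      by (simp add: W_def)
  qed
qed

section \<open>Strong limits of products and words with bounded factors\<close>

lemma strong_tendsto_compose:
  fixes S T :: "'i \<Rightarrow> ('h::real_normed_vector \<Rightarrow>\<^sub>L 'h)" and S\<^sub>0 T\<^sub>0 :: "'h \<Rightarrow>\<^sub>L 'h"
  assumes S: "\<And>\<xi>. ((\<lambda>i. S i \<xi>) \<longlongrightarrow> S\<^sub>0 \<xi>) F" and T: "\<And>\<xi>. ((\<lambda>i. T i \<xi>) \<longlongrightarrow> T\<^sub>0 \<xi>) F"
    and bound: "\<And>i. norm (S i) \<le> B"
  shows "((\<lambda>i. (S i o\<^sub>L T i) \<xi>) \<longlongrightarrow> (S\<^sub>0 o\<^sub>L T\<^sub>0) \<xi>) F"
proof -
  have "((\<lambda>i. S i (T i \<xi> - T\<^sub>0 \<xi>)) \<longlongrightarrow> 0) F"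
  proof (rule Lim_null_comparison)
    show "eventually (\<lambda>i. norm (S i (T i \<xi> - T\<^sub>0 \<xi>)) \<le> B * norm (T i \<xi> - T\<^sub>0 \<xi>)) F"
      using bound by (intro always_eventually allI order_trans[OF norm_blinfun] mult_right_mono) auto
    show "((\<lambda>i. B * norm (T i \<xi> - T\<^sub>0 \<xi>)) \<longlongrightarrow> 0) F"
      by (intro tendsto_mult_right_zero tendsto_norm_zero LIM_zero T)
  qed
  from tendsto_add[OF this S[of "T\<^sub>0 \<xi>"]] show ?thesis
    by (simp add: blinfun.diff_right)
qed

lemma word_op_Nil [simp]: "word_op xs [] = id_blinfun"
  and word_op_Cons [simp]:
    "word_op xs ((i, s) # w) = (if s then cadjoint (xs ! i) else xs ! i) o\<^sub>L word_op xs w"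
  by (simp_all add: word_op_def)

lemma word_op_mem:
  assumes M: "star_algebra M" and xs: "set xs \<subseteq> M" and w: "\<forall>(i, s)\<in>set w. i < length xs"
  shows "word_op xs w \<in> M"
  using w
proof (induction w)
  case (Cons a w)
  obtain i s where a: "a = (i, s)"
    by force
  have "xs ! i \<in> M"
    using Cons.prems xs by (auto simp: a)
  then show ?case
    using Cons star_algebraD[OF M] by (simp add: a)
qed (use star_algebraD[OF M] in simp)

text \<open>Adjoint letters are harmless because all families are Hermitian; in general they would
  break strong convergence. The common bound \<open>B\<close> makes composition continuous along the
  net.\<close>

lemma word_op_strong_tendsto:
  fixes g :: "'i \<Rightarrow> ('h::complex_hilbert_space \<Rightarrow>\<^sub>L 'h) list" and zs :: "('h \<Rightarrow>\<^sub>L 'h) list"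
  assumes len: "\<And>i. length (g i) = length zs"
    and lim: "\<And>l \<xi>. l < length zs \<Longrightarrow> ((\<lambda>i. (g i ! l) \<xi>) \<longlongrightarrow> (zs ! l) \<xi>) F"
    and sa: "\<And>l i. l < length zs \<Longrightarrow> cadjoint (g i ! l) = g i ! l" "\<And>l. l < length zs \<Longrightarrow> cadjoint (zs ! l) = zs ! l"
    and bound: "\<And>l i. l < length zs \<Longrightarrow> norm (g i ! l) \<le> B"
    and w: "\<forall>(l, s)\<in>set w. l < length zs"
  shows "((\<lambda>i. word_op (g i) w \<xi>) \<longlongrightarrow> word_op zs w \<xi>) F"
    and "norm (word_op (g i) w) \<le> B ^ length w"
proof -
  have "(\<forall>\<xi>. ((\<lambda>i. word_op (g i) w \<xi>) \<longlongrightarrow> word_op zs w \<xi>) F) \<and> (\<forall>i. norm (word_op (g i) w) \<le> B ^ length w)"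
    using w
  proof (induction w)
    case Nil
    then show ?case
      by (auto simp: norm_blinfun_id_le)
  next
    case (Cons a w)
    obtain l s where a: "a = (l, s)"
      by force
    have l: "l < length zs"
      using Cons.prems by (simp add: a)
    have "((\<lambda>i. (g i ! l o\<^sub>L word_op (g i) w) \<xi>) \<longlongrightarrow> (zs ! l o\<^sub>L word_op zs w) \<xi>) F" for \<xi>
      by (rule strong_tendsto_compose[where B = B]) (use Cons lim[OF l] bound[OF l] in auto)
    moreover have "norm (g i ! l o\<^sub>L word_op (g i) w) \<le> B * B ^ length w" for i
      using Cons bound[OF l, of i] order_trans[OF norm_ge_zero bound[OF l, of i]]
      by (intro order_trans[OF norm_blinfun_compose] mult_mono) auto
    ultimately show ?case
      by (simp add: a sa l)
  qed
  then show "((\<lambda>i. word_op (g i) w \<xi>) \<longlongrightarrow> word_op zs w \<xi>) F" "norm (word_op (g i) w) \<le> B ^ length w"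
    by blast+
qed

section \<open>Adjoints and normalized traces of matrices\<close>

lemma mat_adjoint_dim [simp]:
  "dim_row (mat_adjoint A) = dim_col A" "dim_col (mat_adjoint A) = dim_row A"
  by (simp_all add: mat_adjoint_def)

lemma mat_adjoint_carrier [simp, intro]: "A \<in> carrier_mat n m \<Longrightarrow> mat_adjoint A \<in> carrier_mat m n"
  by auto

lemma mat_adjoint_index [simp]:
  "i < dim_col A \<Longrightarrow> j < dim_row A \<Longrightarrow> mat_adjoint A $$ (i, j) = conjugate (A $$ (j, i))"
  by (simp add: mat_adjoint_def mat_of_rows_index)

lemma mat_adjoint_add:
  fixes A B :: "complex mat"
  assumes "A \<in> carrier_mat n m" "B \<in> carrier_mat n m"
  shows "mat_adjoint (A + B) = mat_adjoint A + mat_adjoint B"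
  using assms by (intro eq_matI) auto

lemma mat_adjoint_smult:
  fixes A :: "complex mat"
  shows "mat_adjoint (c \<cdot>\<^sub>m A) = cnj c \<cdot>\<^sub>m mat_adjoint A"
  by (intro eq_matI) auto

lemma mat_adjoint_adjoint [simp]: "mat_adjoint (mat_adjoint A) = A"
  for A :: "complex mat"
  by (intro eq_matI) auto

lemma mat_adjoint_one [simp]: "mat_adjoint (1\<^sub>m k :: complex mat) = 1\<^sub>m k"
  by (intro eq_matI) auto

lemma mat_mult_index_sum:
  assumes "A \<in> carrier_mat n k" "B \<in> carrier_mat k m" "i < n" "j < m"
  shows "(A * B) $$ (i, j) = (\<Sum>l<k. A $$ (i, l) * B $$ (l, j))"
  using assms by (simp add: scalar_prod_def atLeast0LessThan)

lemma mat_adjoint_mult: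
  fixes A B :: "complex mat"
  assumes A: "A \<in> carrier_mat n k" and B: "B \<in> carrier_mat k m"
  shows "mat_adjoint (A * B) = mat_adjoint B * mat_adjoint A"
proof (rule eq_matI)
  fix i j assume "i < dim_row (mat_adjoint B * mat_adjoint A)" "j < dim_col (mat_adjoint B * mat_adjoint A)"
  then have ij: "i < m" "j < n"
    using A B by auto
  have "mat_adjoint (A * B) $$ (i, j) = cnj ((A * B) $$ (j, i))"
    using ij A B by (subst mat_adjoint_index) auto
  also have "\<dots> = (\<Sum>l<k. mat_adjoint B $$ (i, l) * mat_adjoint A $$ (l, j))"
    using A B ij by (subst mat_mult_index_sum[OF A B]) (auto simp: mult.commute intro!: sum.cong)
  also have "\<dots> = (mat_adjoint B * mat_adjoint A) $$ (i, j)"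
    by (rule mat_mult_index_sum[symmetric]) (use A B ij in auto)
  finally show "mat_adjoint (A * B) $$ (i, j) = (mat_adjoint B * mat_adjoint A) $$ (i, j)" .
qed (use A B in auto)

lemma normalized_trace_add:
  "A \<in> carrier_mat k k \<Longrightarrow> B \<in> carrier_mat k k \<Longrightarrow>
    normalized_trace (A + B) = normalized_trace A + normalized_trace B"
  by (auto simp: normalized_trace_def sum.distrib add_divide_distrib)

lemma normalized_trace_smult:
  "A \<in> carrier_mat k k \<Longrightarrow> normalized_trace (c \<cdot>\<^sub>m A) = c * normalized_trace A"
  by (auto simp: normalized_trace_def sum_distrib_left)

lemma normalized_trace_one [simp]: "k > 0 \<Longrightarrow> normalized_trace (1\<^sub>m k) = 1"
  by (simp add: normalized_trace_def)

lemma normalized_trace_mult_commute: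
  assumes A: "A \<in> carrier_mat k k" and B: "B \<in> carrier_mat k k"
  shows "normalized_trace (A * B) = normalized_trace (B * A)"
proof -
  have "(\<Sum>i<k. (A * B) $$ (i, i)) = (\<Sum>i<k. \<Sum>l<k. A $$ (i, l) * B $$ (l, i))"
    using A B by (intro sum.cong mat_mult_index_sum) auto
  also have "\<dots> = (\<Sum>l<k. \<Sum>i<k. B $$ (l, i) * A $$ (i, l))"
    by (subst sum.swap) (simp add: mult.commute)
  also have "\<dots> = (\<Sum>i<k. (B * A) $$ (i, i))"
    using A B by (intro sum.cong mat_mult_index_sum[symmetric]) auto
  finally show ?thesis
    using A B by (simp add: normalized_trace_def)
qed

lemma word_mat_Nil [simp]: "word_mat k As [] = 1\<^sub>m k"
  and word_mat_Cons [simp]: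
    "word_mat k As ((i, s) # w) = (if s then mat_adjoint (As ! i) else As ! i) * word_mat k As w"
  by (simp_all add: word_mat_def)

lemma mat_tuples_nth: "As \<in> mat_tuples n k \<Longrightarrow> i < n \<Longrightarrow> As ! i \<in> carrier_mat k k"
  by (auto simp: mat_tuples_def)

lemma word_mat_carrier:
  assumes "As \<in> mat_tuples n k" "\<forall>(i, s)\<in>set w. i < n"
  shows "word_mat k As w \<in> carrier_mat k k"
  using assms(2)
proof (induction w)
  case (Cons a w)
  then show ?case
    using mat_tuples_nth[OF assms(1), of "fst a"]
    by (cases a) (auto intro!: mult_carrier_mat[where n = k])
qed simp

lemma blinfun_compose_id [simp]: "T o\<^sub>L id_blinfun = T" "id_blinfun o\<^sub>L T = T"
  by (auto intro: blinfun_eqI)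

section \<open>Noncommutative *-polynomials\<close>

text \<open>As in words, the flag of a variable stands for its adjoint. Variables that are out of range
  evaluate to \<open>0\<close>, so that no side condition on the variables is needed.\<close>

datatype star_poly = SVar nat bool | SOne | SAdd star_poly star_poly | SScale complex star_poly
  | SMul star_poly star_poly

primrec sp_op :: "('h::complex_hilbert_space \<Rightarrow>\<^sub>L 'h) list \<Rightarrow> star_poly \<Rightarrow> ('h \<Rightarrow>\<^sub>L 'h)" where
  "sp_op xs (SVar i s) = (if i < length xs then if s then cadjoint (xs ! i) else xs ! i else 0)"
| "sp_op xs SOne = id_blinfun"
| "sp_op xs (SAdd p q) = sp_op xs p + sp_op xs q"
| "sp_op xs (SScale c p) = blinfun_scaleC c (sp_op xs p)"
| "sp_op xs (SMul p q) = sp_op xs p o\<^sub>L sp_op xs q"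

primrec sp_mat :: "nat \<Rightarrow> complex mat list \<Rightarrow> star_poly \<Rightarrow> complex mat" where
  "sp_mat k As (SVar i s) =
    (if i < length As then if s then mat_adjoint (As ! i) else As ! i else 0\<^sub>m k k)"
| "sp_mat k As SOne = 1\<^sub>m k"
| "sp_mat k As (SAdd p q) = sp_mat k As p + sp_mat k As q"
| "sp_mat k As (SScale c p) = c \<cdot>\<^sub>m sp_mat k As p"
| "sp_mat k As (SMul p q) = sp_mat k As p * sp_mat k As q"

primrec sp_adj :: "star_poly \<Rightarrow> star_poly" where
  "sp_adj (SVar i s) = SVar i (\<not> s)"
| "sp_adj SOne = SOne"
| "sp_adj (SAdd p q) = SAdd (sp_adj p) (sp_adj q)"
| "sp_adj (SScale c p) = SScale (cnj c) (sp_adj p)"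
| "sp_adj (SMul p q) = SMul (sp_adj q) (sp_adj p)"

lemma sp_mat_carrier [simp, intro]:
  assumes "As \<in> mat_tuples n k"
  shows "sp_mat k As p \<in> carrier_mat k k"
  using mat_tuples_nth[OF assms] assms by (induction p) (auto simp: mat_tuples_def)

lemma sp_mat_adj:
  assumes As: "As \<in> mat_tuples n k"
  shows "sp_mat k As (sp_adj p) = mat_adjoint (sp_mat k As p)"
proof (induction p)
  case (SVar i s)
  show ?case
    by (auto intro!: eq_matI)
qed (simp_all add: mat_adjoint_add[OF sp_mat_carrier[OF As] sp_mat_carrier[OF As]] mat_adjoint_smult
    mat_adjoint_mult[OF sp_mat_carrier[OF As] sp_mat_carrier[OF As]])

lemma sp_op_mem:
  assumes M: "star_algebra M" and xs: "set xs \<subseteq> M"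
  shows "sp_op xs p \<in> M"
proof (induction p)
  case (SVar i s)
  show ?case
    using star_algebraD(6)[OF M, of "xs ! i"] star_algebra_more(2)[OF M] xs by (auto simp: subset_iff)
qed (auto simp: star_algebraD[OF M])

lemma sp_op_adj:
  assumes "\<forall>x\<in>set xs. complex_linear x"
  shows "sp_op xs (sp_adj p) = cadjoint (sp_op xs p) \<and> complex_linear (sp_op xs p)"
  using assms by (induction p) (auto simp: cadjoint_add cadjoint_scaleC cadjoint_compose)

lemma star_algebra_range_sp_op:
  assumes "\<forall>x\<in>set xs. complex_linear x"
  shows "star_algebra (range (sp_op xs))"
  using sp_op_adj[OF assms] unfolding star_algebra_def
  by (auto intro: range_eqI[of _ _ SOne] range_eqI[of _ _ "SAdd _ _"] range_eqI[of _ _ "SScale _ _"]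
      range_eqI[of _ _ "SMul _ _"] range_eqI[of _ _ "sp_adj _"])

section \<open>Traces of star-polynomials on microstates\<close>

lemma microstates_mono:
  "m' \<le> m \<Longrightarrow> \<epsilon> \<le> \<epsilon>' \<Longrightarrow> microstates \<tau> xs R m k \<epsilon> \<subseteq> microstates \<tau> xs R m' k \<epsilon>'"
  by (force simp: microstates_def)

text \<open>Size 0 is excluded: there the normalized trace is 0/0 = 0 even for the unit, whose trace
  in \<open>M\<close> is 1. The tolerance \<open>e\<close> is uniform in \<open>k\<close>.\<close>

definition trace_close ::
  "(('h::complex_hilbert_space \<Rightarrow>\<^sub>L 'h) \<Rightarrow> complex) \<Rightarrow> ('h \<Rightarrow>\<^sub>L 'h) list \<Rightarrow> real \<Rightarrow> real \<Rightarrow> nat \<Rightarrow> real \<Rightarrow> star_poly \<Rightarrow> bool" where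
  "trace_close \<tau> xs R e m \<epsilon> p \<longleftrightarrow> (\<forall>k\<ge>1. \<forall>As\<in>microstates \<tau> xs R m k \<epsilon>.
    cmod (normalized_trace (sp_mat k As p) - \<tau> (sp_op xs p)) < e)"

lemma trace_close_mono:
  "trace_close \<tau> xs R e m \<epsilon> p \<Longrightarrow> m \<le> m' \<Longrightarrow> \<epsilon>' \<le> \<epsilon> \<Longrightarrow> trace_close \<tau> xs R e m' \<epsilon>' p"
  unfolding trace_close_def using microstates_mono by blast

definition trace_converges ::
  "(('h::complex_hilbert_space \<Rightarrow>\<^sub>L 'h) \<Rightarrow> complex) \<Rightarrow> ('h \<Rightarrow>\<^sub>L 'h) list \<Rightarrow> real \<Rightarrow> star_poly \<Rightarrow> bool" where
  "trace_converges \<tau> xs R p \<longleftrightarrow> (\<forall>e>0. \<exists>m. \<exists>\<epsilon>>0. trace_close \<tau> xs R e m \<epsilon> p)"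

lemma trace_converges_cong:
  assumes "trace_converges \<tau> xs R p" "sp_op xs q = sp_op xs p"
    and "\<And>k As. As \<in> mat_tuples (length xs) k \<Longrightarrow> sp_mat k As q = sp_mat k As p"
  shows "trace_converges \<tau> xs R q"
proof -
  have "trace_close \<tau> xs R e m \<epsilon> q \<longleftrightarrow> trace_close \<tau> xs R e m \<epsilon> p" for e m \<epsilon>
    using assms(2,3) by (auto simp: trace_close_def microstates_def)
  then show ?thesis
    using assms(1) by (simp add: trace_converges_def)
qed

lemma trace_converges_add:
  assumes \<tau>: "tracial_state M \<tau>" and M: "star_algebra M" and xs: "set xs \<subseteq> M"
    and pq: "trace_converges \<tau> xs R p" "trace_converges \<tau> xs R q"
  shows "trace_converges \<tau> xs R (SAdd p q)"
  unfolding trace_converges_def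
proof (intro allI impI)
  fix e :: real assume "e > 0"
  then have e: "e / 2 > 0"
    by simp
  obtain m \<epsilon> where p: "\<epsilon> > 0" "trace_close \<tau> xs R (e / 2) m \<epsilon> p"
    using pq(1) e unfolding trace_converges_def by blast
  obtain m' \<epsilon>' where q: "\<epsilon>' > 0" "trace_close \<tau> xs R (e / 2) m' \<epsilon>' q"
    using pq(2) e unfolding trace_converges_def by blast
  have "trace_close \<tau> xs R e (max m m') (min \<epsilon> \<epsilon>') (SAdd p q)"
    unfolding trace_close_def
  proof (intro allI impI ballI)
    fix k As assume k: "1 \<le> k" and As: "As \<in> microstates \<tau> xs R (max m m') k (min \<epsilon> \<epsilon>')"
    have tup: "As \<in> mat_tuples (length xs) k"
      using As by (simp add: microstates_def)
    have "cmod (normalized_trace (sp_mat k As p) - \<tau> (sp_op xs p)) < e / 2"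
      "cmod (normalized_trace (sp_mat k As q) - \<tau> (sp_op xs q)) < e / 2"
      using trace_close_mono[OF p(2), of "max m m'" "min \<epsilon> \<epsilon>'"] trace_close_mono[OF q(2), of "max m m'" "min \<epsilon> \<epsilon>'"] k As
      by (simp_all add: trace_close_def)
    moreover have "normalized_trace (sp_mat k As (SAdd p q)) - \<tau> (sp_op xs (SAdd p q)) =
        (normalized_trace (sp_mat k As p) - \<tau> (sp_op xs p)) + (normalized_trace (sp_mat k As q) - \<tau> (sp_op xs q))"
      by (simp add: normalized_trace_add[OF sp_mat_carrier[OF tup] sp_mat_carrier[OF tup]]
          tracial_state_add[OF \<tau> sp_op_mem[OF M xs] sp_op_mem[OF M xs]])
    ultimately show "cmod (normalized_trace (sp_mat k As (SAdd p q)) - \<tau> (sp_op xs (SAdd p q))) < e"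
      using norm_triangle_ineq[of "normalized_trace (sp_mat k As p) - \<tau> (sp_op xs p)"
          "normalized_trace (sp_mat k As q) - \<tau> (sp_op xs q)"] by (simp only:)
  qed
  then show "\<exists>m. \<exists>\<epsilon>>0. trace_close \<tau> xs R e m \<epsilon> (SAdd p q)"
    using p(1) q(1) by (intro exI[of _ "max m m'"] exI[of _ "min \<epsilon> \<epsilon>'"]) simp
qed

lemma trace_converges_scale:
  assumes \<tau>: "tracial_state M \<tau>" and M: "star_algebra M" and xs: "set xs \<subseteq> M"
    and p: "trace_converges \<tau> xs R p"
  shows "trace_converges \<tau> xs R (SScale c p)"
  unfolding trace_converges_def
proof (intro allI impI)
  fix e :: real assume e: "e > 0"
  \<comment> \<open>The summand 1 avoids division by zero for \<open>c = 0\<close>.\<close>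
  have c: "1 + cmod c > 0"
    by (simp add: add_pos_nonneg)
  then obtain m \<epsilon> where p: "\<epsilon> > 0" "trace_close \<tau> xs R (e / (1 + cmod c)) m \<epsilon> p"
    using p e unfolding trace_converges_def by (meson divide_pos_pos)
  have "trace_close \<tau> xs R e m \<epsilon> (SScale c p)"
    unfolding trace_close_def
  proof (intro allI impI ballI)
    fix k As assume k: "1 \<le> k" and As: "As \<in> microstates \<tau> xs R m k \<epsilon>"
    have tup: "As \<in> mat_tuples (length xs) k"
      using As by (simp add: microstates_def)
    have "cmod (normalized_trace (sp_mat k As (SScale c p)) - \<tau> (sp_op xs (SScale c p))) =
        cmod c * cmod (normalized_trace (sp_mat k As p) - \<tau> (sp_op xs p))"
      by (simp add: normalized_trace_smult[OF sp_mat_carrier[OF tup]]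
          tracial_state_scale[OF \<tau> sp_op_mem[OF M xs]] norm_mult flip: right_diff_distrib)
    also have "\<dots> \<le> cmod c * (e / (1 + cmod c))"
      using p(2) k As by (intro mult_left_mono) (auto simp: trace_close_def less_imp_le)
    also have "\<dots> < e"
      using e c by (simp add: field_simps)
    finally show "cmod (normalized_trace (sp_mat k As (SScale c p)) - \<tau> (sp_op xs (SScale c p))) < e" .
  qed
  then show "\<exists>m. \<exists>\<epsilon>>0. trace_close \<tau> xs R e m \<epsilon> (SScale c p)"
    using p(1) by blast
qed

definition sp_prefix :: "(nat \<times> bool) list \<Rightarrow> star_poly \<Rightarrow> star_poly" where
  "sp_prefix w p = foldr (\<lambda>(i, s). SMul (SVar i s)) w p"

lemma sp_op_prefix:
  "\<forall>(i, s)\<in>set w. i < length xs \<Longrightarrow> sp_op xs (sp_prefix w p) = word_op xs w o\<^sub>L sp_op xs p"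
  by (induction w) (auto simp: sp_prefix_def intro!: blinfun_eqI)

lemma sp_mat_prefix:
  assumes As: "As \<in> mat_tuples n k" and "\<forall>(i, s)\<in>set w. i < n"
  shows "sp_mat k As (sp_prefix w p) = word_mat k As w * sp_mat k As p"
  using assms(2)
proof (induction w)
  case Nil
  show ?case
    using sp_mat_carrier[OF As, of p] by (simp add: sp_prefix_def)
next
  case (Cons a w)
  obtain i s where a: "a = (i, s)"
    by force
  have "length As = n"
    using As by (simp add: mat_tuples_def)
  moreover have "As ! i \<in> carrier_mat k k" "mat_adjoint (As ! i) \<in> carrier_mat k k"
    using Cons.prems mat_tuples_nth[OF As, of i] by (auto simp: a)
  ultimately show ?case
    using Cons sp_mat_carrier[OF As, of p] word_mat_carrier[OF As, of w]
    by (simp add: a sp_prefix_def assoc_mult_mat[of _ k k _ k _ k])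
qed

text \<open>Induction on \<open>p\<close> for words prefixed and *-polynomials appended to \<open>p\<close> replaces an expansion
  of \<open>p\<close> into words.\<close>

lemma trace_converges_prefix:
  assumes \<tau>: "tracial_state M \<tau>" and M: "star_algebra M" and xs: "set xs \<subseteq> M"
    and "\<And>w. \<forall>(i, s)\<in>set w. i < length xs \<Longrightarrow> trace_converges \<tau> xs R (sp_prefix w r)"
    and "\<forall>(i, s)\<in>set w. i < length xs"
  shows "trace_converges \<tau> xs R (sp_prefix w (SMul p r))"
  using assms(4,5)
proof (induction p arbitrary: r w)
  case (SVar i s)
  show ?case
  proof (cases "i < length xs")
    case True
    \<comment> \<open>A variable is a letter, so it moves from the polynomial to the end of the
      word.\<close>
    then have "trace_converges \<tau> xs R (sp_prefix (w @ [(i, s)]) r)"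
      using SVar by auto
    then show ?thesis
      by (simp add: sp_prefix_def)
  next
    case False
    \<comment> \<open>An out-of-range variable evaluates to 0, which is presented as 0 times a
      polynomial already treated.\<close>
    have "trace_converges \<tau> xs R (SScale 0 (sp_prefix w r))"
      by (rule trace_converges_scale[OF \<tau> M xs SVar(1)[OF SVar(2)]])
    then show ?thesis
    proof (rule trace_converges_cong)
      show "sp_op xs (sp_prefix w (SMul (SVar i s) r)) = sp_op xs (SScale 0 (sp_prefix w r))"
        using False by (intro blinfun_eqI) (simp add: sp_op_prefix[OF SVar(2)] blinfun.zero_left
            blinfun.zero_right scaleC_of_real[of 0, simplified])
      fix k As assume As: "As \<in> mat_tuples (length xs) k"
      have "length As = length xs"
        using As by (simp add: mat_tuples_def)
      moreover have "0 \<cdot>\<^sub>m A = 0\<^sub>m k k" if "A \<in> carrier_mat k k" for A :: "complex mat"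
        using that by (intro eq_matI) auto
      ultimately show "sp_mat k As (sp_prefix w (SMul (SVar i s) r)) = sp_mat k As (SScale 0 (sp_prefix w r))"
        using False sp_mat_carrier[OF As, of r] word_mat_carrier[OF As SVar(2)]
        by (simp add: sp_mat_prefix[OF As SVar(2)] left_mult_zero_mat[of _ k k] right_mult_zero_mat[of _ k k]
            mult_carrier_mat[of _ k k _ k])
    qed
  qed
next
  case SOne
  from SOne(1)[OF SOne(2)] show ?case
    by (rule trace_converges_cong)
      (simp_all add: sp_op_prefix[OF SOne(2)] sp_mat_prefix[OF _ SOne(2)] left_mult_one_mat[OF sp_mat_carrier])
next
  case (SAdd p q)
  have "trace_converges \<tau> xs R (SAdd (sp_prefix w (SMul p r)) (sp_prefix w (SMul q r)))"
    by (intro trace_converges_add[OF \<tau> M xs] SAdd.IH SAdd.prems)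
  then show ?case
  proof (rule trace_converges_cong)
    show "sp_op xs (sp_prefix w (SMul (SAdd p q) r)) = sp_op xs (SAdd (sp_prefix w (SMul p r)) (sp_prefix w (SMul q r)))"
      by (intro blinfun_eqI) (simp add: sp_op_prefix[OF SAdd.prems(2)] blinfun.add_left blinfun.add_right)
    fix k As assume As: "As \<in> mat_tuples (length xs) k"
    then show "sp_mat k As (sp_prefix w (SMul (SAdd p q) r)) = sp_mat k As (SAdd (sp_prefix w (SMul p r)) (sp_prefix w (SMul q r)))"
      using sp_mat_carrier[OF As] word_mat_carrier[OF As SAdd.prems(2)]
      by (simp add: sp_mat_prefix[OF As SAdd.prems(2)] add_mult_distrib_mat[of _ k k _ _ k]
          mult_add_distrib_mat[of _ k k _ k] mult_carrier_mat[of _ k k _ k])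
  qed
next
  case (SScale c p)
  have "trace_converges \<tau> xs R (SScale c (sp_prefix w (SMul p r)))"
    by (intro trace_converges_scale[OF \<tau> M xs] SScale.IH SScale.prems)
  then show ?case
  proof (rule trace_converges_cong)
    show "sp_op xs (sp_prefix w (SMul (SScale c p) r)) = sp_op xs (SScale c (sp_prefix w (SMul p r)))"
      using star_algebraD(1)[OF M word_op_mem[OF M xs SScale.prems(2)]]
      by (intro blinfun_eqI) (simp add: sp_op_prefix[OF SScale.prems(2)] complex_linearD)
    fix k As assume As: "As \<in> mat_tuples (length xs) k"
    then show "sp_mat k As (sp_prefix w (SMul (SScale c p) r)) = sp_mat k As (SScale c (sp_prefix w (SMul p r)))"
      using sp_mat_carrier[OF As] word_mat_carrier[OF As SScale.prems(2)]
      by (simp add: sp_mat_prefix[OF As SScale.prems(2)] mult_smult_assoc_mat[of _ k k _ k]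
          mult_smult_distrib[of _ k k _ k] mult_carrier_mat[of _ k k _ k])
  qed
next
  case (SMul p q)
  \<comment> \<open>Reassociation: the hypothesis for \<open>q\<close> makes \<open>SMul q r\<close>
    an admissible tail, to which the hypothesis for \<open>p\<close> applies.\<close>
  have "trace_converges \<tau> xs R (sp_prefix w (SMul p (SMul q r)))"
    using SMul by blast
  then show ?case
  proof (rule trace_converges_cong)
    show "sp_op xs (sp_prefix w (SMul (SMul p q) r)) = sp_op xs (sp_prefix w (SMul p (SMul q r)))"
      by (intro blinfun_eqI) (simp add: sp_op_prefix[OF SMul.prems(2)])
    fix k As assume As: "As \<in> mat_tuples (length xs) k"
    then show "sp_mat k As (sp_prefix w (SMul (SMul p q) r)) = sp_mat k As (sp_prefix w (SMul p (SMul q r)))"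
      using sp_mat_carrier[OF As]
      by (simp add: sp_mat_prefix[OF As SMul.prems(2)] assoc_mult_mat[of _ k k _ k _ k])
  qed
qed

lemma trace_converges_star_poly:
  assumes \<tau>: "tracial_state M \<tau>" and M: "star_algebra M" and xs: "set xs \<subseteq> M"
  shows "trace_converges \<tau> xs R p"
proof -
  have word: "trace_converges \<tau> xs R (sp_prefix w SOne)" if w: "\<forall>(i, s)\<in>set w. i < length xs" for w
    unfolding trace_converges_def
  proof (intro allI impI)
    fix e :: real assume e: "e > 0"
    have "cmod (normalized_trace (sp_mat k As (sp_prefix w SOne)) - \<tau> (sp_op xs (sp_prefix w SOne))) < e"
      if k: "1 \<le> k" and As: "As \<in> microstates \<tau> xs R (length w) k e" for k As
    proof -
      have tup: "As \<in> mat_tuples (length xs) k"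
        using As by (simp add: microstates_def)
      have "cmod (normalized_trace (word_mat k As w) - \<tau> (word_op xs w)) < e"
        \<comment> \<open>Microstates control only words of length at least 1; for the empty word
          both sides are the trace of the unit.\<close>
        using As k w e tracial_state_id[OF \<tau>] by (cases "w = []") (auto simp: microstates_def Suc_le_eq)
      then show ?thesis
        using word_mat_carrier[OF tup w] by (simp add: sp_op_prefix[OF w] sp_mat_prefix[OF tup w])
    qed
    then show "\<exists>m. \<exists>\<epsilon>>0. trace_close \<tau> xs R e m \<epsilon> (sp_prefix w SOne)"
      using e unfolding trace_close_def by blast
  qed
  have "trace_converges \<tau> xs R (sp_prefix [] (SMul p SOne))"
    by (rule trace_converges_prefix[OF \<tau> M xs word]) simp_all
  then show ?thesis
    by (rule trace_converges_cong) (simp_all add: sp_prefix_def right_mult_one_mat[OF sp_mat_carrier])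
qed

section \<open>Norms of matrices\<close>

lemma vec_l2norm_eq_L2_set:
  assumes "v \<in> carrier_vec k"
  shows "vec_l2norm v = L2_set (\<lambda>i. cmod (v $ i)) {..<k}"
proof -
  have "v \<bullet>c v = (\<Sum>i<k. complex_of_real ((cmod (v $ i))\<^sup>2))"
    using assms by (auto simp: scalar_prod_def atLeast0LessThan complex_norm_square simp del: of_real_power)
  also have "\<dots> = complex_of_real (\<Sum>i<k. (cmod (v $ i))\<^sup>2)"
    by simp
  finally show ?thesis
    by (simp only: vec_l2norm_def L2_set_def Re_complex_of_real)
qed

lemma vec_l2norm_nonneg [simp]: "vec_l2norm v \<ge> 0"
  using vec_l2norm_eq_L2_set[of v "dim_vec v"] by (simp add: carrier_vec_dim_vec L2_set_nonneg)

lemma vec_l2norm_power2: "v \<in> carrier_vec k \<Longrightarrow> (vec_l2norm v)\<^sup>2 = (\<Sum>i<k. (cmod (v $ i))\<^sup>2)"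
  by (simp add: vec_l2norm_eq_L2_set L2_set_def sum_nonneg)

lemma vec_l2norm_eq_0:
  assumes "v \<in> carrier_vec k" "vec_l2norm v = 0"
  shows "v = 0\<^sub>v k"
proof -
  have "(\<Sum>i<k. (cmod (v $ i))\<^sup>2) = 0"
    using assms vec_l2norm_power2[OF assms(1)] by simp
  then have "\<forall>i<k. v $ i = 0"
    by (subst (asm) sum_nonneg_eq_0_iff) auto
  then show ?thesis
    using assms(1) by (intro eq_vecI) auto
qed

lemma vec_l2norm_zero [simp]: "vec_l2norm (0\<^sub>v k) = 0"
  by (simp add: vec_l2norm_eq_L2_set[of _ k] L2_set_def)

lemma vec_l2norm_smult: "vec_l2norm (c \<cdot>\<^sub>v v) = cmod c * vec_l2norm v"
proof -
  have "v \<in> carrier_vec (dim_vec v)" "c \<cdot>\<^sub>v v \<in> carrier_vec (dim_vec v)"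
    by (auto simp: carrier_vec_dim_vec)
  then show ?thesis
    by (auto simp: vec_l2norm_eq_L2_set[of _ "dim_vec v"] norm_mult L2_set_right_distrib intro!: L2_set_cong)
qed

lemma vec_l2norm_add:
  assumes "u \<in> carrier_vec k" "v \<in> carrier_vec k"
  shows "vec_l2norm (u + v) \<le> vec_l2norm u + vec_l2norm v"
proof -
  have "vec_l2norm (u + v) \<le> L2_set (\<lambda>i. cmod (u $ i) + cmod (v $ i)) {..<k}"
    using assms by (subst vec_l2norm_eq_L2_set[of _ k])
      (auto intro!: L2_set_mono norm_triangle_ineq)
  also have "\<dots> \<le> vec_l2norm u + vec_l2norm v"
    using assms by (simp add: vec_l2norm_eq_L2_set[of _ k] L2_set_triangle_ineq)
  finally show ?thesis .
qed

lemma vec_l2norm_diff: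
  assumes "u \<in> carrier_vec k" "v \<in> carrier_vec k"
  shows "vec_l2norm (u - v) \<le> vec_l2norm u + vec_l2norm v"
proof -
  have "u - v = u + (-1) \<cdot>\<^sub>v v"
    using assms by (intro eq_vecI) auto
  then show ?thesis
    using vec_l2norm_add[of u k "(-1) \<cdot>\<^sub>v v"] assms vec_l2norm_smult[of "-1" v] by simp
qed

lemma cscalar_prod_sum:
  fixes u v :: "complex vec"
  shows "u \<in> carrier_vec k \<Longrightarrow> v \<in> carrier_vec k \<Longrightarrow> u \<bullet>c v = (\<Sum>i<k. u $ i * cnj (v $ i))"
  by (auto simp: scalar_prod_def atLeast0LessThan)

lemma cmod_cscalar_prod_le:
  assumes "u \<in> carrier_vec k" "v \<in> carrier_vec k"
  shows "cmod (u \<bullet>c v) \<le> vec_l2norm u * vec_l2norm v"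
proof -
  have "cmod (u \<bullet>c v) \<le> (\<Sum>i<k. \<bar>cmod (u $ i)\<bar> * \<bar>cmod (v $ i)\<bar>)"
    unfolding cscalar_prod_sum[OF assms] by (rule order_trans[OF norm_sum]) (simp add: norm_mult)
  also have "\<dots> \<le> vec_l2norm u * vec_l2norm v"
    unfolding vec_l2norm_eq_L2_set[OF assms(1)] vec_l2norm_eq_L2_set[OF assms(2)]
    by (rule L2_set_mult_ineq)
  finally show ?thesis .
qed

lemma vec_l2norm_power2_eq: "v \<in> carrier_vec k \<Longrightarrow> complex_of_real ((vec_l2norm v)\<^sup>2) = v \<bullet>c v"
  by (simp add: vec_l2norm_power2 cscalar_prod_sum[of v k v] complex_norm_square del: of_real_power)

lemma mult_mat_vec_index_sum:
  "A \<in> carrier_mat n k \<Longrightarrow> v \<in> carrier_vec k \<Longrightarrow> i < n \<Longrightarrow> (A *\<^sub>v v) $ i = (\<Sum>j<k. A $$ (i, j) * v $ j)"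
  by (auto simp: scalar_prod_def atLeast0LessThan)

lemma cscalar_prod_adjoint:
  fixes A :: "complex mat"
  assumes A: "A \<in> carrier_mat k k" and u: "u \<in> carrier_vec k" and v: "v \<in> carrier_vec k"
  shows "(A *\<^sub>v u) \<bullet>c v = u \<bullet>c (mat_adjoint A *\<^sub>v v)"
proof -
  have A': "mat_adjoint A \<in> carrier_mat k k"
    using A by blast
  have "(A *\<^sub>v u) \<bullet>c v = (\<Sum>i<k. (\<Sum>j<k. A $$ (i, j) * u $ j) * cnj (v $ i))"
    using A u v mult_mat_vec_index_sum[OF A u]
    by (subst cscalar_prod_sum[of _ k]) (auto intro!: sum.cong)
  also have "\<dots> = (\<Sum>j<k. \<Sum>i<k. A $$ (i, j) * u $ j * cnj (v $ i))"
    unfolding sum_distrib_right by (rule sum.swap)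
  also have "\<dots> = (\<Sum>j<k. u $ j * cnj (\<Sum>i<k. mat_adjoint A $$ (j, i) * v $ i))"
    using A by (auto simp: sum_distrib_left intro!: sum.cong)
  also have "\<dots> = u \<bullet>c (mat_adjoint A *\<^sub>v v)"
    using A' u v mult_mat_vec_index_sum[OF A' v]
    by (subst cscalar_prod_sum[of _ k]) (auto intro!: sum.cong)
  finally show ?thesis .
qed

lemma mult_mat_zero_vec: "A \<in> carrier_mat n k \<Longrightarrow> A *\<^sub>v 0\<^sub>v k = 0\<^sub>v n"
  by (intro eq_vecI) (auto simp: scalar_prod_def)

text \<open>A homogeneous form of the operator-norm bound. Sums, products and adjoints are estimated
  with it directly, without returning to the supremum.\<close>

definition mat_bounded :: "nat \<Rightarrow> complex mat \<Rightarrow> real \<Rightarrow> bool" where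
  "mat_bounded k A C \<longleftrightarrow> A \<in> carrier_mat k k \<and> (\<forall>v\<in>carrier_vec k. vec_l2norm (A *\<^sub>v v) \<le> C * vec_l2norm v)"

lemma mat_boundedD: "mat_bounded k A C \<Longrightarrow> v \<in> carrier_vec k \<Longrightarrow> vec_l2norm (A *\<^sub>v v) \<le> C * vec_l2norm v"
  by (simp add: mat_bounded_def)

text \<open>The supremum dominates its members only once the set is known to be bounded above; the
  sum of the moduli of all entries serves for that. Rescaling then passes from the unit ball to all
  vectors.\<close>

lemma mat_bounded_of_opnorm:
  assumes A: "A \<in> carrier_mat k k" and le: "mat_opnorm A \<le> C"
  shows "mat_bounded k A C"
proof -
  let ?B = "{v \<in> carrier_vec (dim_col A). vec_l2norm v \<le> 1}"
  have "vec_l2norm (A *\<^sub>v v) \<le> (\<Sum>i<k. \<Sum>j<k. cmod (A $$ (i, j)))" if v: "v \<in> ?B" for v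
  proof -
    have v': "v \<in> carrier_vec k" "vec_l2norm v \<le> 1"
      using v A by auto
    have entry: "cmod (v $ j) \<le> 1" if "j < k" for j
    proof -
      have "cmod (v $ j) \<le> L2_set (\<lambda>i. cmod (v $ i)) {..<k}"
        using that by (intro member_le_L2_set) auto
      then show ?thesis
        using v' by (simp add: vec_l2norm_eq_L2_set)
    qed
    have Av: "A *\<^sub>v v \<in> carrier_vec k"
      using A v' by auto
    have "vec_l2norm (A *\<^sub>v v) \<le> (\<Sum>i<k. cmod ((A *\<^sub>v v) $ i))"
      unfolding vec_l2norm_eq_L2_set[OF Av] by (rule L2_set_le_sum) simp
    also have "\<dots> \<le> (\<Sum>i<k. \<Sum>j<k. cmod (A $$ (i, j)))"
    proof (rule sum_mono)
      fix i assume "i \<in> {..<k}"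
      then have "cmod ((A *\<^sub>v v) $ i) \<le> (\<Sum>j<k. cmod (A $$ (i, j) * v $ j))"
        using mult_mat_vec_index_sum[OF A v'(1), of i] norm_sum by simp
      also have "\<dots> \<le> (\<Sum>j<k. cmod (A $$ (i, j)))"
        using entry by (intro sum_mono) (simp add: norm_mult mult_left_le)
      finally show "cmod ((A *\<^sub>v v) $ i) \<le> (\<Sum>j<k. cmod (A $$ (i, j)))" .
    qed
    finally show ?thesis .
  qed
  then have bdd: "bdd_above ((\<lambda>v. vec_l2norm (A *\<^sub>v v)) ` ?B)"
    by (rule bdd_aboveI2)
  have unit: "vec_l2norm (A *\<^sub>v v) \<le> C" if "v \<in> ?B" for v
    using cSUP_upper[OF that bdd] le by (simp add: mat_opnorm_def)
  have "vec_l2norm (A *\<^sub>v v) \<le> C * vec_l2norm v" if v: "v \<in> carrier_vec k" for v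
  proof (cases "vec_l2norm v = 0")
    case True
    then have "v = 0\<^sub>v k"
      by (rule vec_l2norm_eq_0[OF v])
    then show ?thesis
      by (simp add: mult_mat_zero_vec[OF A])
  next
    case False
    define r where "r = vec_l2norm v"
    have "r > 0"
      using False vec_l2norm_nonneg[of v] by (simp add: r_def less_le)
    have "complex_of_real (1 / r) \<cdot>\<^sub>v v \<in> ?B"
      using v A \<open>r > 0\<close> by (simp add: vec_l2norm_smult r_def norm_divide)
    from unit[OF this] have "(1 / r) * vec_l2norm (A *\<^sub>v v) \<le> C"
      using \<open>r > 0\<close> mult_mat_vec[OF A v] by (simp add: vec_l2norm_smult norm_divide)
    then show ?thesis
      using \<open>r > 0\<close> by (simp add: r_def[symmetric] field_simps)
  qed
  with A show ?thesis
    by (simp add: mat_bounded_def)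
qed

lemma opnorm_of_mat_bounded:
  assumes A: "mat_bounded k A C" and "C \<ge> 0"
  shows "mat_opnorm A \<le> C"
  unfolding mat_opnorm_def
proof (rule cSUP_least)
  have c: "dim_col A = k"
    using A by (auto simp: mat_bounded_def)
  show "{v \<in> carrier_vec (dim_col A). vec_l2norm v \<le> 1} \<noteq> {}"
    using vec_l2norm_zero[of "dim_col A"] by (metis (mono_tags, lifting) empty_iff mem_Collect_eq zero_carrier_vec zero_le_one)
  show "vec_l2norm (A *\<^sub>v v) \<le> C" if "v \<in> {v \<in> carrier_vec (dim_col A). vec_l2norm v \<le> 1}" for v
    using that mat_boundedD[OF A, of v] c \<open>C \<ge> 0\<close> mult_left_mono[of "vec_l2norm v" 1 C] by auto
qed

lemma mat_bounded_mono: "mat_bounded k A C \<Longrightarrow> C \<le> D \<Longrightarrow> mat_bounded k A D"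
  unfolding mat_bounded_def by (meson mult_right_mono order_trans vec_l2norm_nonneg)

lemma mat_bounded_zero: "mat_bounded k (0\<^sub>m k k) 0"
proof -
  have "0\<^sub>m k k *\<^sub>v v = 0\<^sub>v k" if "v \<in> carrier_vec k" for v :: "complex vec"
    using that by (intro eq_vecI) (auto simp: scalar_prod_def)
  then show ?thesis
    by (simp add: mat_bounded_def)
qed

lemma mat_bounded_one: "mat_bounded k (1\<^sub>m k) 1"
  by (auto simp: mat_bounded_def)

lemma mat_bounded_add:
  assumes "mat_bounded k A C" "mat_bounded k B D"
  shows "mat_bounded k (A + B) (C + D)"
  unfolding mat_bounded_def
proof (intro conjI ballI)
  have c: "A \<in> carrier_mat k k" "B \<in> carrier_mat k k"
    using assms by (auto simp: mat_bounded_def)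
  then show "A + B \<in> carrier_mat k k"
    by simp
  fix v :: "complex vec" assume v: "v \<in> carrier_vec k"
  have "vec_l2norm ((A + B) *\<^sub>v v) \<le> vec_l2norm (A *\<^sub>v v) + vec_l2norm (B *\<^sub>v v)"
    using c v vec_l2norm_add[of "A *\<^sub>v v" k "B *\<^sub>v v"] by (simp add: add_mult_distrib_mat_vec[of _ k k])
  then show "vec_l2norm ((A + B) *\<^sub>v v) \<le> (C + D) * vec_l2norm v"
    using mat_boundedD[OF assms(1) v] mat_boundedD[OF assms(2) v] by (simp add: distrib_right)
qed

lemma smult_mat_mult_vec:
  fixes A :: "complex mat"
  assumes "A \<in> carrier_mat n k" "v \<in> carrier_vec k"
  shows "(c \<cdot>\<^sub>m A) *\<^sub>v v = c \<cdot>\<^sub>v (A *\<^sub>v v)"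
  using assms by (intro eq_vecI) (auto simp: scalar_prod_def sum_distrib_left mult.assoc)

lemma mat_bounded_smult:
  assumes "mat_bounded k A C"
  shows "mat_bounded k (c \<cdot>\<^sub>m A) (cmod c * C)"
  using assms unfolding mat_bounded_def
  by (auto simp: smult_mat_mult_vec[of _ k k] vec_l2norm_smult mult.assoc intro!: mult_left_mono)

lemma mat_bounded_mult:
  assumes "mat_bounded k A C" "mat_bounded k B D" "C \<ge> 0"
  shows "mat_bounded k (A * B) (C * D)"
  unfolding mat_bounded_def
proof (intro conjI ballI)
  have c: "A \<in> carrier_mat k k" "B \<in> carrier_mat k k"
    using assms by (auto simp: mat_bounded_def)
  then show "A * B \<in> carrier_mat k k"
    by simp
  fix v :: "complex vec" assume v: "v \<in> carrier_vec k"
  have "vec_l2norm ((A * B) *\<^sub>v v) = vec_l2norm (A *\<^sub>v (B *\<^sub>v v))"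
    using c v by (simp add: assoc_mult_mat_vec[of _ k k _ k])
  also have "\<dots> \<le> C * vec_l2norm (B *\<^sub>v v)"
    using c v by (intro mat_boundedD[OF assms(1)]) auto
  also have "\<dots> \<le> C * (D * vec_l2norm v)"
    by (intro mult_left_mono mat_boundedD[OF assms(2) v] assms(3))
  finally show "vec_l2norm ((A * B) *\<^sub>v v) \<le> C * D * vec_l2norm v"
    by (simp add: mult.assoc)
qed

text \<open>With \<open>w\<close> the image of \<open>v\<close> under the adjoint,
  \<open>|w|^2 = <A w, v> \<le> C |w| |v|\<close>, and one factor \<open>|w|\<close>
  cancels.\<close>

lemma mat_bounded_adjoint:
  assumes A: "mat_bounded k A C"
  shows "mat_bounded k (mat_adjoint A) C"
  unfolding mat_bounded_def
proof (intro conjI ballI)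
  have c: "A \<in> carrier_mat k k"
    using A by (auto simp: mat_bounded_def)
  then show "mat_adjoint A \<in> carrier_mat k k"
    by blast
  fix v :: "complex vec" assume v: "v \<in> carrier_vec k"
  let ?w = "mat_adjoint A *\<^sub>v v"
  have w: "?w \<in> carrier_vec k"
    by (rule mult_mat_vec_carrier[OF mat_adjoint_carrier[OF c] v])
  have "complex_of_real ((vec_l2norm ?w)\<^sup>2) = (A *\<^sub>v ?w) \<bullet>c v"
    unfolding vec_l2norm_power2_eq[OF w] by (rule cscalar_prod_adjoint[OF c w v, symmetric])
  then have "(vec_l2norm ?w)\<^sup>2 = cmod ((A *\<^sub>v ?w) \<bullet>c v)"
    by (metis abs_of_nonneg norm_of_real zero_le_power2)
  also have "\<dots> \<le> vec_l2norm (A *\<^sub>v ?w) * vec_l2norm v"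
    using c w v by (intro cmod_cscalar_prod_le[of _ k]) auto
  also have "\<dots> \<le> C * vec_l2norm ?w * vec_l2norm v"
    by (intro mult_right_mono mat_boundedD[OF A w]) simp
  finally have "vec_l2norm ?w * vec_l2norm ?w \<le> vec_l2norm ?w * (C * vec_l2norm v)"
    by (simp add: power2_eq_square mult_ac)
  \<comment> \<open>Covers the case in which the adjoint annihilates \<open>v\<close>; the sign is
    read off from the bound for \<open>A\<close>.\<close>
  moreover have "0 \<le> C * vec_l2norm v"
    using mat_boundedD[OF A v] vec_l2norm_nonneg order_trans by blast
  ultimately show "vec_l2norm ?w \<le> C * vec_l2norm v"
    using vec_l2norm_nonneg[of ?w] by (cases "vec_l2norm ?w = 0") (auto simp: mult_le_cancel_left)
qed

lemma mat_bounded_entry: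
  assumes A: "mat_bounded k A C" and ij: "i < k" "j < k"
  shows "cmod (A $$ (i, j)) \<le> C"
proof -
  have c: "A \<in> carrier_mat k k"
    using A by (auto simp: mat_bounded_def)
  have u: "unit_vec k j \<in> carrier_vec k"
    by simp
  have "(\<Sum>i<k. (cmod (unit_vec k j $ i))\<^sup>2) = (\<Sum>i<k. if i = j then 1 else 0)"
    using ij by (intro sum.cong) auto
  then have "vec_l2norm (unit_vec k j) = 1"
    using ij by (simp add: vec_l2norm_eq_L2_set[OF u] L2_set_def)
  moreover have Au: "A *\<^sub>v unit_vec k j = col A j"
    using c ij by (intro eq_vecI) (auto simp: scalar_prod_right_unit)
  moreover have "col A j \<in> carrier_vec k"
    using c by auto
  then have "cmod (col A j $ i) \<le> vec_l2norm (col A j)"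
    using ij by (simp only: vec_l2norm_eq_L2_set) (intro member_le_L2_set, auto)
  ultimately show ?thesis
    using mat_boundedD[OF A u] c ij by simp
qed

text \<open>The bound is uniform over tuple length and matrix size, so that one constant serves all
  microstate spaces at once.\<close>

definition sp_bounded :: "real \<Rightarrow> star_poly \<Rightarrow> real \<Rightarrow> bool" where
  "sp_bounded R p C \<longleftrightarrow> (\<forall>n k As. As \<in> mat_tuples n k \<longrightarrow> (\<forall>A\<in>set As. mat_opnorm A \<le> R) \<longrightarrow>
    mat_bounded k (sp_mat k As p) C)"

lemma sp_bounded_exists: "\<exists>C\<ge>0. sp_bounded R p C"
proof (induction p)
  case (SVar i s)
  have "mat_bounded k (sp_mat k As (SVar i s)) \<bar>R\<bar>"
    if As: "As \<in> mat_tuples n k" and R: "\<forall>A\<in>set As. mat_opnorm A \<le> R" for n k As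
  proof (cases "i < length As")
    case True
    then have "As ! i \<in> carrier_mat k k"
      using As by (intro mat_tuples_nth[OF As]) (simp add: mat_tuples_def)
    then have "mat_bounded k (As ! i) \<bar>R\<bar>"
      using True R mat_bounded_of_opnorm[of "As ! i" k R] mat_bounded_mono abs_ge_self by auto
    then show ?thesis
      using True mat_bounded_adjoint by simp
  next
    case False
    then show ?thesis
      using mat_bounded_mono[OF mat_bounded_zero, of "\<bar>R\<bar>" k] by simp
  qed
  then show ?case
    unfolding sp_bounded_def by (intro exI[of _ "\<bar>R\<bar>"] conjI allI impI abs_ge_zero)
next
  case SOne
  then show ?case
    by (intro exI[of _ 1]) (auto simp: sp_bounded_def mat_bounded_one)
next
  case (SAdd p q)
  then obtain C D where "C \<ge> 0" "sp_bounded R p C" "D \<ge> 0" "sp_bounded R q D"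
    by blast
  then show ?case
    by (intro exI[of _ "C + D"]) (simp add: sp_bounded_def mat_bounded_add)
next
  case (SScale c p)
  then obtain C where "C \<ge> 0" "sp_bounded R p C"
    by blast
  then show ?case
    by (intro exI[of _ "cmod c * C"]) (simp add: sp_bounded_def mat_bounded_smult)
next
  case (SMul p q)
  then obtain C D where "C \<ge> 0" "sp_bounded R p C" "D \<ge> 0" "sp_bounded R q D"
    by blast
  then show ?case
    by (intro exI[of _ "C * D"]) (simp add: sp_bounded_def mat_bounded_mult)
qed

section \<open>Truncation of Hermitian matrices\<close>

text \<open>The iteration of \<open>resolvent_op\<close> as a formal polynomial: the same
  coefficients can then be evaluated at operators and at matrices.\<close>

primrec sp_resolvent :: "real \<Rightarrow> nat \<Rightarrow> star_poly \<Rightarrow> star_poly" where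
  "sp_resolvent C 0 p = SScale 0 SOne"
| "sp_resolvent C (Suc n) p = SScale (of_real (1 / (1 + C\<^sup>2)))
    (SAdd SOne (SAdd (SScale (of_real (C\<^sup>2)) (sp_resolvent C n p))
      (SScale (-1) (SMul p (SMul p (sp_resolvent C n p))))))"

lemma sp_op_resolvent: "sp_op xs (sp_resolvent C n p) = resolvent_op C n (sp_op xs p)"
proof (induction n)
  case 0
  show ?case
    using scaleR_eq_blinfun_scaleC[of 0 id_blinfun] by simp
next
  case (Suc n)
  have "blinfun_scaleC (-1) T = - T" for T :: "'a \<Rightarrow>\<^sub>L 'a"
    using scaleR_eq_blinfun_scaleC[of "-1" T] by simp
  then show ?case
    by (simp only: sp_resolvent.simps sp_op.simps Suc scaleR_eq_blinfun_scaleC[symmetric])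
      (simp add: scaleR_add_right)
qed

section \<open>Residual estimates for Hermitian matrices\<close>

lemma Re_cscalar_expand:
  fixes u v :: "complex vec"
  assumes "u \<in> carrier_vec k" "v \<in> carrier_vec k"
  shows "(vec_l2norm (u + v))\<^sup>2 = (vec_l2norm u)\<^sup>2 + 2 * Re (u \<bullet>c v) + (vec_l2norm v)\<^sup>2"
    and "(vec_l2norm (u - v))\<^sup>2 = (vec_l2norm u)\<^sup>2 - 2 * Re (u \<bullet>c v) + (vec_l2norm v)\<^sup>2"
proof -
  have "(cmod (a + b))\<^sup>2 = (cmod a)\<^sup>2 + 2 * Re (a * cnj b) + (cmod b)\<^sup>2"
    "(cmod (a - b))\<^sup>2 = (cmod a)\<^sup>2 - 2 * Re (a * cnj b) + (cmod b)\<^sup>2" for a b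
    unfolding cmod_power2 by (simp_all add: power2_eq_square algebra_simps)
  moreover have "u + v \<in> carrier_vec k" "u - v \<in> carrier_vec k"
    using assms by auto
  ultimately show "(vec_l2norm (u + v))\<^sup>2 = (vec_l2norm u)\<^sup>2 + 2 * Re (u \<bullet>c v) + (vec_l2norm v)\<^sup>2"
    "(vec_l2norm (u - v))\<^sup>2 = (vec_l2norm u)\<^sup>2 - 2 * Re (u \<bullet>c v) + (vec_l2norm v)\<^sup>2"
    using assms
    by (simp_all add: vec_l2norm_power2[of _ k] cscalar_prod_sum[OF assms] sum.distrib sum_subtractf sum_distrib_left del: times_complex.sel)
qed

lemma Re_cscalar_hermitian_square:
  assumes H: "H \<in> carrier_mat k k" "mat_adjoint H = H" and x: "x \<in> carrier_vec k"
  shows "x \<bullet>c (H *\<^sub>v (H *\<^sub>v x)) = complex_of_real ((vec_l2norm (H *\<^sub>v x))\<^sup>2)"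
proof -
  have Hx: "H *\<^sub>v x \<in> carrier_vec k"
    using H x by auto
  have "x \<bullet>c (H *\<^sub>v (H *\<^sub>v x)) = (H *\<^sub>v x) \<bullet>c (H *\<^sub>v x)"
    using cscalar_prod_adjoint[OF H(1) x Hx] H(2) by simp
  then show ?thesis
    using vec_l2norm_power2_eq[OF Hx] by simp
qed

lemma hermitian_square_defect_le:
  assumes H: "mat_adjoint H = H" "mat_bounded k H C" "C \<ge> 0" and x: "x \<in> carrier_vec k"
  shows "vec_l2norm (complex_of_real (C\<^sup>2) \<cdot>\<^sub>v x - H *\<^sub>v (H *\<^sub>v x)) \<le> C\<^sup>2 * vec_l2norm x"
proof -
  have c: "H \<in> carrier_mat k k"
    using H(2) by (simp add: mat_bounded_def)
  have Hx: "H *\<^sub>v x \<in> carrier_vec k" "H *\<^sub>v (H *\<^sub>v x) \<in> carrier_vec k"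
    using c x by auto
  have "(vec_l2norm (H *\<^sub>v (H *\<^sub>v x)))\<^sup>2 \<le> (C * vec_l2norm (H *\<^sub>v x))\<^sup>2"
    by (intro power_mono mat_boundedD[OF H(2) Hx(1)]) simp
  then have "(vec_l2norm (H *\<^sub>v (H *\<^sub>v x)))\<^sup>2 \<le> C\<^sup>2 * (vec_l2norm (H *\<^sub>v x))\<^sup>2"
    by (simp add: power_mult_distrib)
  moreover have "(complex_of_real (C\<^sup>2) \<cdot>\<^sub>v x) \<bullet>c (H *\<^sub>v (H *\<^sub>v x)) =
      complex_of_real (C\<^sup>2 * (vec_l2norm (H *\<^sub>v x))\<^sup>2)"
    using Re_cscalar_hermitian_square[OF c H(1) x] x Hx
    by (simp add: smult_scalar_prod_distrib[of _ k])
  then have "Re ((complex_of_real (C\<^sup>2) \<cdot>\<^sub>v x) \<bullet>c (H *\<^sub>v (H *\<^sub>v x))) = C\<^sup>2 * (vec_l2norm (H *\<^sub>v x))\<^sup>2"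
    by (simp only: Re_complex_of_real)
  moreover have "(vec_l2norm (complex_of_real (C\<^sup>2) \<cdot>\<^sub>v x))\<^sup>2 = (C\<^sup>2 * vec_l2norm x)\<^sup>2"
    by (simp add: vec_l2norm_smult norm_power)
  moreover have "0 \<le> C\<^sup>2 * (vec_l2norm (H *\<^sub>v x))\<^sup>2"
    by simp
  ultimately have "(vec_l2norm (complex_of_real (C\<^sup>2) \<cdot>\<^sub>v x - H *\<^sub>v (H *\<^sub>v x)))\<^sup>2 \<le> (C\<^sup>2 * vec_l2norm x)\<^sup>2"
    using Re_cscalar_expand(2)[OF smult_carrier_vec[THEN iffD2, OF x] Hx(2), of "complex_of_real (C\<^sup>2)"]
    by linarith
  then show ?thesis
    by (rule power2_le_imp_le) simp
qed

text \<open>The argument of \<open>norm_resolvent_op_le\<close> on column vectors. The resulting 2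
  is independent of \<open>C\<close>, of the number of steps and of the matrix size; it becomes the
  cutoff of the microstates of \<open>z\<close>.\<close>

lemma sp_mat_resolvent_bounded:
  assumes As: "As \<in> mat_tuples m k"
    and H: "mat_adjoint (sp_mat k As p) = sp_mat k As p" "mat_bounded k (sp_mat k As p) C" "C \<ge> 0"
  shows "mat_bounded k (sp_mat k As (SMul p (sp_resolvent C n p))) 2"
proof -
  let ?H = "sp_mat k As p"
  define S where "S n = sp_mat k As (sp_resolvent C n p)" for n
  have c: "?H \<in> carrier_mat k k" "\<And>n. S n \<in> carrier_mat k k"
    using sp_mat_carrier[OF As] by (auto simp: S_def)
  define K where "K = 1 + C\<^sup>2"
  have K: "K > 0" "K \<noteq> 0"
    by (simp_all add: K_def one_plus_square_pos less_imp_neq[OF one_plus_square_pos, symmetric])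
  have main: "vec_l2norm (?H *\<^sub>v (S n *\<^sub>v v)) \<le> 2 * vec_l2norm v" if v: "v \<in> carrier_vec k" for v
  proof -
    define s where "s n = S n *\<^sub>v v" for n
    define D where "D x = ?H *\<^sub>v (?H *\<^sub>v x)" for x
    have carr: "s n \<in> carrier_vec k" "x \<in> carrier_vec k \<Longrightarrow> D x \<in> carrier_vec k" for n x
      using mult_mat_vec_carrier[OF c(2) v] mult_mat_vec_carrier[OF c(1)] by (simp_all add: s_def D_def)
    have D_add: "D (x + y) = D x + D y" and D_diff: "D (x - y) = D x - D y"
      and D_smult: "D (a \<cdot>\<^sub>v x) = a \<cdot>\<^sub>v D x"
      if "x \<in> carrier_vec k" "y \<in> carrier_vec k" for x y a
      using that c mult_add_distrib_mat_vec[OF c(1)] mult_minus_distrib_mat_vec[OF c(1)] mult_mat_vec[OF c(1)]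
      by (simp_all add: D_def)
    \<comment> \<open>The residual, as in \<open>resolvent_err\<close>, with \<open>D\<close> in
      place of the squared operator.\<close>
    define e where "e n = v - s n - D (s n)" for n
    have e_carr: "e n \<in> carrier_vec k" for n
      using carr v by (auto simp: e_def)
    have s_Suc: "s (Suc n) = complex_of_real (1 / K) \<cdot>\<^sub>v (v + (complex_of_real (C\<^sup>2) \<cdot>\<^sub>v s n - D (s n)))" for n
    proof -
      have neg: "x + (-1) \<cdot>\<^sub>v y = x - y" if "x \<in> carrier_vec k" "y \<in> carrier_vec k" for x y :: "complex vec"
        using that by (intro eq_vecI) auto
      have "s (Suc n) = complex_of_real (1 / K) \<cdot>\<^sub>v (1\<^sub>m k *\<^sub>v v +
          (complex_of_real (C\<^sup>2) \<cdot>\<^sub>v (S n *\<^sub>v v) + (-1) \<cdot>\<^sub>v ((?H * (?H * S n)) *\<^sub>v v)))"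
        unfolding s_def S_def sp_resolvent.simps sp_mat.simps K_def[symmetric] using c v
        by (simp only: smult_mat_mult_vec[of _ k k] add_mult_distrib_mat_vec[of _ k k] S_def
            add_carrier_mat smult_carrier_mat mult_carrier_mat[of _ k k _ k] one_carrier_mat)
      also have "(?H * (?H * S n)) *\<^sub>v v = D (s n)"
        using c v by (simp add: D_def s_def assoc_mult_mat_vec[of _ k k _ k])
      finally show ?thesis
        using v carr(1)[of n] carr(2)[OF carr(1), of n] by (simp add: neg s_def)
    qed
    have e_Suc: "e (Suc n) = complex_of_real (1 / K) \<cdot>\<^sub>v (complex_of_real (C\<^sup>2) \<cdot>\<^sub>v e n - D (e n))" for n
    proof -
      let ?c = "complex_of_real (C\<^sup>2)" and ?K = "complex_of_real K"
      have 1: "?K = 1 + ?c" "?K \<noteq> 0"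
        using K(2) by (simp add: K_def) (simp only: of_real_eq_0_iff not_False_eq_True K(2))
      have 2: "D (s (Suc n)) = complex_of_real (1 / K) \<cdot>\<^sub>v (D v + (?c \<cdot>\<^sub>v D (s n) - D (D (s n))))"
        unfolding s_Suc using v carr by (simp add: D_add D_diff D_smult[OF _ v])
      have 3: "D (e n) = D v - D (s n) - D (D (s n))"
        unfolding e_def using v carr by (simp add: D_diff)
      have vs: "v \<in> carrier_vec k" "s n \<in> carrier_vec k" "D v \<in> carrier_vec k" "D (s n) \<in> carrier_vec k"
        "D (D (s n)) \<in> carrier_vec k"
        using v carr by auto
      \<comment> \<open>Entrywise form of the residual recursion: \<open>a\<close>,
        \<open>b\<close>, \<open>d\<close>, \<open>a'\<close>, \<open>d'\<close> stand for the
        entries of \<open>v\<close>, \<open>s n\<close>, \<open>D (s n)\<close>, \<open>D v\<close>,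
        \<open>D (D (s n))\<close>.\<close>
      have alg: "a - 1 / ?K * (a + (?c * b - d)) - 1 / ?K * (a' + (?c * d - d')) =
          1 / ?K * (?c * (a - b - d) - (a' - d - d'))" for a b d a' d'
      proof -
        have "?K * (a - 1 / ?K * (a + (?c * b - d)) - 1 / ?K * (a' + (?c * d - d'))) =
            ?K * a - (a + (?c * b - d)) - (a' + (?c * d - d'))"
          using 1(2) by (simp add: right_diff_distrib)
        also have "\<dots> = ?c * (a - b - d) - (a' - d - d')"
          unfolding 1(1) by (simp add: algebra_simps)
        finally have "?K * (a - 1 / ?K * (a + (?c * b - d)) - 1 / ?K * (a' + (?c * d - d'))) =
            ?c * (a - b - d) - (a' - d - d')" .
        moreover have "x = 1 / ?K * y" if "?K * x = y" for x y
          using that 1(2) by (simp add: field_simps)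
        ultimately show ?thesis
          by blast
      qed
      show ?thesis
        unfolding e_def[of "Suc n"] 2 3 unfolding s_Suc e_def
        by (rule eq_vecI) (use vs alg in \<open>simp_all add: of_real_divide\<close>)
    qed
    have e_le: "vec_l2norm (e n) \<le> vec_l2norm v" for n
    proof (induction n)
      case 0
      have "S 0 *\<^sub>v v = 0\<^sub>v k"
        using v by (intro eq_vecI) (auto simp: S_def smult_mat_mult_vec[of _ k k])
      then have "e 0 = v"
        using v by (intro eq_vecI) (auto simp: e_def s_def D_def mult_mat_zero_vec[OF c(1)])
      then show ?case
        by simp
    next
      case (Suc n)
      have "vec_l2norm (e (Suc n)) = 1 / K * vec_l2norm (complex_of_real (C\<^sup>2) \<cdot>\<^sub>v e n - D (e n))"
        unfolding e_Suc vec_l2norm_smult using K(1) by (simp add: norm_divide)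
      also have "\<dots> \<le> 1 / K * (C\<^sup>2 * vec_l2norm (e n))"
        unfolding D_def using K(1) hermitian_square_defect_le[OF H e_carr]
        by (intro mult_left_mono) auto
      also have "\<dots> = C\<^sup>2 / K * vec_l2norm (e n)"
        by simp
      also have "\<dots> \<le> 1 * vec_l2norm (e n)"
        using K(1) by (intro mult_right_mono) (auto simp: K_def)
      finally show ?case
        using Suc by simp
    qed
    have "s n + D (s n) = v - e n"
      using v carr(1)[of n] carr(2)[OF carr(1), of n] by (intro eq_vecI) (auto simp: e_def)
    then have "vec_l2norm (s n + D (s n)) \<le> 2 * vec_l2norm v"
      using vec_l2norm_diff[OF v e_carr, of n] e_le[of n] by simp
    then have "(vec_l2norm (s n + D (s n)))\<^sup>2 \<le> (2 * vec_l2norm v)\<^sup>2"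
      by (intro power_mono) auto
    moreover have "(vec_l2norm (s n + D (s n)))\<^sup>2 =
        (vec_l2norm (s n))\<^sup>2 + 2 * (vec_l2norm (?H *\<^sub>v s n))\<^sup>2 + (vec_l2norm (D (s n)))\<^sup>2"
      using Re_cscalar_expand(1)[OF carr(1) carr(2)[OF carr(1)], of n n]
        Re_cscalar_hermitian_square[OF c(1) H(1) carr(1), of n]
      by (simp add: D_def del: of_real_power)
    ultimately have "(vec_l2norm (?H *\<^sub>v s n))\<^sup>2 \<le> (2 * vec_l2norm v)\<^sup>2"
      using zero_le_power2[of "vec_l2norm (s n)"] zero_le_power2[of "vec_l2norm (D (s n))"]
        zero_le_power2[of "vec_l2norm (?H *\<^sub>v s n)"] by linarith
    then show ?thesis
      unfolding s_def by (rule power2_le_imp_le) simp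
  qed
  show ?thesis
    unfolding mat_bounded_def
  proof (intro conjI ballI)
    show "sp_mat k As (SMul p (sp_resolvent C n p)) \<in> carrier_mat k k"
      using sp_mat_carrier[OF As] .
    fix v :: "complex vec" assume v: "v \<in> carrier_vec k"
    have "sp_mat k As (SMul p (sp_resolvent C n p)) *\<^sub>v v = ?H *\<^sub>v (S n *\<^sub>v v)"
      using c v by (simp add: S_def assoc_mult_mat_vec[of _ k k _ k])
    then show "vec_l2norm (sp_mat k As (SMul p (sp_resolvent C n p)) *\<^sub>v v) \<le> 2 * vec_l2norm v"
      using main[OF v] by simp
  qed
qed

text \<open>A polynomial that is Hermitian at \<open>xs\<close> may fail to be so at matrices, which
  do not satisfy the relations of \<open>xs\<close>. Symmetrising makes it Hermitian at all matrices
  and leaves a Hermitian value at \<open>xs\<close> unchanged.\<close>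

definition sp_sym :: "star_poly \<Rightarrow> star_poly" where
  "sp_sym p = SScale (1/2) (SAdd p (sp_adj p))"

lemma sp_op_sym:
  assumes lin: "\<forall>x\<in>set xs. complex_linear x" and sa: "cadjoint (sp_op xs p) = sp_op xs p"
  shows "sp_op xs (sp_sym p) = sp_op xs p"
proof -
  have "sp_op xs (sp_sym p) = (1/2) *\<^sub>R (sp_op xs p + sp_op xs p)"
    using sa sp_op_adj[OF lin] scaleR_eq_blinfun_scaleC[of "1/2" "sp_op xs p + sp_op xs p"]
    by (simp add: sp_sym_def)
  then show ?thesis
    by (simp flip: scaleR_2)
qed

lemma sp_mat_sym_adjoint:
  assumes "As \<in> mat_tuples n k"
  shows "mat_adjoint (sp_mat k As (sp_sym p)) = sp_mat k As (sp_sym p)"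
  using sp_mat_carrier[OF assms, of p]
  by (simp add: sp_sym_def sp_mat_adj[OF assms] mat_adjoint_smult mat_adjoint_add[of _ k k] comm_add_mat[of _ k k])

lemma sp_mat_sym_bounded:
  assumes As: "As \<in> mat_tuples n k" and p: "mat_bounded k (sp_mat k As p) C"
  shows "mat_bounded k (sp_mat k As (sp_sym p)) C"
  using mat_bounded_smult[OF mat_bounded_add[OF p mat_bounded_adjoint[OF p]], of "1/2"]
  by (simp add: sp_sym_def sp_mat_adj[OF As])

section \<open>The normalized Hilbert--Schmidt norm\<close>

text \<open>The squared 2-norm of one matrix. Staying with squares replaces the triangle inequality
  by \<open>hs_sq_add_le\<close>, whose factors 2 account for the constants further on.\<close>

definition hs_sq :: "complex mat \<Rightarrow> real" where
  "hs_sq A = Re (normalized_trace (mat_adjoint A * A))"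

lemma hs_sq_eq_sum:
  assumes A: "A \<in> carrier_mat k k"
  shows "hs_sq A = (\<Sum>i<k. \<Sum>j<k. (cmod (A $$ (j, i)))\<^sup>2) / k"
proof -
  have A': "mat_adjoint A \<in> carrier_mat k k"
    using A by blast
  have "(\<Sum>i<k. (mat_adjoint A * A) $$ (i, i)) = (\<Sum>i<k. \<Sum>j<k. mat_adjoint A $$ (i, j) * A $$ (j, i))"
    by (intro sum.cong mat_mult_index_sum[OF A' A]) auto
  also have "\<dots> = (\<Sum>i<k. \<Sum>j<k. complex_of_real ((cmod (A $$ (j, i)))\<^sup>2))"
    using A by (intro sum.cong) (auto simp: complex_norm_square mult.commute simp del: of_real_power)
  also have "\<dots> = complex_of_real (\<Sum>i<k. \<Sum>j<k. (cmod (A $$ (j, i)))\<^sup>2)"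
    by simp
  finally have "normalized_trace (mat_adjoint A * A) = complex_of_real ((\<Sum>i<k. \<Sum>j<k. (cmod (A $$ (j, i)))\<^sup>2) / k)"
    using A unfolding normalized_trace_def by simp
  then show ?thesis
    by (simp only: hs_sq_def Re_complex_of_real)
qed

lemma hs_sq_nonneg: "A \<in> carrier_mat k k \<Longrightarrow> hs_sq A \<ge> 0"
  by (auto simp: hs_sq_eq_sum intro!: divide_nonneg_nonneg sum_nonneg)

lemma hs_sq_add_le:
  assumes "A \<in> carrier_mat k k" "B \<in> carrier_mat k k"
  shows "hs_sq (A + B) \<le> 2 * hs_sq A + 2 * hs_sq B"
proof -
  have c: "A + B \<in> carrier_mat k k"
    using assms by auto
  have le: "(cmod (a + b))\<^sup>2 \<le> 2 * (cmod a)\<^sup>2 + 2 * (cmod b)\<^sup>2" for a b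
  proof -
    have "(cmod (a + b))\<^sup>2 + (cmod (a - b))\<^sup>2 = 2 * (cmod a)\<^sup>2 + 2 * (cmod b)\<^sup>2"
      unfolding cmod_power2 by (simp add: power2_eq_square algebra_simps)
    then show ?thesis
      using zero_le_power2[of "cmod (a - b)"] by linarith
  qed
  have "(\<Sum>i<k. \<Sum>j<k. (cmod ((A + B) $$ (j, i)))\<^sup>2) \<le>
      (\<Sum>i<k. \<Sum>j<k. 2 * (cmod (A $$ (j, i)))\<^sup>2 + 2 * (cmod (B $$ (j, i)))\<^sup>2)"
    using assms le by (intro sum_mono) auto
  then have "hs_sq (A + B) \<le> (\<Sum>i<k. \<Sum>j<k. 2 * (cmod (A $$ (j, i)))\<^sup>2 + 2 * (cmod (B $$ (j, i)))\<^sup>2) / k"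
    unfolding hs_sq_eq_sum[OF c] by (rule divide_right_mono) simp
  then show ?thesis
    by (simp add: hs_sq_eq_sum[OF assms(1)] hs_sq_eq_sum[OF assms(2)] sum.distrib sum_distrib_left add_divide_distrib)
qed

lemma hs_sq_smult:
  assumes A: "A \<in> carrier_mat k k"
  shows "hs_sq (c \<cdot>\<^sub>m A) = (cmod c)\<^sup>2 * hs_sq A"
proof -
  have "c \<cdot>\<^sub>m A \<in> carrier_mat k k"
    using A by simp
  then show ?thesis
    using A by (simp add: hs_sq_eq_sum[of _ k] norm_mult power_mult_distrib sum_distrib_left)
qed

text \<open>Cyclicity of the trace. Because of this, conjugated errors cost nothing when orbits are
  compared.\<close>

lemma hs_sq_conj_unitary:
  assumes A: "A \<in> carrier_mat k k" and W: "W \<in> unitary_group k"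
  shows "hs_sq (W * A * mat_adjoint W) = hs_sq A"
proof -
  have W': "W \<in> carrier_mat k k" "mat_adjoint W \<in> carrier_mat k k" "mat_adjoint W * W = 1\<^sub>m k"
    using W by (auto simp: unitary_group_def)
  have A': "mat_adjoint A \<in> carrier_mat k k"
    using A by blast
  have "mat_adjoint (W * A * mat_adjoint W) = W * (mat_adjoint A * mat_adjoint W)"
    using A W' by (simp add: mat_adjoint_mult[of _ k k _ k])
  then have "mat_adjoint (W * A * mat_adjoint W) * (W * A * mat_adjoint W) =
      W * (mat_adjoint A * (mat_adjoint W * (W * (A * mat_adjoint W))))"
    using A A' W' by (simp add: assoc_mult_mat[of _ k k _ k _ k] mult_carrier_mat[of _ k k _ k])
  also have "mat_adjoint W * (W * (A * mat_adjoint W)) = A * mat_adjoint W"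
    using A W' by (simp add: assoc_mult_mat[of _ k k _ k _ k, symmetric])
  finally have "normalized_trace (mat_adjoint (W * A * mat_adjoint W) * (W * A * mat_adjoint W)) =
      normalized_trace (W * (mat_adjoint A * (A * mat_adjoint W)))"
    by (rule arg_cong)
  also have "\<dots> = normalized_trace (mat_adjoint A * (A * mat_adjoint W) * W)"
    by (rule normalized_trace_mult_commute[OF W'(1)]) (simp add: A A' W'(2) mult_carrier_mat[of _ k k _ k])
  also have "mat_adjoint A * (A * mat_adjoint W) * W = mat_adjoint A * A"
    using A A' W' by (simp add: assoc_mult_mat[of _ k k _ k _ k] mult_carrier_mat[of _ k k _ k])
  finally show ?thesis
    by (simp add: hs_sq_def)
qed

lemma tuple_norm2_less_iff:
  assumes "\<omega> > 0"
  shows "tuple_norm2 As < \<omega> \<longleftrightarrow> (\<Sum>A\<leftarrow>As. hs_sq A) < \<omega>\<^sup>2"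
proof -
  have "tuple_norm2 As < \<omega> \<longleftrightarrow> sqrt (\<Sum>A\<leftarrow>As. hs_sq A) < sqrt (\<omega>\<^sup>2)"
    using assms by (simp add: tuple_norm2_def hs_sq_def)
  then show ?thesis
    by (simp only: real_sqrt_less_iff)
qed

section \<open>Orbit covering numbers\<close>

lemma sum_list_map2:
  assumes "length xs = n" "length ys = n"
  shows "(\<Sum>z\<leftarrow>map2 f xs ys. g z) = (\<Sum>l<n. g (f (xs ! l) (ys ! l)))"
  using assms by (simp add: sum_list_sum_nth atLeast0LessThan)

lemma in_orbit_ball_iff:
  assumes "\<omega> > 0" and Bs: "Bs \<in> mat_tuples n k"
  shows "As \<in> orbit_ball k Bs \<omega> \<longleftrightarrow> As \<in> mat_tuples n k \<and>
    (\<exists>W\<in>unitary_group k. (\<Sum>l<n. hs_sq (As ! l - W * Bs ! l * mat_adjoint W)) < \<omega>\<^sup>2)"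
proof -
  have len: "length Bs = n"
    using Bs by (simp add: mat_tuples_def)
  have "(\<Sum>A\<leftarrow>map2 (\<lambda>A B. A - W * B * mat_adjoint W) As Bs. hs_sq A) =
      (\<Sum>l<n. hs_sq (As ! l - W * Bs ! l * mat_adjoint W))" if "As \<in> mat_tuples n k" for W
    using that len by (intro sum_list_map2) (auto simp: mat_tuples_def)
  then show ?thesis
    unfolding orbit_ball_def len tuple_norm2_less_iff[OF \<open>\<omega> > 0\<close>] mem_Collect_eq
    by (intro conj_cong refl bex_cong) simp
qed

lemma one_unitary: "1\<^sub>m k \<in> unitary_group k"
  by (simp add: unitary_group_def)

lemma floor_eq_imp_abs_diff_less:
  fixes x y :: real
  assumes "\<lfloor>N * x\<rfloor> = \<lfloor>N * y\<rfloor>" "N > 0"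
  shows "\<bar>x - y\<bar> < 1 / N"
proof -
  have "\<bar>N * x - N * y\<bar> < 1"
    using assms(1) by linarith
  then have "N * \<bar>x - y\<bar> < 1"
    using assms(2) by (simp add: abs_mult right_diff_distrib[symmetric])
  then show ?thesis
    using assms(2) by (simp add: field_simps)
qed

text \<open>Gives meaning to the least cardinality in the covering number. Entries are rounded to a
  grid; since centres must lie in \<open>\<Gamma>\<close>, each occupied cell contributes one of its
  own members, and the trivial unitary suffices.\<close>

lemma finite_orbit_cover_exists:
  assumes \<Gamma>: "\<Gamma> \<subseteq> {As \<in> mat_tuples n k. \<forall>A\<in>set As. mat_opnorm A \<le> R}" and \<omega>: "\<omega> > 0"
  shows "\<exists>C. finite C \<and> C \<subseteq> \<Gamma> \<and> \<Gamma> \<subseteq> (\<Union>Bs\<in>C. orbit_ball k Bs \<omega>)"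
proof -
  \<comment> \<open>With \<open>t = 2 n k\<close> the total squared error is at most
    \<open>t / N^2 = t \<omega>^2 / (t + 1)^2 < \<omega>^2\<close>; the 1 also keeps
    \<open>N\<close> positive when \<open>n\<close> or \<open>k\<close> is 0.\<close>
  define N where "N = (2 * real n * real k + 1) / \<omega>"
  have N: "N > 0"
    using \<omega> by (auto simp: N_def intro!: divide_pos_pos add_nonneg_pos)
  define I where "I = {..<n} \<times> {..<k} \<times> {..<k}"
  define \<rho> where "\<rho> As = (\<lambda>(l, i, j)\<in>I. (\<lfloor>N * Re (As ! l $$ (i, j))\<rfloor>, \<lfloor>N * Im (As ! l $$ (i, j))\<rfloor>))" for As :: "complex mat list"
  define L where "L = \<lceil>N * \<bar>R\<bar>\<rceil> + 1"
  have entry: "cmod (As ! l $$ (i, j)) \<le> \<bar>R\<bar>" if "As \<in> \<Gamma>" "l < n" "i < k" "j < k" for As l i j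
  proof -
    have "As ! l \<in> carrier_mat k k" "mat_opnorm (As ! l) \<le> R"
      using that \<Gamma> mat_tuples_nth[of As n k l] by (auto simp: mat_tuples_def)
    then have "mat_bounded k (As ! l) R"
      by (rule mat_bounded_of_opnorm)
    from mat_bounded_entry[OF this that(3,4)] show ?thesis
      by linarith
  qed
  have floor_bound: "\<lfloor>N * x\<rfloor> \<in> {-L..L}" if "\<bar>x\<bar> \<le> \<bar>R\<bar>" for x
  proof -
    have "\<bar>N * x\<bar> \<le> N * \<bar>R\<bar>"
      using that N by (simp add: abs_mult)
    then show ?thesis
      unfolding L_def by (simp, linarith)
  qed
  have "\<rho> ` \<Gamma> \<subseteq> I \<rightarrow>\<^sub>E ({-L..L} \<times> {-L..L})"
  proof (rule image_subsetI)
    fix As assume As: "As \<in> \<Gamma>"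
    show "\<rho> As \<in> I \<rightarrow>\<^sub>E ({-L..L} \<times> {-L..L})"
      unfolding \<rho>_def
    proof (rule restrict_PiE_iff[THEN iffD2], rule ballI)
      fix x assume "x \<in> I"
      then obtain l i j where x: "x = (l, i, j)" "l < n" "i < k" "j < k"
        by (auto simp: I_def)
      have "\<bar>Re (As ! l $$ (i, j))\<bar> \<le> \<bar>R\<bar>" "\<bar>Im (As ! l $$ (i, j))\<bar> \<le> \<bar>R\<bar>"
        using entry[OF As x(2-4)] abs_Re_le_cmod[of "As ! l $$ (i, j)"] abs_Im_le_cmod[of "As ! l $$ (i, j)"]
        by linarith+
      then show "(case x of (l, i, j) \<Rightarrow> (\<lfloor>N * Re (As ! l $$ (i, j))\<rfloor>, \<lfloor>N * Im (As ! l $$ (i, j))\<rfloor>))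
          \<in> {-L..L} \<times> {-L..L}"
        using floor_bound by (simp add: x(1))
    qed
  qed
  then have fin: "finite (\<rho> ` \<Gamma>)"
    by (rule finite_subset) (auto simp: I_def intro!: finite_PiE)
  define C where "C = inv_into \<Gamma> \<rho> ` (\<rho> ` \<Gamma>)"
  have "C \<subseteq> \<Gamma>"
    by (auto simp: C_def inv_into_into)
  moreover have "\<Gamma> \<subseteq> (\<Union>Bs\<in>C. orbit_ball k Bs \<omega>)"
  proof
    fix As assume As: "As \<in> \<Gamma>"
    define Bs where "Bs = inv_into \<Gamma> \<rho> (\<rho> As)"
    have Bs: "Bs \<in> \<Gamma>" "\<rho> Bs = \<rho> As" "Bs \<in> C"
      using As by (auto simp: Bs_def C_def inv_into_into f_inv_into_f)
    have tup: "As \<in> mat_tuples n k" "Bs \<in> mat_tuples n k"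
      using As Bs(1) \<Gamma> by auto
    have small: "hs_sq (As ! l - 1\<^sub>m k * Bs ! l * mat_adjoint (1\<^sub>m k)) \<le> 2 * real k / N\<^sup>2" if l: "l < n" for l
    proof -
      have c: "As ! l \<in> carrier_mat k k" "Bs ! l \<in> carrier_mat k k"
        using tup l by (auto intro: mat_tuples_nth)
      have eq: "As ! l - 1\<^sub>m k * Bs ! l * mat_adjoint (1\<^sub>m k) = As ! l - Bs ! l"
        using c by simp
      have d: "As ! l - Bs ! l \<in> carrier_mat k k"
        using c by (simp add: minus_carrier_mat)
      have ent: "(cmod ((As ! l - Bs ! l) $$ (j, i)))\<^sup>2 \<le> 2 / N\<^sup>2" if ij: "i < k" "j < k" for i j
      proof -
        let ?a = "As ! l $$ (j, i)" and ?b = "Bs ! l $$ (j, i)"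
        have "\<rho> As (l, j, i) = \<rho> Bs (l, j, i)"
          using Bs(2) by simp
        then have "\<lfloor>N * Re ?a\<rfloor> = \<lfloor>N * Re ?b\<rfloor>" "\<lfloor>N * Im ?a\<rfloor> = \<lfloor>N * Im ?b\<rfloor>"
          using l ij by (simp_all add: \<rho>_def I_def)
        then have "\<bar>Re ?a - Re ?b\<bar> < 1 / N" "\<bar>Im ?a - Im ?b\<bar> < 1 / N"
          using floor_eq_imp_abs_diff_less N by blast+
        then have "(Re ?a - Re ?b)\<^sup>2 \<le> (1 / N)\<^sup>2" "(Im ?a - Im ?b)\<^sup>2 \<le> (1 / N)\<^sup>2"
          using N by (auto intro!: power2_le_iff_abs_le[THEN iffD2])
        then show ?thesis
          using c ij by (simp add: cmod_power2 power_divide)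
      qed
      have "hs_sq (As ! l - Bs ! l) \<le> (\<Sum>i<k. \<Sum>j<k. 2 / N\<^sup>2) / k"
        unfolding hs_sq_eq_sum[OF d] using ent by (intro divide_right_mono sum_mono) auto
      also have "\<dots> \<le> 2 * real k / N\<^sup>2"
        by (cases "k = 0") (auto simp: field_simps)
      finally show ?thesis
        unfolding eq .
    qed
    have "(\<Sum>l<n. hs_sq (As ! l - 1\<^sub>m k * Bs ! l * mat_adjoint (1\<^sub>m k))) \<le> (\<Sum>l<n. 2 * real k / N\<^sup>2)"
      using small by (intro sum_mono) auto
    also have "\<dots> < \<omega>\<^sup>2"
    proof -
      define t where "t = 2 * real n * real k"
      have "t \<ge> 0"
        by (simp add: t_def)
      moreover have "(t + 1)\<^sup>2 = t * t + 2 * t + 1"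
        by (simp add: power2_eq_square algebra_simps)
      ultimately have "t < (t + 1)\<^sup>2"
        using mult_nonneg_nonneg[of t t] by linarith
      also have "\<dots> = \<omega>\<^sup>2 * N\<^sup>2"
        using \<omega> by (simp add: N_def t_def power_divide)
      finally have "t / N\<^sup>2 < \<omega>\<^sup>2"
        using N by (simp add: pos_divide_less_eq)
      then show ?thesis
        by (simp add: t_def mult_ac)
    qed
    finally have "As \<in> orbit_ball k Bs \<omega>"
      unfolding in_orbit_ball_iff[OF \<omega> tup(2)] using tup(1) one_unitary by blast
    then show "As \<in> (\<Union>Bs\<in>C. orbit_ball k Bs \<omega>)"
      using Bs(3) by blast
  qed
  ultimately show ?thesis
    using fin by (intro exI[of _ C]) (simp add: C_def)
qed

lemma orbit_covering_number_le:
  assumes "\<Gamma> \<noteq> {}" "finite C" "C \<subseteq> \<Gamma>" "\<Gamma> \<subseteq> (\<Union>Bs\<in>C. orbit_ball k Bs \<omega>)"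
  shows "orbit_covering_number k \<Gamma> \<omega> \<le> card C"
  using assms by (auto simp: orbit_covering_number_def intro!: Least_le)

lemma orbit_covering_number_attained:
  assumes "\<Gamma> \<noteq> {}" "\<exists>C. finite C \<and> C \<subseteq> \<Gamma> \<and> \<Gamma> \<subseteq> (\<Union>Bs\<in>C. orbit_ball k Bs \<omega>)"
  shows "\<exists>C. finite C \<and> card C = orbit_covering_number k \<Gamma> \<omega> \<and> C \<subseteq> \<Gamma> \<and> \<Gamma> \<subseteq> (\<Union>Bs\<in>C. orbit_ball k Bs \<omega>)"
proof -
  have "\<exists>p C. finite C \<and> card C = p \<and> C \<subseteq> \<Gamma> \<and> \<Gamma> \<subseteq> (\<Union>Bs\<in>C. orbit_ball k Bs \<omega>)"
    using assms(2) by blast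
  from LeastI_ex[OF this] show ?thesis
    using assms(1) by (simp add: orbit_covering_number_def)
qed

section \<open>Conjugation by unitaries and transfer of orbit covers\<close>

definition mat_conj :: "complex mat \<Rightarrow> complex mat \<Rightarrow> complex mat" where
  "mat_conj U A = U * A * mat_adjoint U"

lemma mat_conj_carrier [simp]:
  "U \<in> carrier_mat k k \<Longrightarrow> A \<in> carrier_mat k k \<Longrightarrow> mat_conj U A \<in> carrier_mat k k"
  by (simp add: mat_conj_def mult_carrier_mat[of _ k k _ k])

lemma mat_conj_linear:
  assumes "U \<in> carrier_mat k k" "A \<in> carrier_mat k k" "B \<in> carrier_mat k k"
  shows "mat_conj U (A + B) = mat_conj U A + mat_conj U B"
    and "mat_conj U (A - B) = mat_conj U A - mat_conj U B"
    and "mat_conj U (c \<cdot>\<^sub>m A) = c \<cdot>\<^sub>m mat_conj U A"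
  using assms
  by (simp_all add: mat_conj_def mult_add_distrib_mat[of _ k k _ k] add_mult_distrib_mat[of _ k k _ _ k]
      mult_minus_distrib_mat[of _ k k _ k] minus_mult_distrib_mat[of _ k k _ _ k]
      mult_smult_distrib[of _ k k _ k] mult_smult_assoc_mat[of _ k k _ k] mult_carrier_mat[of _ k k _ k])

lemma mat_conj_conj:
  assumes "U \<in> carrier_mat k k" "V \<in> carrier_mat k k" "A \<in> carrier_mat k k"
  shows "mat_conj U (mat_conj V A) = mat_conj (U * V) A"
  using assms
  by (simp add: mat_conj_def mat_adjoint_mult[of _ k k _ k] assoc_mult_mat[of _ k k _ k _ k]
      mult_carrier_mat[of _ k k _ k])

lemma unitary_mult_adjoint:
  assumes V: "V \<in> unitary_group k" and W: "W \<in> unitary_group k"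
  shows "V * mat_adjoint W \<in> unitary_group k" "V * mat_adjoint W * W = V"
proof -
  have c: "V \<in> carrier_mat k k" "W \<in> carrier_mat k k" "mat_adjoint V \<in> carrier_mat k k" "mat_adjoint W \<in> carrier_mat k k"
    and e: "mat_adjoint V * V = 1\<^sub>m k" "V * mat_adjoint V = 1\<^sub>m k" "mat_adjoint W * W = 1\<^sub>m k" "W * mat_adjoint W = 1\<^sub>m k"
    using assms by (auto simp: unitary_group_def)
  note simps = assoc_mult_mat[of _ k k _ k _ k] mult_carrier_mat[of _ k k _ k]
  show eq: "V * mat_adjoint W * W = V"
    using c e by (simp add: simps)
  have adj: "mat_adjoint (V * mat_adjoint W) = W * mat_adjoint V"
    using c by (simp add: mat_adjoint_mult[of _ k k _ k])
  have "V * mat_adjoint W * (W * mat_adjoint V) = (V * mat_adjoint W * W) * mat_adjoint V"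
    using c by (simp add: simps)
  then have 1: "V * mat_adjoint W * (W * mat_adjoint V) = 1\<^sub>m k"
    using eq e by simp
  have "W * mat_adjoint V * (V * mat_adjoint W) = W * ((mat_adjoint V * V) * mat_adjoint W)"
    using c by (simp add: simps)
  then have 2: "W * mat_adjoint V * (V * mat_adjoint W) = 1\<^sub>m k"
    using c e by simp
  show "V * mat_adjoint W \<in> unitary_group k"
    unfolding unitary_group_def mem_Collect_eq adj using 1 2 c by (simp add: simps)
qed

text \<open>A ball of the cover of \<open>\<Gamma>'\<close> that meets the image of \<open>f\<close>
  receives as new centre one preimage \<open>g Ds\<close>, as its old centre may have none. Two
  tuples with images in the same ball have images within \<open>2 \<omega>'\<close> of each other up
  to conjugation, which is the source of \<open>4 * \<omega>'^2\<close>.\<close>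

lemma orbit_covering_number_transfer:
  assumes \<omega>: "\<omega> > 0" "\<omega>' > 0" and ne: "\<Gamma> \<noteq> {}"
    and \<Gamma>: "\<Gamma> \<subseteq> mat_tuples n k" and \<Gamma>': "\<Gamma>' \<subseteq> mat_tuples p k" and f: "f ` \<Gamma> \<subseteq> \<Gamma>'"
    and cover: "\<exists>C. finite C \<and> C \<subseteq> \<Gamma>' \<and> \<Gamma>' \<subseteq> (\<Union>Bs\<in>C. orbit_ball k Bs \<omega>')"
    and transfer: "\<And>As Bs U. As \<in> \<Gamma> \<Longrightarrow> Bs \<in> \<Gamma> \<Longrightarrow> U \<in> unitary_group k \<Longrightarrow>
      (\<Sum>l<p. hs_sq (f As ! l - mat_conj U (f Bs ! l))) < 4 * \<omega>'\<^sup>2 \<Longrightarrow>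
      (\<Sum>l<n. hs_sq (As ! l - mat_conj U (Bs ! l))) < \<omega>\<^sup>2"
  shows "orbit_covering_number k \<Gamma> \<omega> \<le> orbit_covering_number k \<Gamma>' \<omega>'"
proof -
  have "\<Gamma>' \<noteq> {}"
    using f ne by blast
  from orbit_covering_number_attained[OF this cover] obtain C' where
    *: "finite C' \<and> card C' = orbit_covering_number k \<Gamma>' \<omega>' \<and> C' \<subseteq> \<Gamma>' \<and> \<Gamma>' \<subseteq> (\<Union>Bs\<in>C'. orbit_ball k Bs \<omega>')"
    by (rule exE)
  note C' = *[THEN conjunct1] *[THEN conjunct2, THEN conjunct1]
    *[THEN conjunct2, THEN conjunct2, THEN conjunct1] *[THEN conjunct2, THEN conjunct2, THEN conjunct2]
  define near where "near Ds = {As \<in> \<Gamma>. f As \<in> orbit_ball k Ds \<omega>'}" for Ds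
  define C'' where "C'' = {Ds \<in> C'. near Ds \<noteq> {}}"
  define g where "g Ds = (SOME As. As \<in> near Ds)" for Ds
  have g: "g Ds \<in> near Ds" if "Ds \<in> C''" for Ds
    using that by (simp add: g_def C''_def some_in_eq)
  have fin: "finite C''" "C'' \<subseteq> C'"
    using C'(1) by (auto simp: C''_def)
  have "g ` C'' \<subseteq> \<Gamma>"
    using g by (auto simp: near_def)
  moreover have "\<Gamma> \<subseteq> (\<Union>Bs\<in>g ` C''. orbit_ball k Bs \<omega>)"
  proof
    fix As assume As: "As \<in> \<Gamma>"
    then obtain Ds where Ds: "Ds \<in> C'" "f As \<in> orbit_ball k Ds \<omega>'"
      using f C'(4) by blast
    then have "Ds \<in> C''"
      using As by (auto simp: C''_def near_def)
    from g[OF this] have Bs: "g Ds \<in> \<Gamma>" "f (g Ds) \<in> orbit_ball k Ds \<omega>'"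
      by (auto simp: near_def)
    have Ds_tup: "Ds \<in> mat_tuples p k"
      using Ds(1) C'(3) \<Gamma>' by blast
    obtain V where V: "V \<in> unitary_group k" "(\<Sum>l<p. hs_sq (f As ! l - mat_conj V (Ds ! l))) < \<omega>'\<^sup>2"
      using Ds(2) unfolding in_orbit_ball_iff[OF \<omega>(2) Ds_tup] mat_conj_def by blast
    obtain W where W: "W \<in> unitary_group k" "(\<Sum>l<p. hs_sq (f (g Ds) ! l - mat_conj W (Ds ! l))) < \<omega>'\<^sup>2"
      using Bs(2) unfolding in_orbit_ball_iff[OF \<omega>(2) Ds_tup] mat_conj_def by blast
    \<comment> \<open>The adjoint of \<open>W\<close> undoes the rotation belonging to
      \<open>g Ds\<close>, and \<open>V\<close> performs the one belonging to
      \<open>As\<close>.\<close>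
    define U where "U = V * mat_adjoint W"
    have U: "U \<in> unitary_group k" "U * W = V"
      using unitary_mult_adjoint[OF V(1) W(1)] by (simp_all add: U_def)
    have uc: "U \<in> carrier_mat k k" "V \<in> carrier_mat k k" "W \<in> carrier_mat k k"
      using U(1) V(1) W(1) by (auto simp: unitary_group_def)
    have "hs_sq (f As ! l - mat_conj U (f (g Ds) ! l)) \<le>
        2 * hs_sq (f As ! l - mat_conj V (Ds ! l)) + 2 * hs_sq (f (g Ds) ! l - mat_conj W (Ds ! l))"
      if l: "l < p" for l
    proof -
      have c: "f As ! l \<in> carrier_mat k k" "f (g Ds) ! l \<in> carrier_mat k k" "Ds ! l \<in> carrier_mat k k"
        using As Bs(1) f \<Gamma>' Ds_tup l mat_tuples_nth[of _ p k l] by blast+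
      let ?X = "f As ! l - mat_conj V (Ds ! l)" and ?Y = "f (g Ds) ! l - mat_conj W (Ds ! l)"
      have carr: "?X \<in> carrier_mat k k" "?Y \<in> carrier_mat k k" "mat_conj U ?Y \<in> carrier_mat k k"
        "mat_conj U (f (g Ds) ! l) \<in> carrier_mat k k" "mat_conj V (Ds ! l) \<in> carrier_mat k k"
        using c uc by (simp_all add: minus_carrier_mat)
      have "mat_conj U ?Y = mat_conj U (f (g Ds) ! l) - mat_conj V (Ds ! l)"
        using c uc U(2) by (simp add: mat_conj_linear(2)[of _ k] mat_conj_conj[of _ k])
      then have "f As ! l - mat_conj U (f (g Ds) ! l) = ?X + (-1) \<cdot>\<^sub>m mat_conj U ?Y"
        using c carr by (intro eq_matI) auto
      then have "hs_sq (f As ! l - mat_conj U (f (g Ds) ! l)) \<le> 2 * hs_sq ?X + 2 * hs_sq ((-1) \<cdot>\<^sub>m mat_conj U ?Y)"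
        using hs_sq_add_le[of ?X k "(-1) \<cdot>\<^sub>m mat_conj U ?Y"] carr by simp
      also have "hs_sq ((-1) \<cdot>\<^sub>m mat_conj U ?Y) = hs_sq ?Y"
        using hs_sq_smult[OF carr(3), of "-1"] hs_sq_conj_unitary[OF carr(2) U(1)] by (simp add: mat_conj_def)
      finally show ?thesis .
    qed
    then have "(\<Sum>l<p. hs_sq (f As ! l - mat_conj U (f (g Ds) ! l))) \<le>
        (\<Sum>l<p. 2 * hs_sq (f As ! l - mat_conj V (Ds ! l)) + 2 * hs_sq (f (g Ds) ! l - mat_conj W (Ds ! l)))"
      by (intro sum_mono) auto
    also have "\<dots> < 4 * \<omega>'\<^sup>2"
      using V(2) W(2) by (simp add: sum.distrib flip: sum_distrib_left)
    finally have "(\<Sum>l<n. hs_sq (As ! l - mat_conj U (g Ds ! l))) < \<omega>\<^sup>2"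
      by (rule transfer[OF As Bs(1) U(1)])
    then have "As \<in> orbit_ball k (g Ds) \<omega>"
      using As Bs(1) \<Gamma> U(1) in_orbit_ball_iff[OF \<omega>(1), of "g Ds" n k As] by (auto simp: mat_conj_def)
    then show "As \<in> (\<Union>Bs\<in>g ` C''. orbit_ball k Bs \<omega>)"
      using \<open>Ds \<in> C''\<close> by blast
  qed
  ultimately have "orbit_covering_number k \<Gamma> \<omega> \<le> card (g ` C'')"
    using fin(1) by (intro orbit_covering_number_le ne) auto
  also have "\<dots> \<le> card C'"
    using card_image_le[OF fin(1), of g] card_mono[OF C'(1) fin(2)] by linarith
  finally show ?thesis
    using C'(2) by simp
qed

section \<open>Bounded strong approximation\<close>

lemma resolvent_op_mem:
  assumes A: "star_algebra A" and a: "a \<in> A"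
  shows "resolvent_op C n a \<in> A"
proof (induction n)
  case 0
  show ?case
    using star_algebra_more(2)[OF A] by simp
next
  case (Suc n)
  show ?case
    unfolding resolvent_op.simps
    by (intro star_algebra_more(1)[OF A] star_algebraD(3)[OF A] star_algebra_more(4)[OF A]
        star_algebraD(5)[OF A] star_algebraD(2)[OF A] Suc a)
qed

lemma cadjoint_truncation:
  fixes a :: "'h::complex_hilbert_space \<Rightarrow>\<^sub>L 'h"
  assumes "complex_linear a" "cadjoint a = a"
  shows "cadjoint (a o\<^sub>L resolvent_op C n a) = a o\<^sub>L resolvent_op C n a"
proof -
  let ?S = "\<lambda>n. resolvent_op C n a"
  \<comment> \<open>The star algebra of all complex-linear operators serves to show that the partial
    sums are complex-linear.\<close>
  have star: "star_algebra {T :: 'h \<Rightarrow>\<^sub>L 'h. complex_linear T}"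
    by (simp add: star_algebra_def)
  then have lin: "complex_linear (?S n)" for n
    using resolvent_op_mem[OF star] assms(1) by simp
  have comm: "a o\<^sub>L ?S n = ?S n o\<^sub>L a" for n
    by (rule blinfun_eqI) (simp add: resolvent_op_commute)
  have sa: "inner (a x) y = inner x (a y)" for x y
    by (rule inner_selfadjoint[OF assms])
  have S: "cinner (?S n x) y = cinner x (?S n y)" for n x y
  proof (induction n arbitrary: x y)
    case 0
    then show ?case
      by (simp add: blinfun.zero_left)
  next
    case (Suc n)
    interpret bounded_bilinear "cinner :: 'h \<Rightarrow> 'h \<Rightarrow> complex"
      by (rule bounded_bilinear_cinner)
    have "cinner (a (a (?S n x))) y = cinner x (?S n (a (a y)))"
      using Suc cinner_cadjoint[OF assms(1)] assms(2) by simp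
    then show ?case
      using Suc
      by (simp add: blinfun.add_left blinfun.diff_left blinfun.scaleR_left add_left add_right
          diff_left diff_right scaleR_left scaleR_right resolvent_op_commute)
  qed
  then have "cadjoint (?S n) = ?S n"
    by (rule cadjoint_eqI)
  then show ?thesis
    using comm by (simp add: cadjoint_compose assms lin)
qed

text \<open>Kaplansky density for Hermitian elements. No matrices are involved here, so the
  truncation is taken at \<open>C = norm a\<close>.\<close>

lemma kaplansky_bounded:
  fixes A M :: "('h::complex_hilbert_space \<Rightarrow>\<^sub>L 'h) set"
  assumes A: "star_algebra A" and M: "von_neumann_algebra M"
    and sub: "M \<subseteq> sot_closure A"
    and z: "z \<in> M" "cadjoint z = z" "norm z \<le> 2/5"
    and F: "finite F" "e > 0"
  shows "\<exists>y. (y \<in> A \<and> cadjoint y = y \<and> norm y \<le> 2) \<and> (\<forall>\<xi>\<in>F. norm (y \<xi> - z \<xi>) < e)"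
proof -
  obtain a where a: "a \<in> A" "cadjoint a = a"
    "\<forall>C\<ge>norm a. \<exists>n. \<forall>\<xi>\<in>F. norm (a (resolvent_op C n a \<xi>) - z \<xi>) < e"
    using kaplansky_truncation[OF A M sub z F] by blast
  then obtain n where n: "\<forall>\<xi>\<in>F. norm (a (resolvent_op (norm a) n a \<xi>) - z \<xi>) < e"
    by blast
  have lin: "complex_linear a"
    by (rule star_algebraD(1)[OF A a(1)])
  show ?thesis
    using n a resolvent_op_mem[OF A a(1)] star_algebraD(5)[OF A a(1)] cadjoint_truncation[OF lin a(2)]
      norm_truncation_le[OF lin a(2) order_refl]
    by (intro exI[of _ "a o\<^sub>L resolvent_op (norm a) n a"]) auto
qed

text \<open>The matrix clause ranges over all tuples with cutoff \<open>R\<close>, of any size, and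
  not only over microstates; it holds before any trace condition is imposed.\<close>

definition sp_truncated :: "real \<Rightarrow> ('h::complex_hilbert_space \<Rightarrow>\<^sub>L 'h) list \<Rightarrow> star_poly \<Rightarrow> bool" where
  "sp_truncated R xs G \<longleftrightarrow> cadjoint (sp_op xs G) = sp_op xs G \<and> norm (sp_op xs G) \<le> 2 \<and>
    (\<forall>n k As. As \<in> mat_tuples n k \<longrightarrow> (\<forall>A\<in>set As. mat_opnorm A \<le> R) \<longrightarrow>
      mat_adjoint (sp_mat k As G) = sp_mat k As G \<and> mat_opnorm (sp_mat k As G) \<le> 2)"

text \<open>The order of choices matters: \<open>a\<close> and a polynomial \<open>p\<close> for it,
  next \<open>C\<close>, large enough for \<open>a\<close> and for all values of \<open>p\<close> at
  matrices with cutoff \<open>R\<close>, and last the number \<open>n\<close> of iterations.\<close>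

lemma kaplansky_polynomial:
  fixes M :: "('h::complex_hilbert_space \<Rightarrow>\<^sub>L 'h) set"
  assumes lin: "\<forall>x\<in>set xs. complex_linear x" and M: "von_neumann_algebra M"
    and sub: "M \<subseteq> sot_closure (range (sp_op xs))"
    and z: "z \<in> M" "cadjoint z = z" "norm z \<le> 2/5"
    and F: "finite F" "e > 0"
  shows "\<exists>G. sp_truncated R xs G \<and> (\<forall>\<xi>\<in>F. norm (sp_op xs G \<xi> - z \<xi>) < e)"
proof -
  note A = star_algebra_range_sp_op[OF lin]
  obtain a where a: "a \<in> range (sp_op xs)" "cadjoint a = a"
    "\<forall>C\<ge>norm a. \<exists>n. \<forall>\<xi>\<in>F. norm (a (resolvent_op C n a \<xi>) - z \<xi>) < e"
    using kaplansky_truncation[OF A M sub z F] by blast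
  obtain p\<^sub>0 where p0: "a = sp_op xs p\<^sub>0"
    using a(1) by blast
  define p where "p = sp_sym p\<^sub>0"
  have p: "sp_op xs p = a"
    unfolding p_def p0 by (rule sp_op_sym[OF lin]) (use a(2) p0 in simp)
  obtain C\<^sub>0 where C0: "C\<^sub>0 \<ge> 0" "sp_bounded R p C\<^sub>0"
    using sp_bounded_exists by blast
  define C where "C = max C\<^sub>0 (norm a)"
  have C: "C \<ge> 0" "C \<ge> norm a" "C \<ge> C\<^sub>0"
    using C0(1) by (auto simp: C_def)
  obtain n where n: "\<forall>\<xi>\<in>F. norm (a (resolvent_op C n a \<xi>) - z \<xi>) < e"
    using a(3) C(2) by blast
  \<comment> \<open>The second symmetrisation makes matrix values Hermitian at once, without
    commuting \<open>p\<close> past its resolvent.\<close>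
  define G where "G = sp_sym (SMul p (sp_resolvent C n p))"
  have la: "complex_linear a"
    by (rule star_algebraD(1)[OF A a(1)])
  have op: "sp_op xs (SMul p (sp_resolvent C n p)) = a o\<^sub>L resolvent_op C n a"
    by (simp add: p sp_op_resolvent)
  have G: "sp_op xs G = a o\<^sub>L resolvent_op C n a"
    unfolding G_def op[symmetric] by (rule sp_op_sym[OF lin]) (simp only: op cadjoint_truncation[OF la a(2)])
  have mat: "mat_adjoint (sp_mat k As G) = sp_mat k As G \<and> mat_opnorm (sp_mat k As G) \<le> 2"
    if As: "As \<in> mat_tuples m k" "\<forall>A\<in>set As. mat_opnorm A \<le> R" for m k As
  proof
    show "mat_adjoint (sp_mat k As G) = sp_mat k As G"
      unfolding G_def by (rule sp_mat_sym_adjoint[OF As(1)])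
    have "mat_bounded k (sp_mat k As (SMul p (sp_resolvent C n p))) 2"
      using sp_mat_sym_adjoint[OF As(1)] mat_bounded_mono[OF C0(2)[unfolded sp_bounded_def, rule_format, OF As(1)] C(3)] As(2)
      by (intro sp_mat_resolvent_bounded[OF As(1)] C(1)) (auto simp: p_def)
    then have "mat_bounded k (sp_mat k As G) 2"
      unfolding G_def by (rule sp_mat_sym_bounded[OF As(1)])
    then show "mat_opnorm (sp_mat k As G) \<le> 2"
      by (rule opnorm_of_mat_bounded) simp
  qed
  show ?thesis
    unfolding sp_truncated_def
    by (intro exI[of _ G] conjI) (use mat n in \<open>auto simp: G cadjoint_truncation[OF la a(2)] norm_truncation_le[OF la a(2) C(2)]\<close>)
qed

section \<open>Hermitian generators\<close>

lemma cadjoint_scaleR: "complex_linear T \<Longrightarrow> cadjoint (s *\<^sub>R T) = s *\<^sub>R cadjoint T"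
  by (simp add: scaleR_eq_blinfun_scaleC cadjoint_scaleC)

definition re_part :: "('h::complex_hilbert_space \<Rightarrow>\<^sub>L 'h) \<Rightarrow> 'h \<Rightarrow>\<^sub>L 'h" where
  "re_part T = blinfun_scaleC (1/2) (T + cadjoint T)"

definition im_part :: "('h::complex_hilbert_space \<Rightarrow>\<^sub>L 'h) \<Rightarrow> 'h \<Rightarrow>\<^sub>L 'h" where
  "im_part T = blinfun_scaleC (-\<i>/2) (T + blinfun_scaleC (-1) (cadjoint T))"

lemma re_im_part:
  assumes M: "star_algebra M" and T: "T \<in> M"
  shows "re_part T \<in> M" "im_part T \<in> M" "cadjoint (re_part T) = re_part T" "cadjoint (im_part T) = im_part T"
    "re_part T + blinfun_scaleC \<i> (im_part T) = T"
proof -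
  have lin: "complex_linear T"
    by (rule star_algebraD(1)[OF M T])
  show "re_part T \<in> M" "im_part T \<in> M"
    unfolding re_part_def im_part_def by (intro star_algebraD[OF M] T)+
  show "cadjoint (re_part T) = re_part T"
    using lin by (simp add: re_part_def cadjoint_scaleC cadjoint_add add.commute)
  show "cadjoint (im_part T) = im_part T"
    using lin
    by (intro blinfun_eqI)
      (simp add: im_part_def cadjoint_scaleC cadjoint_add blinfun.add_left scaleC_add_right scaleC_scaleC add.commute)
  show "re_part T + blinfun_scaleC \<i> (im_part T) = T"
  proof (rule blinfun_eqI)
    fix x
    have "(re_part T + blinfun_scaleC \<i> (im_part T)) x =
        ((1/2) *\<^sub>C T x + (1/2) *\<^sub>C T x) + ((1/2) *\<^sub>C cadjoint T x + (-1/2) *\<^sub>C cadjoint T x)"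
      by (simp add: re_part_def im_part_def blinfun.add_left scaleC_add_right scaleC_scaleC)
    also have "\<dots> = 1 *\<^sub>C T x + 0 *\<^sub>C cadjoint T x"
      unfolding scaleC_add_left[symmetric] by simp
    also have "\<dots> = T x"
      using scaleC_of_real[of 1 "T x"] scaleC_of_real[of 0 "cadjoint T x"] by simp
    finally show "(re_part T + blinfun_scaleC \<i> (im_part T)) x = T x" .
  qed
qed

text \<open>Positive scaling into the ball of radius 2/5 is invertible inside an algebra, so the
  scaled real and imaginary parts still generate \<open>N\<close>. Elements \<open>ys\<close> of
  \<open>N\<close> may be prepended; the approximants of the generators of \<open>M\<close> enter
  there.\<close>

lemma vna_hermitian_generators:
  fixes N :: "('h::complex_hilbert_space \<Rightarrow>\<^sub>L 'h) set"
  assumes "finitely_generated_vna N"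
  obtains gens where "set gens \<subseteq> N" "\<And>z. z \<in> set gens \<Longrightarrow> cadjoint z = z \<and> norm z \<le> 2/5"
    "\<And>ys. set ys \<subseteq> N \<Longrightarrow> generates_vna (ys @ gens) N"
proof -
  obtain zs where zs: "zs \<noteq> []" "von_neumann_algebra N" "von_neumann_algebra hull (set zs) = N"
    using assms unfolding finitely_generated_vna_def generates_vna_def by blast
  note N = star_algebra_of_vna[OF zs(2)]
  have sub: "set zs \<subseteq> N"
    using hull_subset[of "set zs" von_neumann_algebra] zs(3) by simp
  \<comment> \<open>Division by \<open>1 + norm T\<close> rather than by \<open>norm T\<close>
    allows \<open>T = 0\<close>.\<close>
  define r where "r T = 2 / 5 / (1 + norm T)" for T :: "'h \<Rightarrow>\<^sub>L 'h"
  have r: "r T > 0" for T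
    by (simp add: r_def add_pos_nonneg)
  have r_norm: "norm (r T *\<^sub>R T) \<le> 2 / 5" for T
    by (simp add: r_def field_simps add_pos_nonneg abs_of_pos)
  define gens where "gens = concat (map (\<lambda>T. [r (re_part T) *\<^sub>R re_part T, r (im_part T) *\<^sub>R im_part T]) zs)"
  have gens_iff: "z \<in> set gens \<longleftrightarrow> (\<exists>T\<in>set zs. z = r (re_part T) *\<^sub>R re_part T \<or> z = r (im_part T) *\<^sub>R im_part T)" for z
    by (auto simp: gens_def)
  have gens_sub: "set gens \<subseteq> N"
  proof
    fix z assume "z \<in> set gens"
    then obtain T where T: "T \<in> set zs" "z = r (re_part T) *\<^sub>R re_part T \<or> z = r (im_part T) *\<^sub>R im_part T"
      using gens_iff by blast
    then have "T \<in> N"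
      using sub by blast
    then show "z \<in> N"
      using T(2) re_im_part(1,2)[OF N] star_algebra_more(1)[OF N] by metis
  qed
  have "cadjoint z = z \<and> norm z \<le> 2/5" if "z \<in> set gens" for z
  proof -
    obtain T where T: "T \<in> set zs" "z = r (re_part T) *\<^sub>R re_part T \<or> z = r (im_part T) *\<^sub>R im_part T"
      using \<open>z \<in> set gens\<close> gens_iff by blast
    then have "T \<in> N"
      using sub by blast
    obtain U where U: "U \<in> N" "cadjoint U = U" "z = r U *\<^sub>R U"
      using T(2) re_im_part(1-4)[OF N \<open>T \<in> N\<close>] by metis
    show ?thesis
      using cadjoint_scaleR[OF star_algebraD(1)[OF N U(1)], of "r U"] r_norm[of U] unfolding U(3) by (simp only: U(2))
  qed
  moreover have "generates_vna (ys @ gens) N" if ys: "set ys \<subseteq> N" for ys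
    unfolding generates_vna_def
  proof (intro conjI zs(2))
    show "ys @ gens \<noteq> []"
      using zs(1) by (cases zs) (simp_all add: gens_def)
    \<comment> \<open>The hull is treated as an intersection: every competitor \<open>V\<close>
      recovers each \<open>T\<close> from its scaled parts.\<close>
    have "N \<subseteq> V" if V: "von_neumann_algebra V" "set (ys @ gens) \<subseteq> V" for V
    proof -
      note SV = star_algebra_of_vna[OF V(1)]
      have "T \<in> V" if T: "T \<in> set zs" for T
      proof -
        have mem: "r (re_part T) *\<^sub>R re_part T \<in> V" "r (im_part T) *\<^sub>R im_part T \<in> V"
          using V(2) T gens_iff by (simp_all add: subset_iff) blast+
        have "re_part T \<in> V" "im_part T \<in> V"
          using star_algebra_more(1)[OF SV mem(1), of "1 / r (re_part T)"]
            star_algebra_more(1)[OF SV mem(2), of "1 / r (im_part T)"] r[of "re_part T"] r[of "im_part T"]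
          by simp_all
        then have "re_part T + blinfun_scaleC \<i> (im_part T) \<in> V"
          by (intro star_algebraD[OF SV])
        then show ?thesis
          using re_im_part(5)[OF N, of T] sub T by auto
      qed
      then show ?thesis
        using V(1) hull_minimal[of "set zs" V von_neumann_algebra] zs(3) by auto
    qed
    then have "N \<subseteq> von_neumann_algebra hull set (ys @ gens)"
      unfolding hull_def by blast
    moreover have "von_neumann_algebra hull set (ys @ gens) \<subseteq> N"
      using ys gens_sub zs(2) by (intro hull_minimal) auto
    ultimately show "von_neumann_algebra hull set (ys @ gens) = N"
      by blast
  qed
  ultimately show ?thesis
    using that gens_sub by blast
qed

text \<open>The strong closure of the *-polynomials is itself a von Neumann algebra containing
  \<open>xs\<close>, hence contains the hull.\<close>

lemma generated_vna_subset_closure: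
  assumes "generates_vna xs M"
  shows "M \<subseteq> sot_closure (range (sp_op xs))"
proof -
  have M: "von_neumann_algebra M" "von_neumann_algebra hull (set xs) = M"
    using assms by (auto simp: generates_vna_def)
  then have lin: "\<forall>x\<in>set xs. complex_linear x"
    using hull_subset[of "set xs" von_neumann_algebra] star_algebraD(1)[OF star_algebra_of_vna] by blast
  let ?C = "sot_closure (range (sp_op xs))"
  have "set xs \<subseteq> range (sp_op xs)"
  proof
    fix x assume "x \<in> set xs"
    then obtain i where "i < length xs" "x = xs ! i"
      by (auto simp: in_set_conv_nth)
    then have "x = sp_op xs (SVar i False)"
      by simp
    then show "x \<in> range (sp_op xs)"
      by (rule range_eqI)
  qed
  then have "set xs \<subseteq> ?C"
    using closure_of_subset[of "range (sp_op xs)" strong_operator_topology]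
    by (simp add: strong_operator_topology_topspace)
  then have "von_neumann_algebra hull (set xs) \<subseteq> ?C"
    by (rule hull_minimal) (rule von_neumann_algebra_sot_closure[OF star_algebra_range_sp_op[OF lin]])
  then show ?thesis
    using M(2) by simp
qed

section \<open>Approximating the generators of the large algebra\<close>

text \<open>The defect \<open>x - c (g + i h)\<close>. In the applications \<open>g\<close> and
  \<open>h\<close> approximate the real and imaginary parts of \<open>x\<close> divided by
  \<open>c\<close>, and \<open>c\<close> undoes this scaling.\<close>

definition dev_op :: "real \<Rightarrow> ('h::complex_hilbert_space \<Rightarrow>\<^sub>L 'h) \<Rightarrow> ('h \<Rightarrow>\<^sub>L 'h) \<Rightarrow> ('h \<Rightarrow>\<^sub>L 'h) \<Rightarrow> ('h \<Rightarrow>\<^sub>L 'h)" where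
  "dev_op c x g h = x + blinfun_scaleC (complex_of_real (- c)) (g + blinfun_scaleC \<i> h)"

definition dev_sq :: "real \<Rightarrow> ('h::complex_hilbert_space \<Rightarrow>\<^sub>L 'h) \<Rightarrow> ('h \<Rightarrow>\<^sub>L 'h) \<Rightarrow> ('h \<Rightarrow>\<^sub>L 'h) \<Rightarrow> ('h \<Rightarrow>\<^sub>L 'h)" where
  "dev_sq c x g h = cadjoint (dev_op c x g h) o\<^sub>L dev_op c x g h"

lemma norm_blinfun_scaleC_le: "norm (blinfun_scaleC c T) \<le> cmod c * norm T"
proof (rule norm_blinfun_bound)
  fix x
  have "norm (blinfun_scaleC c T x) = cmod c * norm (T x)"
    by (simp add: norm_scaleC)
  also have "\<dots> \<le> cmod c * (norm T * norm x)"
    by (intro mult_left_mono norm_blinfun) simp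
  finally show "norm (blinfun_scaleC c T x) \<le> cmod c * norm T * norm x"
    by (simp add: mult.assoc)
qed simp

text \<open>For Hermitian \<open>g\<close> and \<open>h\<close> the adjoint of the defect has the
  same shape, with -i for i and \<open>cadjoint x\<close> for \<open>x\<close>. Thus both factors of
  the square converge strongly and boundedly, although the adjoint is not strongly
  continuous.\<close>

lemma dev_op_trace_tendsto:
  fixes g h :: "'i \<Rightarrow> ('h::complex_hilbert_space \<Rightarrow>\<^sub>L 'h)"
  assumes \<tau>: "tracial_state M \<tau>" and M: "star_algebra M" and "F \<noteq> bot" and x: "x \<in> M"
    and g: "\<And>i. g i \<in> M" "\<And>i. cadjoint (g i) = g i" "\<And>i. norm (g i) \<le> 2"
    and h: "\<And>i. h i \<in> M" "\<And>i. cadjoint (h i) = h i" "\<And>i. norm (h i) \<le> 2"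
    and g0: "g\<^sub>0 \<in> M" "cadjoint g\<^sub>0 = g\<^sub>0" and h0: "h\<^sub>0 \<in> M" "cadjoint h\<^sub>0 = h\<^sub>0"
    and lim: "\<And>\<xi>. ((\<lambda>i. g i \<xi>) \<longlongrightarrow> g\<^sub>0 \<xi>) F" "\<And>\<xi>. ((\<lambda>i. h i \<xi>) \<longlongrightarrow> h\<^sub>0 \<xi>) F"
  shows "((\<lambda>i. \<tau> (dev_sq c x (g i) (h i)))
    \<longlongrightarrow> \<tau> (dev_sq c x g\<^sub>0 h\<^sub>0)) F"
proof -
  define D where "D s u g h = u + blinfun_scaleC (complex_of_real (- c)) (g + blinfun_scaleC s h)"
    for s and u g h :: "'h \<Rightarrow>\<^sub>L 'h"
  have D: "dev_op c x g h = D \<i> x g h" for g h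
    by (simp add: D_def dev_op_def)
  have D_adj: "cadjoint (dev_op c x g h) = D (- \<i>) (cadjoint x) g h"
    if "g \<in> M" "h \<in> M" "cadjoint g = g" "cadjoint h = h" for g h
    using that x star_algebraD(1)[OF M] by (simp add: D_def dev_op_def cadjoint_add cadjoint_scaleC)
  have D_lim: "((\<lambda>i. D s u (g i) (h i) \<xi>) \<longlongrightarrow> D s u g\<^sub>0 h\<^sub>0 \<xi>) F" for s u \<xi>
    unfolding D_def
    by (simp only: blinfun.add_left blinfun_scaleC_apply) (intro tendsto_add tendsto_const tendsto_scaleC lim)
  have D_norm: "norm (D s u (g i) (h i)) \<le> norm u + \<bar>c\<bar> * (2 + cmod s * 2)" for s u i
  proof -
    have "norm (g i + blinfun_scaleC s (h i)) \<le> 2 + cmod s * 2"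
      using g(3)[of i] h(3)[of i] norm_blinfun_scaleC_le[of s "h i"] mult_left_mono[OF h(3)[of i], of "cmod s"]
      by (intro order_trans[OF norm_triangle_ineq] add_mono) auto
    then have "norm (blinfun_scaleC (complex_of_real (- c)) (g i + blinfun_scaleC s (h i))) \<le> \<bar>c\<bar> * (2 + cmod s * 2)"
      by (intro order_trans[OF norm_blinfun_scaleC_le] mult_mono) auto
    then show ?thesis
      unfolding D_def by (intro order_trans[OF norm_triangle_ineq] add_mono) auto
  qed
  have D_mem: "D s u g h \<in> M" if "u \<in> M" "g \<in> M" "h \<in> M" for s u g h
    unfolding D_def using that by (intro star_algebraD[OF M])
  have x': "cadjoint x \<in> M"
    by (rule star_algebraD(6)[OF M x])
  define B where "B u = norm u + \<bar>c\<bar> * 4" for u :: "'h \<Rightarrow>\<^sub>L 'h"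
  have B: "norm (D \<i> x (g i) (h i)) \<le> B x" "norm (D (-\<i>) (cadjoint x) (g i) (h i)) \<le> B (cadjoint x)" for i
    using D_norm[of \<i> x i] D_norm[of "-\<i>" "cadjoint x" i] by (simp_all add: B_def)
  have "((\<lambda>i. \<tau> (D (-\<i>) (cadjoint x) (g i) (h i) o\<^sub>L D \<i> x (g i) (h i)))
    \<longlongrightarrow> \<tau> (D (-\<i>) (cadjoint x) g\<^sub>0 h\<^sub>0 o\<^sub>L D \<i> x g\<^sub>0 h\<^sub>0)) F"
  proof (rule tracial_state_tendsto[OF \<tau> M])
    show "D (-\<i>) (cadjoint x) (g i) (h i) o\<^sub>L D \<i> x (g i) (h i) \<in> M" for i
      by (intro star_algebraD(5)[OF M] D_mem x x' g h)
    show "D (-\<i>) (cadjoint x) g\<^sub>0 h\<^sub>0 o\<^sub>L D \<i> x g\<^sub>0 h\<^sub>0 \<in> M"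
      by (intro star_algebraD(5)[OF M] D_mem x x' g0 h0)
    show "((\<lambda>i. (D (-\<i>) (cadjoint x) (g i) (h i) o\<^sub>L D \<i> x (g i) (h i)) \<xi>)
      \<longlongrightarrow> (D (-\<i>) (cadjoint x) g\<^sub>0 h\<^sub>0 o\<^sub>L D \<i> x g\<^sub>0 h\<^sub>0) \<xi>) F" for \<xi>
      by (rule strong_tendsto_compose[OF D_lim D_lim B(2)])
    show "norm (D (-\<i>) (cadjoint x) (g i) (h i) o\<^sub>L D \<i> x (g i) (h i)) \<le> B (cadjoint x) * B x" for i
      using B[of i] order_trans[OF norm_ge_zero B(2)]
      by (intro order_trans[OF norm_blinfun_compose] mult_mono) auto
  qed fact
  then show ?thesis
    using D_adj[OF g(1) h(1) g(2) h(2)] D_adj[OF g0(1) h0(1) g0(2) h0(2)] by (simp add: dev_sq_def D)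
qed

text \<open>Kaplansky density for the star algebra \<open>\<Union>i. N i\<close> approximates the
  scaled real and imaginary parts of all \<open>xs\<close> by bounded nets, along which the traces
  of the squared defects tend to 0. A single index gives finitely many elements, and these lie in
  one \<open>N m\<close>.\<close>

lemma approximate_in_union:
  fixes M :: "('h::complex_hilbert_space \<Rightarrow>\<^sub>L 'h) set" and N :: "nat \<Rightarrow> ('h \<Rightarrow>\<^sub>L 'h) set"
  assumes M: "von_neumann_algebra M" and \<tau>: "tracial_state M \<tau>"
    and N: "\<And>i. von_neumann_algebra (N i)" "\<And>i. N i \<subseteq> M" "\<And>i. N i \<subseteq> N (Suc i)"
    and sub: "M \<subseteq> sot_closure (\<Union>i. N i)"
    and xs: "set xs \<subseteq> M" and n: "n = length xs" and \<eta>: "\<eta> > 0"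
  shows "\<exists>c>0. \<exists>i ys. length ys = 2 * n \<and> set ys \<subseteq> N i \<and>
    (\<forall>y\<in>set ys. cadjoint y = y \<and> norm y \<le> 2/5) \<and>
    (\<forall>j<n. cmod (\<tau> (dev_sq c (xs ! j) (ys ! j) (ys ! (n + j)))) < \<eta>)"
proof -
  note SM = star_algebra_of_vna[OF M]
  have mono: "N i \<subseteq> N j" if "i \<le> j" for i j
    using that N(3) by (rule lift_Suc_mono_le[rotated])
  have A: "star_algebra (\<Union>i. N i)"
  proof -
    have two: "\<exists>i. S \<in> N i \<and> T \<in> N i" if "S \<in> N i" "T \<in> N j" for S T i j
      using that mono[of i "max i j"] mono[of j "max i j"] by (intro exI[of _ "max i j"]) auto
    note D = star_algebraD[OF star_algebra_of_vna[OF N(1)]]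
    have "S + T \<in> (\<Union>i. N i) \<and> S o\<^sub>L T \<in> (\<Union>i. N i)" if ST: "S \<in> (\<Union>i. N i)" "T \<in> (\<Union>i. N i)" for S T
    proof -
      obtain i where "S \<in> N i" "T \<in> N i"
        using ST two by blast
      then show ?thesis
        using D(3)[of S i T] D(5)[of S i T] by blast
    qed
    moreover have "complex_linear T \<and> blinfun_scaleC c T \<in> (\<Union>i. N i) \<and> cadjoint T \<in> (\<Union>i. N i)"
      if T: "T \<in> (\<Union>i. N i)" for c T
    proof -
      obtain i where "T \<in> N i"
        using T by blast
      then show ?thesis
        using D(1)[of T i] D(4)[of T i c] D(6)[of T i] by blast
    qed
    moreover have "id_blinfun \<in> (\<Union>i. N i)"
      using D(2)[of 0] by blast
    ultimately show ?thesis
      unfolding star_algebra_def by simp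
  qed
  \<comment> \<open>Large enough that the real and imaginary parts, divided by \<open>c\<close>,
    have norm at most 2/5; the 1 keeps \<open>c\<close> positive.\<close>
  define c where "c = (5/2) * (1 + (\<Sum>x\<leftarrow>xs. norm (re_part x) + norm (im_part x)))"
  have "(\<Sum>x\<leftarrow>xs. norm (re_part x) + norm (im_part x)) \<ge> 0"
    by (auto intro!: sum_list_nonneg)
  then have c: "c > 0"
    by (simp add: c_def)
  have c_le: "norm (re_part x) \<le> 2/5 * c" "norm (im_part x) \<le> 2/5 * c" if "x \<in> set xs" for x
  proof -
    have "norm (re_part x) + norm (im_part x) \<le> (\<Sum>x\<leftarrow>xs. norm (re_part x) + norm (im_part x))"
      using that by (intro member_le_sum_list) auto
    moreover have "2/5 * c = 1 + (\<Sum>x\<leftarrow>xs. norm (re_part x) + norm (im_part x))"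
      by (simp add: c_def)
    ultimately have "norm (re_part x) \<le> 2/5 * c \<and> norm (im_part x) \<le> 2/5 * c"
      using norm_ge_zero[of "re_part x"] norm_ge_zero[of "im_part x"] by linarith
    then show "norm (re_part x) \<le> 2/5 * c" "norm (im_part x) \<le> 2/5 * c"
      by blast+
  qed
  define p where "p l = (if l < n then re_part (xs ! l) else im_part (xs ! (l - n)))" for l
  define t where "t l = (1 / c) *\<^sub>R p l" for l
  have p: "p l \<in> M" "cadjoint (p l) = p l" "norm (p l) \<le> 2/5 * c" if "l < 2 * n" for l
    using that xs n re_im_part[OF SM] c_le unfolding p_def
    by (auto simp: subset_iff)
  have t: "t l \<in> M" "cadjoint (t l) = t l" "norm (t l) \<le> 2/5" if "l < 2 * n" for l
  proof -
    show "t l \<in> M"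
      unfolding t_def by (rule star_algebra_more(1)[OF SM p(1)[OF that]])
    show "cadjoint (t l) = t l"
      using p(2)[OF that] star_algebraD(1)[OF SM p(1)[OF that]] by (simp add: t_def cadjoint_scaleR)
    show "norm (t l) \<le> 2/5"
      using p(3)[OF that] c by (simp add: t_def field_simps)
  qed
  have "\<forall>l\<in>{..<2 * n}. \<exists>g :: 'h set \<times> nat \<Rightarrow> _. (\<forall>i. g i \<in> (\<Union>i. N i) \<and> cadjoint (g i) = g i \<and> norm (g i) \<le> 2) \<and>
      (\<forall>\<xi>. ((\<lambda>i. g i \<xi>) \<longlongrightarrow> t l \<xi>) strong_net)"
  proof
    fix l assume "l \<in> {..<2 * n}"
    then have l: "l < 2 * n"
      by simp
    show "\<exists>g :: 'h set \<times> nat \<Rightarrow> _. (\<forall>i. g i \<in> (\<Union>i. N i) \<and> cadjoint (g i) = g i \<and> norm (g i) \<le> 2) \<and>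
        (\<forall>\<xi>. ((\<lambda>i. g i \<xi>) \<longlongrightarrow> t l \<xi>) strong_net)"
      by (rule strong_net_exists[where f = "\<lambda>y. y"]) (rule kaplansky_bounded[OF A M sub t[OF l]])
  qed
  from bchoice[OF this] obtain g :: "nat \<Rightarrow> 'h set \<times> nat \<Rightarrow> 'h \<Rightarrow>\<^sub>L 'h" where
    "\<forall>l\<in>{..<2 * n}. (\<forall>i. g l i \<in> (\<Union>i. N i) \<and> cadjoint (g l i) = g l i \<and> norm (g l i) \<le> 2) \<and>
      (\<forall>\<xi>. ((\<lambda>i. g l i \<xi>) \<longlongrightarrow> t l \<xi>) strong_net)"
    by (rule exE)
  then have g: "\<And>l i. l < 2 * n \<Longrightarrow> g l i \<in> (\<Union>i. N i)" "\<And>l i. l < 2 * n \<Longrightarrow> cadjoint (g l i) = g l i"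
    "\<And>l i. l < 2 * n \<Longrightarrow> norm (g l i) \<le> 2" "\<And>l \<xi>. l < 2 * n \<Longrightarrow> ((\<lambda>i. g l i \<xi>) \<longlongrightarrow> t l \<xi>) strong_net"
    by (simp_all del: split_paired_All)
  have gM: "g l i \<in> M" if "l < 2 * n" for l i
    using g(1)[OF that] N(2) by blast
  have dev0: "dev_op c (xs ! j) (t j) (t (n + j)) = 0" if j: "j < n" for j
  proof -
    have "t j + blinfun_scaleC \<i> (t (n + j)) = (1 / c) *\<^sub>R (re_part (xs ! j) + blinfun_scaleC \<i> (im_part (xs ! j)))"
      using j by (intro blinfun_eqI)
        (simp add: t_def p_def blinfun.add_left blinfun.scaleR_left scaleR_add_right scaleR_scaleC scaleC_scaleC mult.commute)
    also have "\<dots> = (1 / c) *\<^sub>R (xs ! j)"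
      using re_im_part(5)[OF SM] xs j n by (metis nth_mem subset_iff)
    finally have eq: "t j + blinfun_scaleC \<i> (t (n + j)) = (1 / c) *\<^sub>R (xs ! j)" .
    show ?thesis
      unfolding dev_op_def eq scaleR_eq_blinfun_scaleC[symmetric] using c by simp
  qed
  define Q where "Q i j = \<tau> (dev_sq c (xs ! j) (g j i) (g (n + j) i))" for i j
  have "((\<lambda>i. Q i j) \<longlongrightarrow> \<tau> (dev_sq c (xs ! j) (t j) (t (n + j)))) strong_net" if j: "j < n" for j
    unfolding Q_def
    by (rule dev_op_trace_tendsto[OF \<tau> SM strong_net_neq_bot]) (use j gM g t xs n in auto)
  then have "((\<lambda>i. Q i j) \<longlongrightarrow> 0) strong_net" if "j < n" for j
    using that dev0 tracial_state_zero[OF \<tau> SM] by (simp add: dev_sq_def)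
  then have "eventually (\<lambda>i. cmod (Q i j) < \<eta>) strong_net" if "j < n" for j
    using that \<eta> tendstoD[of "\<lambda>i. Q i j" 0 strong_net \<eta>] by simp
  then have "eventually (\<lambda>i. \<forall>j\<in>{..<n}. cmod (Q i j) < \<eta>) strong_net"
    by (intro eventually_ball_finite) auto
  then obtain i where i: "\<And>j. j < n \<Longrightarrow> cmod (Q i j) < \<eta>"
    using eventually_happens'[OF strong_net_neq_bot] by blast
  \<comment> \<open>The density argument loses a factor 5 (norm 2 instead of 2/5). Dividing by 5
    restores it, and \<open>5 * c\<close> in place of \<open>c\<close> leaves the defect
    unchanged.\<close>
  define ys where "ys = map (\<lambda>l. (1/5) *\<^sub>R g l i) [0..<2 * n]"
  have "\<exists>m. \<forall>l<2 * n. g l i \<in> N m"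
  proof -
    have "\<forall>l\<in>{..<2 * n}. \<exists>m. g l i \<in> N m"
      using g(1) by blast
    then obtain m where m: "\<And>l. l < 2 * n \<Longrightarrow> g l i \<in> N (m l)"
      by (metis lessThan_iff)
    \<comment> \<open>The sum of the indices is an upper bound for each of them.\<close>
    have "g l i \<in> N (\<Sum>l<2 * n. m l)" if "l < 2 * n" for l
      using m[OF that] mono[of "m l" "\<Sum>l<2 * n. m l"] member_le_sum[of l "{..<2 * n}" m] that by auto
    then show ?thesis
      by blast
  qed
  then obtain m where m: "\<And>l. l < 2 * n \<Longrightarrow> g l i \<in> N m"
    by blast
  have scaled: "dev_op (5 * c) x ((1/5) *\<^sub>R a) ((1/5) *\<^sub>R b) = dev_op c x a b" for x a b
    by (intro blinfun_eqI)
      (simp add: dev_op_def blinfun.add_left blinfun.scaleR_left scaleR_scaleC scaleC_scaleC scaleC_add_right)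
  have "set ys \<subseteq> N m"
    using m star_algebra_more(1)[OF star_algebra_of_vna[OF N(1)]] by (auto simp: ys_def)
  moreover have "cadjoint y = y \<and> norm y \<le> 2/5" if y: "y \<in> set ys" for y
  proof -
    obtain l where l: "l < 2 * n" "y = (1/5) *\<^sub>R g l i"
      using y by (auto simp: ys_def)
    have "cadjoint y = y"
      using g(2)[OF l(1)] star_algebraD(1)[OF SM gM[OF l(1)]] by (simp add: l(2) cadjoint_scaleR)
    then show ?thesis
      using g(3)[OF l(1), of i] l(2) by simp
  qed
  moreover have "cmod (\<tau> (dev_sq (5 * c) (xs ! j) (ys ! j) (ys ! (n + j)))) < \<eta>" if j: "j < n" for j
    using i[OF j] j by (simp add: ys_def scaled Q_def dev_sq_def)
  ultimately show ?thesis
    using c by (intro exI[of _ "5 * c"] conjI exI[of _ m] exI[of _ ys]) (auto simp: ys_def)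
qed

text \<open>All nets share one index filter, so the finitely many conditions, one per word and one
  per generator, hold together at some index. The defects stay below \<open>\<eta>\<close> because
  the inequality at \<open>zs\<close> is strict.\<close>

lemma approximate_by_polynomials:
  fixes M :: "('h::complex_hilbert_space \<Rightarrow>\<^sub>L 'h) set"
  assumes \<tau>: "tracial_state M \<tau>" and gen: "generates_vna xs M" and n: "n = length xs"
    and zs: "set zs \<subseteq> M" "\<And>z. z \<in> set zs \<Longrightarrow> cadjoint z = z \<and> norm z \<le> 2/5" "2 * n \<le> length zs"
    and W: "finite W" "\<And>w. w \<in> W \<Longrightarrow> \<forall>(i, s)\<in>set w. i < length zs" and \<epsilon>: "\<epsilon> > 0"
    and dev: "\<And>j. j < n \<Longrightarrow> cmod (\<tau> (dev_sq c (xs ! j) (zs ! j) (zs ! (n + j)))) < \<eta>"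
  shows "\<exists>Gs. length Gs = length zs \<and> (\<forall>G\<in>set Gs. sp_truncated R xs G) \<and>
    (\<forall>w\<in>W. cmod (\<tau> (word_op (map (sp_op xs) Gs) w) - \<tau> (word_op zs w)) < \<epsilon>) \<and>
    (\<forall>j<n. cmod (\<tau> (dev_sq c (xs ! j) (sp_op xs (Gs ! j)) (sp_op xs (Gs ! (n + j))))) < \<eta>)"
proof -
  have M: "von_neumann_algebra M" and xs: "set xs \<subseteq> M"
    using gen hull_subset[of "set xs" von_neumann_algebra] by (auto simp: generates_vna_def)
  note SM = star_algebra_of_vna[OF M]
  have lin: "\<forall>x\<in>set xs. complex_linear x"
    using xs star_algebraD(1)[OF SM] by blast
  let ?p = "length zs"
  have z: "zs ! l \<in> M" "cadjoint (zs ! l) = zs ! l" "norm (zs ! l) \<le> 2/5" if "l < ?p" for l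
    using zs that by (auto simp: subset_iff)
  have "\<forall>l\<in>{..<?p}. \<exists>g :: 'h set \<times> nat \<Rightarrow> _. (\<forall>i. sp_truncated R xs (g i)) \<and>
      (\<forall>\<xi>. ((\<lambda>i. sp_op xs (g i) \<xi>) \<longlongrightarrow> (zs ! l) \<xi>) strong_net)"
  proof
    fix l assume "l \<in> {..<?p}"
    then have l: "l < ?p"
      by simp
    show "\<exists>g :: 'h set \<times> nat \<Rightarrow> _. (\<forall>i. sp_truncated R xs (g i)) \<and> (\<forall>\<xi>. ((\<lambda>i. sp_op xs (g i) \<xi>) \<longlongrightarrow> (zs ! l) \<xi>) strong_net)"
      by (rule strong_net_exists[where f = "sp_op xs"])
        (rule kaplansky_polynomial[OF lin M generated_vna_subset_closure[OF gen] z[OF l]])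
  qed
  from bchoice[OF this] obtain g :: "nat \<Rightarrow> 'h set \<times> nat \<Rightarrow> star_poly" where "\<forall>l\<in>{..<?p}. (\<forall>i. sp_truncated R xs (g l i)) \<and>
      (\<forall>\<xi>. ((\<lambda>i. sp_op xs (g l i) \<xi>) \<longlongrightarrow> (zs ! l) \<xi>) strong_net)"
    by (rule exE)
  then have g: "\<And>l i. l < ?p \<Longrightarrow> sp_truncated R xs (g l i)"
    "\<And>l \<xi>. l < ?p \<Longrightarrow> ((\<lambda>i. sp_op xs (g l i) \<xi>) \<longlongrightarrow> (zs ! l) \<xi>) strong_net"
    by (simp_all del: split_paired_All)
  define Gs where "Gs i = map (\<lambda>l. g l i) [0..<?p]" for i
  define ops where "ops i = map (sp_op xs) (Gs i)" for i
  have ops: "length (ops i) = ?p" "l < ?p \<Longrightarrow> ops i ! l = sp_op xs (g l i)" for i l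
    by (simp_all add: ops_def Gs_def)
  have opsM: "sp_op xs G \<in> M" for G
    by (rule sp_op_mem[OF SM xs])
  have sa: "cadjoint (sp_op xs (g l i)) = sp_op xs (g l i)" "norm (sp_op xs (g l i)) \<le> 2" if "l < ?p" for l i
    using g(1)[OF that] by (auto simp: sp_truncated_def)
  have "eventually (\<lambda>i. cmod (\<tau> (word_op (ops i) w) - \<tau> (word_op zs w)) < \<epsilon>) strong_net" if w: "w \<in> W" for w
  proof -
    have "((\<lambda>i. \<tau> (word_op (ops i) w)) \<longlongrightarrow> \<tau> (word_op zs w)) strong_net"
    proof (rule tracial_state_tendsto[OF \<tau> SM])
      show "word_op (ops i) w \<in> M" for i
        by (rule word_op_mem[OF SM]) (use opsM W(2)[OF w] ops in \<open>auto simp: ops_def\<close>)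
      show "word_op zs w \<in> M"
        by (rule word_op_mem[OF SM zs(1) W(2)[OF w]])
      show "((\<lambda>i. word_op (ops i) w \<xi>) \<longlongrightarrow> word_op zs w \<xi>) strong_net" for \<xi>
        by (rule word_op_strong_tendsto(1)[where B = 2]) (use ops g(2) sa z W(2)[OF w] in auto)
      show "norm (word_op (ops i) w) \<le> 2 ^ length w" for i
        by (rule word_op_strong_tendsto(2)[where F = strong_net and zs = zs]) (use ops g(2) sa z W(2)[OF w] in auto)
    qed simp
    from tendstoD[OF this \<epsilon>] show ?thesis
      by (simp add: dist_norm)
  qed
  then have ev1: "eventually (\<lambda>i. \<forall>w\<in>W. cmod (\<tau> (word_op (ops i) w) - \<tau> (word_op zs w)) < \<epsilon>) strong_net"
    using W(1) by (intro eventually_ball_finite) auto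
  define Q where "Q a b j = \<tau> (dev_sq c (xs ! j) a b)" for a b j
  have "eventually (\<lambda>i. cmod (Q (sp_op xs (g j i)) (sp_op xs (g (n + j) i)) j) < \<eta>) strong_net" if j: "j < n" for j
  proof -
    have jp: "j < ?p" "n + j < ?p"
      using j zs(3) by auto
    have "((\<lambda>i. Q (sp_op xs (g j i)) (sp_op xs (g (n + j) i)) j) \<longlongrightarrow> Q (zs ! j) (zs ! (n + j)) j) strong_net"
      unfolding Q_def
      by (rule dev_op_trace_tendsto[OF \<tau> SM strong_net_neq_bot])
        (use j jp xs n opsM sa z g(2) in auto)
    then have "((\<lambda>i. cmod (Q (sp_op xs (g j i)) (sp_op xs (g (n + j) i)) j)) \<longlongrightarrow> cmod (Q (zs ! j) (zs ! (n + j)) j)) strong_net"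
      by (rule tendsto_norm)
    then show ?thesis
      by (rule order_tendstoD(2)) (use dev[OF j] in \<open>simp add: Q_def\<close>)
  qed
  then have "eventually (\<lambda>i. \<forall>j\<in>{..<n}. cmod (Q (sp_op xs (g j i)) (sp_op xs (g (n + j) i)) j) < \<eta>) strong_net"
    by (intro eventually_ball_finite) auto
  from eventually_happens'[OF strong_net_neq_bot eventually_conj[OF ev1 this]]
  obtain i where ii: "(\<forall>w\<in>W. cmod (\<tau> (word_op (ops i) w) - \<tau> (word_op zs w)) < \<epsilon>) \<and>
    (\<forall>j\<in>{..<n}. cmod (Q (sp_op xs (g j i)) (sp_op xs (g (n + j) i)) j) < \<eta>)"
    by (rule exE)
  note i = ii[THEN conjunct1] ii[THEN conjunct2]
  show ?thesis
  proof (intro exI[of _ "Gs i"] conjI)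
    show "length (Gs i) = ?p"
      by (simp add: Gs_def)
    show "\<forall>G\<in>set (Gs i). sp_truncated R xs G"
      using g(1) by (auto simp: Gs_def)
    show "\<forall>w\<in>W. cmod (\<tau> (word_op (map (sp_op xs) (Gs i)) w) - \<tau> (word_op zs w)) < \<epsilon>"
      using i(1) by (simp only: ops_def)
    show "\<forall>j<n. cmod (\<tau> (dev_sq c (xs ! j) (sp_op xs (Gs i ! j)) (sp_op xs (Gs i ! (n + j))))) < \<eta>"
    proof (intro allI impI)
      fix j assume j: "j < n"
      have "Gs i ! j = g j i" "Gs i ! (n + j) = g (n + j) i"
        using j zs(3) by (simp_all add: Gs_def)
      then show "cmod (\<tau> (dev_sq c (xs ! j) (sp_op xs (Gs i ! j)) (sp_op xs (Gs i ! (n + j))))) < \<eta>"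
        using i(2) j by (simp only: Q_def lessThan_iff Ball_def)
    qed
  qed
qed

section \<open>Comparing covering numbers of microstate spaces\<close>

lemma finitely_many_traces_close:
  assumes \<tau>: "tracial_state M \<tau>" and M: "star_algebra M" and xs: "set xs \<subseteq> M" and e: "e > 0"
    and "finite P"
  shows "\<exists>m. \<exists>\<epsilon>>0. \<forall>p\<in>P. trace_close \<tau> xs R e m \<epsilon> p"
  using \<open>finite P\<close>
proof (induction P)
  case empty
  show ?case
    by (intro exI[of _ 0] exI[of _ 1]) simp
next
  case (insert p P)
  obtain m \<epsilon> where m: "\<epsilon> > 0" "\<forall>p\<in>P. trace_close \<tau> xs R e m \<epsilon> p"
    using insert.IH by blast
  obtain m' \<epsilon>' where m': "\<epsilon>' > 0" "trace_close \<tau> xs R e m' \<epsilon>' p"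
    using trace_converges_star_poly[OF \<tau> M xs] e unfolding trace_converges_def by blast
  have "trace_close \<tau> xs R e (max m m') (min \<epsilon> \<epsilon>') q" if "q \<in> insert p P" for q
    using that m(2) trace_close_mono[of \<tau> xs R e m \<epsilon> q] trace_close_mono[OF m'(2)] by auto
  then show ?case
    using m(1) m'(1) by (intro exI[of _ "max m m'"] exI[of _ "min \<epsilon> \<epsilon>'"]) simp
qed

definition sp_word :: "star_poly list \<Rightarrow> (nat \<times> bool) list \<Rightarrow> star_poly" where
  "sp_word Gs w = foldr (\<lambda>(i, s) p. SMul (if s then sp_adj (Gs ! i) else Gs ! i) p) w SOne"

lemma sp_op_word:
  assumes "\<forall>x\<in>set xs. complex_linear x" "\<forall>(i, s)\<in>set w. i < length Gs"
  shows "sp_op xs (sp_word Gs w) = word_op (map (sp_op xs) Gs) w"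
  using assms(2) by (induction w) (auto simp: sp_word_def sp_op_adj[OF assms(1)])

lemma sp_mat_word:
  assumes "As \<in> mat_tuples n k" "\<forall>(i, s)\<in>set w. i < length Gs"
  shows "sp_mat k As (sp_word Gs w) = word_mat k (map (sp_mat k As) Gs) w"
  using assms(2) by (induction w) (auto simp: sp_word_def sp_mat_adj[OF assms(1)])

definition sp_dev :: "real \<Rightarrow> nat \<Rightarrow> star_poly \<Rightarrow> star_poly \<Rightarrow> star_poly" where
  "sp_dev c j g h = SAdd (SVar j False) (SScale (complex_of_real (- c)) (SAdd g (SScale \<i> h)))"

lemma sp_op_dev: "j < length xs \<Longrightarrow> sp_op xs (sp_dev c j g h) = dev_op c (xs ! j) (sp_op xs g) (sp_op xs h)"
  by (simp add: sp_dev_def dev_op_def)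

text \<open>Up to the two defects, \<open>A\<close> and \<open>A\<^sub>0\<close> are linear in
  \<open>B\<close>, \<open>H\<close> and in \<open>B\<^sub>0\<close>, \<open>H\<^sub>0\<close>, and
  conjugation by \<open>U\<close> is linear and isometric. Three uses of \<open>hs_sq_add_le\<close>
  give 2 + 4 = 6 for the defects and 2 times 2 times 2 = 8 for the rest.\<close>

lemma hs_sq_conj_transfer:
  assumes c: "A \<in> carrier_mat k k" "B \<in> carrier_mat k k" "H \<in> carrier_mat k k"
    "A\<^sub>0 \<in> carrier_mat k k" "B\<^sub>0 \<in> carrier_mat k k" "H\<^sub>0 \<in> carrier_mat k k"
    and U: "U \<in> unitary_group k"
    and \<eta>: "hs_sq (A + complex_of_real (- c) \<cdot>\<^sub>m (B + \<i> \<cdot>\<^sub>m H)) \<le> \<eta>"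
      "hs_sq (A\<^sub>0 + complex_of_real (- c) \<cdot>\<^sub>m (B\<^sub>0 + \<i> \<cdot>\<^sub>m H\<^sub>0)) \<le> \<eta>"
  shows "hs_sq (A - mat_conj U A\<^sub>0) \<le>
    6 * \<eta> + 8 * c\<^sup>2 * (hs_sq (B - mat_conj U B\<^sub>0) + hs_sq (H - mat_conj U H\<^sub>0))"
proof -
  define D D\<^sub>0 where "D = A + complex_of_real (- c) \<cdot>\<^sub>m (B + \<i> \<cdot>\<^sub>m H)"
    and "D\<^sub>0 = A\<^sub>0 + complex_of_real (- c) \<cdot>\<^sub>m (B\<^sub>0 + \<i> \<cdot>\<^sub>m H\<^sub>0)"
  define X Y where "X = B - mat_conj U B\<^sub>0" and "Y = H - mat_conj U H\<^sub>0"
  have uc: "U \<in> carrier_mat k k"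
    using U by (auto simp: unitary_group_def)
  have cc: "mat_conj U A\<^sub>0 \<in> carrier_mat k k" "mat_conj U B\<^sub>0 \<in> carrier_mat k k" "mat_conj U H\<^sub>0 \<in> carrier_mat k k"
    using uc c by simp_all
  have D: "D \<in> carrier_mat k k" "D\<^sub>0 \<in> carrier_mat k k"
    using c by (simp_all add: D_def D\<^sub>0_def)
  have XY: "X \<in> carrier_mat k k" "Y \<in> carrier_mat k k"
    using c cc by (simp_all add: X_def Y_def minus_carrier_mat)
  have conj_D: "mat_conj U D\<^sub>0 = mat_conj U A\<^sub>0 + complex_of_real (- c) \<cdot>\<^sub>m (mat_conj U B\<^sub>0 + \<i> \<cdot>\<^sub>m mat_conj U H\<^sub>0)"
    using uc c unfolding D\<^sub>0_def by (simp add: mat_conj_linear(1,3)[of _ k])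
  have split: "A - mat_conj U A\<^sub>0 =
      D + (complex_of_real c \<cdot>\<^sub>m (X + \<i> \<cdot>\<^sub>m Y) + (-1) \<cdot>\<^sub>m mat_conj U D\<^sub>0)"
    unfolding conj_D D_def X_def Y_def using c cc by (intro eq_matI) (auto simp: algebra_simps)
  have CD: "mat_conj U D\<^sub>0 \<in> carrier_mat k k"
    using uc D by simp
  have "hs_sq (A - mat_conj U A\<^sub>0) \<le>
      2 * hs_sq D + 2 * hs_sq (complex_of_real c \<cdot>\<^sub>m (X + \<i> \<cdot>\<^sub>m Y) + (-1) \<cdot>\<^sub>m mat_conj U D\<^sub>0)"
    unfolding split using D XY CD by (intro hs_sq_add_le) auto
  also have "hs_sq (complex_of_real c \<cdot>\<^sub>m (X + \<i> \<cdot>\<^sub>m Y) + (-1) \<cdot>\<^sub>m mat_conj U D\<^sub>0) \<le>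
      2 * hs_sq (complex_of_real c \<cdot>\<^sub>m (X + \<i> \<cdot>\<^sub>m Y)) + 2 * hs_sq ((-1) \<cdot>\<^sub>m mat_conj U D\<^sub>0)"
    using D XY CD by (intro hs_sq_add_le) auto
  also have "hs_sq ((-1) \<cdot>\<^sub>m mat_conj U D\<^sub>0) = hs_sq D\<^sub>0"
    using hs_sq_smult[OF CD, of "-1"] hs_sq_conj_unitary[OF D(2) U] by (simp add: mat_conj_def)
  also have "hs_sq (complex_of_real c \<cdot>\<^sub>m (X + \<i> \<cdot>\<^sub>m Y)) = c\<^sup>2 * hs_sq (X + \<i> \<cdot>\<^sub>m Y)"
    using hs_sq_smult[of "X + \<i> \<cdot>\<^sub>m Y" k "complex_of_real c"] XY by simp
  also have "c\<^sup>2 * hs_sq (X + \<i> \<cdot>\<^sub>m Y) \<le> c\<^sup>2 * (2 * hs_sq X + 2 * hs_sq Y)"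
    using hs_sq_add_le[of X k "\<i> \<cdot>\<^sub>m Y"] hs_sq_smult[OF XY(2), of \<i>] XY by (intro mult_left_mono) auto
  finally show ?thesis
    using \<eta> unfolding D_def[symmetric] D\<^sub>0_def[symmetric] X_def[symmetric] Y_def[symmetric]
    by (simp add: algebra_simps)
qed

text \<open>The value \<open>ln 0 = 0\<close> covers the case \<open>a = 0\<close>.\<close>

lemma ln_real_nat_mono: "a \<le> b \<Longrightarrow> ln (real a) \<le> ln (real b)"
  by (cases "a = 0"; cases "b = 0") auto

text \<open>The family \<open>zs\<close> and the radius \<open>\<omega>'\<close> are fixed before
  \<open>m'\<close> and \<open>\<epsilon>'\<close>; only the polynomials, \<open>m\<close> and
  \<open>\<epsilon>\<close> depend on these. So the infimum over \<open>m'\<close> and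
  \<open>\<epsilon>'\<close> for \<open>zs\<close> can be used at one radius. This order is possible
  because the defect bound \<open>\<eta>\<close> for \<open>zs\<close> does not involve
  \<open>m'\<close> or \<open>\<epsilon>'\<close>.\<close>

lemma microstate_covering_bound:
  fixes M :: "('h::complex_hilbert_space \<Rightarrow>\<^sub>L 'h) set" and N :: "nat \<Rightarrow> ('h \<Rightarrow>\<^sub>L 'h) set"
  assumes M: "von_neumann_algebra M" and \<tau>: "tracial_state M \<tau>" and gen: "generates_vna xs M"
    and N: "\<And>i. von_neumann_algebra (N i)" "\<And>i. N i \<subseteq> M" "\<And>i. N i \<subseteq> N (Suc i)"
    and fg: "\<And>i. finitely_generated_vna (N i)"
    and sub: "M \<subseteq> sot_closure (\<Union>i. N i)"
    and \<omega>: "0 < \<omega>"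
  obtains zs i \<omega>' where "generates_vna zs (N i)" "0 < \<omega>'" "\<omega>' < \<omega>"
    "\<forall>m'. \<forall>\<epsilon>'>0. \<exists>m. \<exists>\<epsilon>>0. \<forall>k\<ge>1. microstates \<tau> xs R m k \<epsilon> \<noteq> {} \<longrightarrow>
      orbit_covering_number k (microstates \<tau> xs R m k \<epsilon>) \<omega> \<le>
      orbit_covering_number k (microstates \<tau> zs 2 m' k \<epsilon>') \<omega>'"
proof -
  note SM = star_algebra_of_vna[OF M]
  have xs: "set xs \<subseteq> M"
    using gen hull_subset[of "set xs" von_neumann_algebra] by (auto simp: generates_vna_def)
  have lin: "\<forall>x\<in>set xs. complex_linear x"
    using xs star_algebraD(1)[OF SM] by blast
  define n where "n = length xs"
  \<comment> \<open>The final estimate has the form \<open>12 n \<eta> + 64 c^2 \<omega>'^2\<close>;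
    this choice makes the first term at most half of \<open>\<omega>^2\<close>.\<close>
  define \<eta> where "\<eta> = \<omega>\<^sup>2 / (24 * (real n + 1))"
  have \<eta>: "\<eta> > 0"
    using \<omega> by (simp add: \<eta>_def add_nonneg_pos)
  obtain c i ys where c: "c > 0" and ys: "length ys = 2 * n" "set ys \<subseteq> N i"
    "\<forall>y\<in>set ys. cadjoint y = y \<and> norm y \<le> 2/5"
    and dev: "\<forall>j<n. cmod (\<tau> (dev_sq c (xs ! j) (ys ! j) (ys ! (n + j)))) < \<eta>"
    using approximate_in_union[OF M \<tau> N sub xs n_def \<eta>] by blast
  obtain gens where gens: "set gens \<subseteq> N i" "\<And>z. z \<in> set gens \<Longrightarrow> cadjoint z = z \<and> norm z \<le> 2/5"
    "\<And>ys. set ys \<subseteq> N i \<Longrightarrow> generates_vna (ys @ gens) (N i)"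
    using vna_hermitian_generators[OF fg] by blast
  define zs where "zs = ys @ gens"
  \<comment> \<open>The bound \<open>\<omega> / (16 * c)\<close> makes
    \<open>64 c^2 \<omega>'^2\<close> at most a quarter of \<open>\<omega>^2\<close>; the bound
    \<open>\<omega> / 2\<close> ensures \<open>\<omega>' < \<omega>\<close>.\<close>
  define \<omega>' where "\<omega>' = min (\<omega> / 2) (\<omega> / (16 * c))"
  have \<omega>': "0 < \<omega>'" "\<omega>' < \<omega>" "\<omega>' \<le> \<omega> / (16 * c)"
    using \<omega> c by (auto simp: \<omega>'_def min_def)
  have zs: "set zs \<subseteq> M" "z \<in> set zs \<Longrightarrow> cadjoint z = z \<and> norm z \<le> 2/5" "2 * n \<le> length zs" for z
    using ys gens N(2)[of i] by (auto simp: zs_def)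
  have zs_nth: "zs ! l = ys ! l" if "l < 2 * n" for l
    using that ys(1) by (simp add: zs_def nth_append)
  have dev': "cmod (\<tau> (dev_sq c (xs ! j) (zs ! j) (zs ! (n + j)))) < \<eta>" if "j < n" for j
    using dev that zs_nth[of j] zs_nth[of "n + j"] by simp
  let ?p = "length zs"
  have main: "\<exists>m. \<exists>\<epsilon>>0. \<forall>k\<ge>1. microstates \<tau> xs R m k \<epsilon> \<noteq> {} \<longrightarrow>
      orbit_covering_number k (microstates \<tau> xs R m k \<epsilon>) \<omega> \<le>
      orbit_covering_number k (microstates \<tau> zs 2 m' k \<epsilon>') \<omega>'" if \<epsilon>': "\<epsilon>' > 0" for m' \<epsilon>'
  proof -
    define W where "W = {w. set w \<subseteq> {..<?p} \<times> (UNIV :: bool set) \<and> length w \<le> m'}"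
    have W: "\<And>w. w \<in> W \<Longrightarrow> \<forall>(i, s)\<in>set w. i < ?p"
      by (auto simp: W_def)
    have finW: "finite W"
      unfolding W_def by (intro finite_lists_length_le) simp
    \<comment> \<open>One half of the tolerance pays for replacing \<open>zs\<close> by polynomials
      at \<open>xs\<close>, the other for replacing operators by matrices.\<close>
    have "\<epsilon>' / 2 > 0"
      using \<epsilon>' by simp
    from approximate_by_polynomials[OF \<tau> gen n_def zs finW W this dev', where R = R]
    obtain Gs where Gs: "length Gs = ?p" "\<forall>G\<in>set Gs. sp_truncated R xs G"
      "\<forall>w\<in>W. cmod (\<tau> (word_op (map (sp_op xs) Gs) w) - \<tau> (word_op zs w)) < \<epsilon>' / 2"
      "\<forall>j<n. cmod (\<tau> (dev_sq c (xs ! j) (sp_op xs (Gs ! j)) (sp_op xs (Gs ! (n + j))))) < \<eta>"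
      by blast
    define dp where "dp j = sp_dev c j (Gs ! j) (Gs ! (n + j))" for j
    \<comment> \<open>The traces to be controlled: those of words in the polynomials, which make
      \<open>f As\<close> a microstate, and those of the squared defects, which allow
      \<open>As\<close> to be recovered up to a small error.\<close>
    define P where "P = sp_word Gs ` W \<union> (\<lambda>j. SMul (sp_adj (dp j)) (dp j)) ` {..<n}"
    have "finite P"
      using finW by (simp add: P_def)
    moreover have "min (\<epsilon>' / 2) \<eta> > 0"
      using \<epsilon>' \<eta> by simp
    ultimately have "\<exists>m. \<exists>\<epsilon>>0. \<forall>p\<in>P. trace_close \<tau> xs R (min (\<epsilon>' / 2) \<eta>) m \<epsilon> p"
      by (intro finitely_many_traces_close[OF \<tau> SM xs])
    then obtain m \<epsilon> where m: "\<epsilon> > 0" "\<forall>p\<in>P. trace_close \<tau> xs R (min (\<epsilon>' / 2) \<eta>) m \<epsilon> p"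
      by blast
    have "orbit_covering_number k (microstates \<tau> xs R m k \<epsilon>) \<omega> \<le>
        orbit_covering_number k (microstates \<tau> zs 2 m' k \<epsilon>') \<omega>'"
      if k: "k \<ge> 1" and ne: "microstates \<tau> xs R m k \<epsilon> \<noteq> {}" for k
    proof -
      let ?\<Gamma> = "microstates \<tau> xs R m k \<epsilon>" and ?\<Gamma>' = "microstates \<tau> zs 2 m' k \<epsilon>'"
      define f where "f As = map (sp_mat k As) Gs" for As
      have tup: "As \<in> mat_tuples n k" "\<forall>A\<in>set As. mat_opnorm A \<le> R" if "As \<in> ?\<Gamma>" for As
        using that by (auto simp: microstates_def n_def)
      have close: "cmod (normalized_trace (sp_mat k As p) - \<tau> (sp_op xs p)) < min (\<epsilon>' / 2) \<eta>"
        if "As \<in> ?\<Gamma>" "p \<in> P" for As p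
        using m(2) k that unfolding trace_close_def by blast
      have f_mem: "f As \<in> ?\<Gamma>'" if As: "As \<in> ?\<Gamma>" for As
        unfolding microstates_def
      proof (intro CollectI conjI allI impI)
        show "f As \<in> mat_tuples (length zs) k"
          using sp_mat_carrier[OF tup(1)[OF As]] by (auto simp: f_def mat_tuples_def Gs(1))
        show "\<forall>A\<in>set (f As). mat_opnorm A \<le> 2"
          using Gs(2) tup[OF As] by (auto simp: f_def sp_truncated_def)
        fix w :: "(nat \<times> bool) list"
        assume w: "1 \<le> length w \<and> length w \<le> m' \<and> (\<forall>(i, s)\<in>set w. i < length zs)"
        then have wW: "w \<in> W"
          by (auto simp: W_def)
        have wp: "\<forall>(i, s)\<in>set w. i < length Gs"
          using w Gs(1) by simp
        have "cmod (normalized_trace (word_mat k (f As) w) - \<tau> (word_op (map (sp_op xs) Gs) w)) < \<epsilon>' / 2"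
          using close[OF As, of "sp_word Gs w"] wW by (simp add: P_def f_def sp_mat_word[OF tup(1)[OF As] wp] sp_op_word[OF lin wp])
        moreover have "cmod (\<tau> (word_op (map (sp_op xs) Gs) w) - \<tau> (word_op zs w)) < \<epsilon>' / 2"
          using Gs(3) wW by blast
        ultimately have "cmod (normalized_trace (word_mat k (f As) w) - \<tau> (word_op zs w)) < \<epsilon>' / 2 + \<epsilon>' / 2"
          by (rule norm_diff_triangle_less)
        then show "cmod (normalized_trace (word_mat k (f As) w) - \<tau> (word_op zs w)) < \<epsilon>'"
          by simp
      qed
      \<comment> \<open>One \<open>\<eta>\<close> for the defect at the operators and one for the
        error of the trace.\<close>
      have dev_small: "hs_sq (sp_mat k As (dp j)) \<le> 2 * \<eta>" if As: "As \<in> ?\<Gamma>" and j: "j < n" for As j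
      proof -
        have "sp_op xs (SMul (sp_adj (dp j)) (dp j)) = dev_sq c (xs ! j) (sp_op xs (Gs ! j)) (sp_op xs (Gs ! (n + j)))"
          using j by (simp add: dev_sq_def dp_def sp_op_dev sp_op_adj[OF lin] n_def)
        then have "cmod (\<tau> (sp_op xs (SMul (sp_adj (dp j)) (dp j)))) < \<eta>"
          using Gs(4) j by simp
        moreover have "cmod (normalized_trace (sp_mat k As (SMul (sp_adj (dp j)) (dp j))) - \<tau> (sp_op xs (SMul (sp_adj (dp j)) (dp j)))) < \<eta>"
          using close[OF As, of "SMul (sp_adj (dp j)) (dp j)"] j by (simp add: P_def)
        ultimately have "cmod (normalized_trace (sp_mat k As (SMul (sp_adj (dp j)) (dp j)))) \<le> 2 * \<eta>"
          using norm_triangle_sub[of "normalized_trace (sp_mat k As (SMul (sp_adj (dp j)) (dp j)))"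
              "\<tau> (sp_op xs (SMul (sp_adj (dp j)) (dp j)))"] by linarith
        then show ?thesis
          using complex_Re_le_cmod[of "normalized_trace (sp_mat k As (SMul (sp_adj (dp j)) (dp j)))"]
          by (simp add: hs_sq_def sp_mat_adj[OF tup(1)[OF As]])
      qed
      show ?thesis
      proof (rule orbit_covering_number_transfer[OF \<omega> \<omega>'(1) ne, where n = n and p = ?p and f = f])
        show "?\<Gamma> \<subseteq> mat_tuples n k"
          using tup by blast
        show "?\<Gamma>' \<subseteq> mat_tuples ?p k"
          by (auto simp: microstates_def)
        show "f ` ?\<Gamma> \<subseteq> ?\<Gamma>'"
          using f_mem by blast
        show "\<exists>C. finite C \<and> C \<subseteq> ?\<Gamma>' \<and> ?\<Gamma>' \<subseteq> (\<Union>Bs\<in>C. orbit_ball k Bs \<omega>')"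
          by (rule finite_orbit_cover_exists[where n = ?p and R = 2, OF _ \<omega>'(1)]) (auto simp: microstates_def)
        fix As Bs U
        assume As: "As \<in> ?\<Gamma>" and Bs: "Bs \<in> ?\<Gamma>" and U: "U \<in> unitary_group k"
          and less: "(\<Sum>l<?p. hs_sq (f As ! l - mat_conj U (f Bs ! l))) < 4 * \<omega>'\<^sup>2"
        define h where "h l = hs_sq (f As ! l - mat_conj U (f Bs ! l))" for l
        have uc: "U \<in> carrier_mat k k"
          using U by (auto simp: unitary_group_def)
        have f_nth: "f As ! l = sp_mat k As (Gs ! l)" "f Bs ! l = sp_mat k Bs (Gs ! l)" if "l < ?p" for l
          using that Gs(1) by (simp_all add: f_def)
        have h_nonneg: "h l \<ge> 0" if "l < ?p" for l
          unfolding h_def f_nth[OF that] using sp_mat_carrier[OF tup(1)[OF As]] sp_mat_carrier[OF tup(1)[OF Bs]] uc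
          by (intro hs_sq_nonneg[of _ k]) (simp add: minus_carrier_mat)
        have "hs_sq (As ! j - mat_conj U (Bs ! j)) \<le> 6 * (2 * \<eta>) + 8 * c\<^sup>2 * (h j + h (n + j))" if j: "j < n" for j
        proof -
          have jp: "j < ?p" "n + j < ?p"
            using j zs(3) by auto
          have len: "length As = n" "length Bs = n"
            using tup(1)[OF As] tup(1)[OF Bs] by (auto simp: mat_tuples_def)
          have D: "sp_mat k Cs (dp j) = Cs ! j + complex_of_real (- c) \<cdot>\<^sub>m (sp_mat k Cs (Gs ! j) + \<i> \<cdot>\<^sub>m sp_mat k Cs (Gs ! (n + j)))"
            if "length Cs = n" for Cs
            using that j by (simp add: dp_def sp_dev_def)
          show ?thesis
            unfolding h_def f_nth[OF jp(1)] f_nth[OF jp(2)]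
          proof (rule hs_sq_conj_transfer[OF _ _ _ _ _ _ U])
            show "hs_sq (As ! j + complex_of_real (- c) \<cdot>\<^sub>m (sp_mat k As (Gs ! j) + \<i> \<cdot>\<^sub>m sp_mat k As (Gs ! (n + j)))) \<le> 2 * \<eta>"
              using dev_small[OF As j] unfolding D[OF len(1)] .
            show "hs_sq (Bs ! j + complex_of_real (- c) \<cdot>\<^sub>m (sp_mat k Bs (Gs ! j) + \<i> \<cdot>\<^sub>m sp_mat k Bs (Gs ! (n + j)))) \<le> 2 * \<eta>"
              using dev_small[OF Bs j] unfolding D[OF len(2)] .
          qed (use sp_mat_carrier[OF tup(1)[OF As]] sp_mat_carrier[OF tup(1)[OF Bs]]
              mat_tuples_nth[OF tup(1)[OF As] j] mat_tuples_nth[OF tup(1)[OF Bs] j] in auto)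
        qed
        then have "(\<Sum>j<n. hs_sq (As ! j - mat_conj U (Bs ! j))) \<le> (\<Sum>j<n. 6 * (2 * \<eta>) + 8 * c\<^sup>2 * (h j + h (n + j)))"
          by (intro sum_mono) auto
        also have "\<dots> = 12 * real n * \<eta> + 8 * c\<^sup>2 * ((\<Sum>j<n. h j) + (\<Sum>j<n. h (n + j)))"
          by (simp add: sum.distrib flip: sum_distrib_left)
        also have "\<dots> \<le> 12 * real n * \<eta> + 8 * c\<^sup>2 * (4 * \<omega>'\<^sup>2 + 4 * \<omega>'\<^sup>2)"
        proof (intro add_left_mono mult_left_mono add_mono)
          have "(\<Sum>j<n. h j) \<le> (\<Sum>l<?p. h l)"
            using h_nonneg zs(3) by (intro sum_mono2) auto
          then show "(\<Sum>j<n. h j) \<le> 4 * \<omega>'\<^sup>2"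
            using less by (simp add: h_def)
          \<comment> \<open>The imaginary parts occupy the places \<open>n\<close> to
            \<open>2 * n - 1\<close>; like the block of real parts, they form a partial sum of
            nonnegative terms.\<close>
          have "(\<Sum>j<n. h (n + j)) = (\<Sum>l\<in>(+) n ` {..<n}. h l)"
            by (simp add: sum.reindex)
          also have "\<dots> \<le> (\<Sum>l<?p. h l)"
            using h_nonneg zs(3) by (intro sum_mono2) auto
          finally show "(\<Sum>j<n. h (n + j)) \<le> 4 * \<omega>'\<^sup>2"
            using less by (simp add: h_def)
        qed simp
        also have "\<dots> < \<omega>\<^sup>2"
        proof -
          have "24 * (real n + 1) \<noteq> 0"
            by (simp add: add_nonneg_eq_0_iff)
          then have "24 * (real n + 1) * \<eta> = \<omega>\<^sup>2"
            by (simp add: \<eta>_def)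
          then have "24 * (real n * \<eta>) + 24 * \<eta> = \<omega>\<^sup>2"
            by (simp add: algebra_simps)
          then have 1: "12 * real n * \<eta> \<le> \<omega>\<^sup>2 / 2"
            using \<eta> by simp
          have "(c * \<omega>')\<^sup>2 \<le> (\<omega> / 16)\<^sup>2"
            using \<omega>' c by (intro power_mono) (auto simp: field_simps)
          then have "c\<^sup>2 * \<omega>'\<^sup>2 \<le> \<omega>\<^sup>2 / 256"
            by (simp add: power_mult_distrib power_divide)
          moreover have "\<omega>\<^sup>2 > 0"
            using \<omega> by simp
          moreover have "8 * c\<^sup>2 * (4 * \<omega>'\<^sup>2 + 4 * \<omega>'\<^sup>2) = 64 * (c\<^sup>2 * \<omega>'\<^sup>2)"
            by simp
          ultimately show ?thesis
            using 1 by linarith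
        qed
        finally show "(\<Sum>l<n. hs_sq (As ! l - mat_conj U (Bs ! l))) < \<omega>\<^sup>2" .
      qed
    qed
    with m(1) show ?thesis
      by blast
  qed
  have "generates_vna zs (N i)"
    unfolding zs_def by (rule gens(3)[OF ys(2)])
  then show ?thesis
    using \<omega>'(1,2) by (rule that) (use main in blast)
qed

section \<open>The upper free orbit-dimension\<close>

lemma orbit_dim_at_cutoff_nonneg:
  assumes "0 < \<omega>" "\<omega> < 1"
  shows "orbit_dim_at_cutoff \<tau> xs \<omega> R \<ge> 0"
  unfolding orbit_dim_at_cutoff_def
proof (intro INF_greatest le_Limsup)
  fix m \<epsilon>
  have "ln (real p) \<ge> 0" for p
    using ln_real_nat_mono[of 0 p] by simp
  moreover have "- ((real k)\<^sup>2 * ln \<omega>) \<ge> 0" for k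
    using assms by (simp add: mult_nonneg_nonpos)
  ultimately show "eventually (\<lambda>k. 0 \<le> ereal (ln (real (orbit_covering_number k (microstates \<tau> xs R m k \<epsilon>) \<omega>)) /
      (- ((real k)\<^sup>2 * ln \<omega>)))) sequentially"
    by (intro always_eventually allI) (simp add: divide_nonneg_nonneg del: divide_minus_right)
qed simp

lemma upper_orbit_dim_zero_imp_cutoff:
  assumes "upper_orbit_dim_vna \<tau> N = 0" "generates_vna zs N" "0 < \<omega>" "\<omega> < 1" "0 < R"
  shows "orbit_dim_at_cutoff \<tau> zs \<omega> R \<le> 0"
proof -
  have "orbit_dim_at_cutoff \<tau> zs \<omega> R \<le> orbit_dim_at \<tau> zs \<omega>"
    unfolding orbit_dim_at_def using assms by (intro SUP_upper) auto
  also have "\<dots> \<le> upper_orbit_dim \<tau> zs"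
    unfolding upper_orbit_dim_def using assms by (intro SUP_upper) auto
  also have "\<dots> \<le> upper_orbit_dim_vna \<tau> N"
    unfolding upper_orbit_dim_vna_def using assms by (intro SUP_upper) auto
  finally show ?thesis
    using assms(1) by simp
qed

theorem theorem3:
  fixes M :: "('h::complex_hilbert_space \<Rightarrow>\<^sub>L 'h) set"
    and N :: "nat \<Rightarrow> ('h \<Rightarrow>\<^sub>L 'h) set"
    and \<tau> :: "('h \<Rightarrow>\<^sub>L 'h) \<Rightarrow> complex"
  assumes "von_neumann_algebra M"
    and "finitely_generated_vna M"
    and "tracial_state M \<tau>"
    and "\<And>i. von_neumann_algebra (N i)"
    and "\<And>i. N i \<subseteq> M"
    and "\<And>i. N i \<subseteq> N (Suc i)"
    and "\<And>i. finitely_generated_vna (N i)"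
    and "\<And>i. upper_orbit_dim_vna \<tau> (N i) = 0"
    and "M = strong_operator_topology closure_of (\<Union>i. N i)"
  shows "upper_orbit_dim_vna \<tau> M = 0"
proof (rule antisym)
  have cutoff: "orbit_dim_at_cutoff \<tau> xs \<omega> R \<le> 0"
    if gen: "generates_vna xs M" and \<omega>: "0 < \<omega>" "\<omega> < 1" for xs \<omega> R
  proof (rule ereal_le_epsilon2)
    fix \<delta> :: real assume \<delta>: "0 < \<delta>"
    obtain zs i \<omega>' where zs: "generates_vna zs (N i)" and \<omega>': "0 < \<omega>'" "\<omega>' < \<omega>"
      and cover: "\<forall>m'. \<forall>\<epsilon>'>0. \<exists>m. \<exists>\<epsilon>>0. \<forall>k\<ge>1. microstates \<tau> xs R m k \<epsilon> \<noteq> {} \<longrightarrow>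
        orbit_covering_number k (microstates \<tau> xs R m k \<epsilon>) \<omega> \<le>
        orbit_covering_number k (microstates \<tau> zs 2 m' k \<epsilon>') \<omega>'"
      by (rule microstate_covering_bound[where R = R, OF assms(1,3) gen assms(4-7) equalityD1[OF assms(9)] \<omega>(1)])
    define L L' where "L = - ln \<omega>" and "L' = - ln \<omega>'"
    have L: "L > 0" "L' > 0"
      using \<omega> \<omega>' by (simp_all add: L_def L'_def)
    \<comment> \<open>The quotients for \<open>xs\<close> and \<open>zs\<close> are normalised by
      \<open>L\<close> and \<open>L'\<close>. Their ratio is fixed before \<open>m'\<close> and
      \<open>\<epsilon>'\<close> are chosen, and dimension 0 lies below any positive bound.\<close>
    define \<delta>' where "\<delta>' = \<delta> * L / L'"
    have \<delta>': "\<delta>' > 0"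
      using \<delta> L by (simp add: \<delta>'_def)
    define F where "F m' \<epsilon>' k = ln (real (orbit_covering_number k (microstates \<tau> zs 2 m' k \<epsilon>') \<omega>')) /
        (- ((real k)\<^sup>2 * ln \<omega>'))" for m' \<epsilon>' k
    have "orbit_dim_at_cutoff \<tau> zs \<omega>' 2 < ereal \<delta>'"
    proof (rule order_le_less_trans)
      show "orbit_dim_at_cutoff \<tau> zs \<omega>' 2 \<le> 0"
        using \<omega> \<omega>' by (intro upper_orbit_dim_zero_imp_cutoff[OF assms(8) zs]) auto
      show "0 < ereal \<delta>'"
        using \<delta>' by simp
    qed
    then have "\<exists>m'\<in>UNIV. \<exists>\<epsilon>'\<in>{0<..}. limsup (\<lambda>k. ereal (F m' \<epsilon>' k)) < ereal \<delta>'"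
      unfolding orbit_dim_at_cutoff_def F_def[symmetric] INF_less_iff .
    then obtain m' \<epsilon>' where "\<epsilon>' \<in> {0<..}" and lim: "limsup (\<lambda>k. ereal (F m' \<epsilon>' k)) < ereal \<delta>'"
      by (elim bexE)
    then have \<epsilon>': "\<epsilon>' > 0"
      by simp
    obtain m \<epsilon> where \<epsilon>: "\<epsilon> > 0" and le: "\<forall>k\<ge>1. microstates \<tau> xs R m k \<epsilon> \<noteq> {} \<longrightarrow>
        orbit_covering_number k (microstates \<tau> xs R m k \<epsilon>) \<omega> \<le>
        orbit_covering_number k (microstates \<tau> zs 2 m' k \<epsilon>') \<omega>'"
      using cover \<epsilon>' by blast
    define E where "E k = ln (real (orbit_covering_number k (microstates \<tau> xs R m k \<epsilon>) \<omega>)) /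
        (- ((real k)\<^sup>2 * ln \<omega>))" for k
    have "eventually (\<lambda>k. E k \<le> \<delta>) sequentially"
      using Limsup_lessD[OF lim] eventually_ge_at_top[of 1]
    proof eventually_elim
      case (elim k)
      let ?\<nu> = "orbit_covering_number k (microstates \<tau> xs R m k \<epsilon>) \<omega>"
        and ?\<nu>' = "orbit_covering_number k (microstates \<tau> zs 2 m' k \<epsilon>') \<omega>'"
      have kL: "(real k)\<^sup>2 * L > 0" "(real k)\<^sup>2 * L' > 0"
        using elim(2) L by simp_all
      have "F m' \<epsilon>' k = ln (real ?\<nu>') / ((real k)\<^sup>2 * L')"
        by (simp add: F_def L'_def)
      then have "ln (real ?\<nu>') < \<delta>' * ((real k)\<^sup>2 * L')"
        using elim(1) kL(2) by (simp add: pos_divide_less_eq)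
      also have "\<dots> = \<delta> * ((real k)\<^sup>2 * L)"
        using L by (simp add: \<delta>'_def)
      finally have \<nu>': "ln (real ?\<nu>') < \<delta> * ((real k)\<^sup>2 * L)" .
      have "ln (real ?\<nu>) \<le> \<delta> * ((real k)\<^sup>2 * L)"
      proof (cases "microstates \<tau> xs R m k \<epsilon> = {}")
        \<comment> \<open>The empty set has covering number 1 by convention, hence logarithm
          0.\<close>
        case True
        then show ?thesis
          using \<delta> kL(1) by (simp add: orbit_covering_number_def)
      next
        case False
        then have "?\<nu> \<le> ?\<nu>'"
          using le elim(2) by blast
        from ln_real_nat_mono[OF this] show ?thesis
          using \<nu>' by linarith
      qed
      moreover have "E k = ln (real ?\<nu>) / ((real k)\<^sup>2 * L)"
        by (simp add: E_def L_def)
      ultimately show "E k \<le> \<delta>"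
        using kL(1) by (simp add: pos_divide_le_eq)
    qed
    then have "limsup (\<lambda>k. ereal (E k)) \<le> ereal \<delta>"
      by (intro Limsup_bounded) simp
    moreover have "orbit_dim_at_cutoff \<tau> xs \<omega> R \<le> limsup (\<lambda>k. ereal (E k))"
      unfolding orbit_dim_at_cutoff_def E_def using \<epsilon> by (intro INF_lower2[of m] INF_lower) auto
    ultimately show "orbit_dim_at_cutoff \<tau> xs \<omega> R \<le> 0 + ereal \<delta>"
      by simp
  qed
  show "upper_orbit_dim_vna \<tau> M \<le> 0"
    unfolding upper_orbit_dim_vna_def upper_orbit_dim_def orbit_dim_at_def
    by (intro SUP_least) (auto intro: cutoff)
  \<comment> \<open>Finite generation supplies a generating family, so the supremum is not taken
    over the empty set, where it would be minus infinity.\<close>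
  obtain xs where xs: "generates_vna xs M"
    using assms(2) unfolding finitely_generated_vna_def by blast
  have "0 \<le> orbit_dim_at_cutoff \<tau> xs (1/2) 1"
    by (rule orbit_dim_at_cutoff_nonneg) simp_all
  also have "\<dots> \<le> orbit_dim_at \<tau> xs (1/2)"
    unfolding orbit_dim_at_def by (intro SUP_upper) simp
  also have "\<dots> \<le> upper_orbit_dim \<tau> xs"
    unfolding upper_orbit_dim_def by (intro SUP_upper) simp
  also have "\<dots> \<le> upper_orbit_dim_vna \<tau> M"
    unfolding upper_orbit_dim_vna_def using xs by (intro SUP_upper) simp
  finally show "0 \<le> upper_orbit_dim_vna \<tau> M" .
qed

end
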